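(* Let $(W,S)$ be a finitely generated Coxeter system and let $C$ be a building with Weyl group $W$ (no thickness or local finiteness is assumed). Then the asymptotic dimension of $C$ is finite and equal to the asymptotic dimension of an apartment in $C$. Here $C$ may be understood either as the discrete metric space $(C,\delta)$ with the gallery distance, an apartment then being isometric to $(W,\delta)$, or as the $CAT(0)$ metric space $(|C|,d)$ (Davis realization), an apartment then being isometric to the Davis complex $(|W|,d)$.
   Context: Coxeter system: $(W,S)$ with $S$ finite; $\ell(w)$ is the word length of $w\in W$ with respect to $S$. Building: a building with Weyl group $W$ is a nonempty set $C$ (whose elements are called chambers) with, for each $s\in S$, an equivalence relation on $C$ ($s$-equivalence) all of whose classes have at least two elements, together with a $W$-valued distance $\delta_C: C\times C\to W$ such that for every reduced word $s_1\cdots s_k$ in $S$ and all chambers $c,c'$: $\delta_C(c,c')=s_1\cdots s_k$ if and only if there is a gallery of type $(s_1,\dots,s_k)$ from $c$ to $c'$. Two distinct chambers are adjacent (more precisely $s$-adjacent) if they are $s$-equivalent for some $s\in S$. A gallery is a finite sequence of chambers in which consecutive ones are adjacent; its type records the $s$'s of the successive adjacencies. The gallery distance is $\delta(c,c')=\ell(\delta_C(c,c'))$. The Coxeter group $W$ is itself a building (the abstract Coxeter complex) with $\delta_W(w,w')=w^{-1}w'$, so that $w$ and $ws$ are $s$-adjacent. An apartment in $C$ is the image of a map $W\to C$ preserving the $W$-valued distance. Davis realization: let $K$ be the geometric realization (order complex) of the poset, ordered by inclusion, of subsets $T\subseteq S$ (including $\emptyset$) generating a finite subgroup $W_T$; for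 $s\in S$ let $K_s\subseteq K$ be the subcomplex spanned by those $T$ containing $s$. For $x\in K$ put $S(x)=\{s\in S: x\in K_s\}$. Then $|C|=(C\times K)/\sim$, where $(c,x)\sim(c',x')$ iff $x=x'$ and $\delta_C(c,c')\in W_{S(x)}$. For a chamber $c$, $|c|$ denotes the image of $\{c\}\times K$. The space $|C|$ carries its standard (Moussong) piecewise Euclidean length metric $d$: for each $T$ with $W_T$ finite, the subcomplex of $K$ spanned by the subsets of $T$ is identified with the intersection of the closed fundamental chamber of the canonical orthogonal representation of $W_T$ on $\mathbb{R}^T$ with the convex hull of the $W_T$-orbit of the point of the open fundamental chamber at distance $1$ from all its walls. With this metric $|C|$ is a $CAT(0)$ space, quasi-isometric to $(C,\delta)$. $|W|$ is the Davis realization of $W$ itself (the Davis complex). Asymptotic dimension: a metric space $X$ has asymptotic dimension $\le n$ if for every $r>0$ there exist $n+1$ families $\mathcal{U}^0,\ldots,\mathcal{U}^n$ of subsets of $X$ such that (1) $\bigcup_i\mathcal{U}^i$ is a uniformly bounded cover of $X$, and (2) for every $i$ any two distinct sets $U,U'\in\mathcal{U}^i$ satisfy $\inf\{\operatorname{dist}(x,y)\mid x\in U,\ y\in U'\}\ge r$. The asymptotic dimension of $X$ is the least such $n$ ($\infty$ if none exists). *)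

theory Defs
  imports
    "HOL-Analysis.Analysis"
    "HOL-Algebra.Multiplicative_Group"
    "HOL-Algebra.Generated_Groups"
begin

section \<open>Asymptotic dimension\<close>

definition asdim_le :: "'a set \<Rightarrow> ('a \<Rightarrow> 'a \<Rightarrow> real) \<Rightarrow> nat \<Rightarrow> bool" where
  "asdim_le X d n \<longleftrightarrow>
     (\<forall>r>0. \<exists>\<U> :: nat \<Rightarrow> 'a set set.
        (\<Union>i\<le>n. \<Union>(\<U> i)) = X \<and>
        (\<exists>D. \<forall>i\<le>n. \<forall>U\<in>\<U> i. \<forall>x\<in>U. \<forall>y\<in>U. d x y \<le> D) \<and>
        (\<forall>i\<le>n. \<forall>U\<in>\<U> i. \<forall>V\<in>\<U> i. U \<noteq> V \<longrightarrow> (\<forall>x\<in>U. \<forall>y\<in>V. r \<le> d x y)))"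

text \<open>The infimum of the empty set in \<^typ>\<open>enat\<close> is \<^term>\<open>\<infinity>\<close>.\<close>

definition asdim :: "'a set \<Rightarrow> ('a \<Rightarrow> 'a \<Rightarrow> real) \<Rightarrow> enat" where
  "asdim X d = Inf (enat ` {n. asdim_le X d n})"

definition isometric :: "'a set \<Rightarrow> ('a \<Rightarrow> 'a \<Rightarrow> real) \<Rightarrow> 'b set \<Rightarrow> ('b \<Rightarrow> 'b \<Rightarrow> real) \<Rightarrow> bool" where
  "isometric X d Y e \<longleftrightarrow>
     (\<exists>f. bij_betw f X Y \<and> (\<forall>x\<in>X. \<forall>y\<in>X. e (f x) (f y) = d x y))"


section \<open>Coxeter systems\<close>

definition word_prod :: "('w, 'm) monoid_scheme \<Rightarrow> 'w list \<Rightarrow> 'w" where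
  "word_prod W ws = foldr (\<otimes>\<^bsub>W\<^esub>) ws \<one>\<^bsub>W\<^esub>"

text \<open>If \<open>s t\<close> has infinite order, then \<^const>\<open>group.ord\<close> is \<open>0\<close>.\<close>

definition cox_m :: "('w, 'm) monoid_scheme \<Rightarrow> 'w \<Rightarrow> 'w \<Rightarrow> nat" where
  "cox_m W s t = group.ord W (s \<otimes>\<^bsub>W\<^esub> t)"

text \<open>The congruence on words over \<open>S\<close> generated by the relations \<open>(s t)\<^sup>m = 1\<close>,
  where \<open>m = cox_m W s t\<close>; the relation is void if \<open>m = 0\<close>. When the elements of \<open>S\<close>
  are involutions, the case \<open>s = t\<close> is the relation \<open>s s = 1\<close>, so the quotient monoid is
  the group presented by these generators and relations.\<close>

inductive cox_cong :: "('w, 'm) monoid_scheme \<Rightarrow> 'w set \<Rightarrow> 'w list \<Rightarrow> 'w list \<Rightarrow> bool"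
  for W S where
    refl: "us \<in> lists S \<Longrightarrow> cox_cong W S us us"
  | sym: "cox_cong W S us vs \<Longrightarrow> cox_cong W S vs us"
  | trans: "cox_cong W S us vs \<Longrightarrow> cox_cong W S vs ws \<Longrightarrow> cox_cong W S us ws"
  | append: "cox_cong W S us us' \<Longrightarrow> cox_cong W S vs vs' \<Longrightarrow> cox_cong W S (us @ vs) (us' @ vs')"
  | braid: "s \<in> S \<Longrightarrow> t \<in> S \<Longrightarrow> cox_cong W S (concat (replicate (cox_m W s t) [s, t])) []"

locale coxeter_system = group W
  for W :: "('w, 'm) monoid_scheme" +
  fixes S :: "'w set"
  assumes generators: "S \<subseteq> carrier W" "generate W S = carrier W"
    and involutions: "s \<in> S \<Longrightarrow> group.ord W s = 2"
    and presentation: "us \<in> lists S \<Longrightarrow> vs \<in> lists S \<Longrightarrow>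
      word_prod W us = word_prod W vs \<Longrightarrow> cox_cong W S us vs"

definition cox_length :: "('w, 'm) monoid_scheme \<Rightarrow> 'w set \<Rightarrow> 'w \<Rightarrow> nat" where
  "cox_length W S w = (LEAST n. \<exists>ws\<in>lists S. length ws = n \<and> word_prod W ws = w)"

definition reduced_word :: "('w, 'm) monoid_scheme \<Rightarrow> 'w set \<Rightarrow> 'w list \<Rightarrow> bool" where
  "reduced_word W S ws \<longleftrightarrow> ws \<in> lists S \<and> cox_length W S (word_prod W ws) = length ws"

definition cox_dist :: "('w, 'm) monoid_scheme \<Rightarrow> 'w \<Rightarrow> 'w \<Rightarrow> 'w" where
  "cox_dist W v w = inv\<^bsub>W\<^esub> v \<otimes>\<^bsub>W\<^esub> w"


section \<open>Buildings\<close>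

text \<open>\<open>E s\<close> is \<open>s\<close>-equivalence; \<open>cs\<close> lists the chambers of the gallery and \<open>ws\<close> is its type.\<close>

definition gallery :: "'c set \<Rightarrow> ('w \<Rightarrow> ('c \<times> 'c) set) \<Rightarrow> 'w list \<Rightarrow> 'c list \<Rightarrow> bool" where
  "gallery C E ws cs \<longleftrightarrow>
     set cs \<subseteq> C \<and> length cs = Suc (length ws) \<and>
     (\<forall>i<length ws. cs ! i \<noteq> cs ! Suc i \<and> (cs ! i, cs ! Suc i) \<in> E (ws ! i))"

locale building = coxeter_system W S
  for W :: "('w, 'm) monoid_scheme" and S :: "'w set" +
  fixes C :: "'c set"
    and E :: "'w \<Rightarrow> ('c \<times> 'c) set"
    and \<delta> :: "'c \<Rightarrow> 'c \<Rightarrow> 'w"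
  assumes nonempty: "C \<noteq> {}"
    and equivalence: "s \<in> S \<Longrightarrow> equiv C (E s)"
    and panels: "s \<in> S \<Longrightarrow> P \<in> C // E s \<Longrightarrow> \<exists>c\<in>P. \<exists>c'\<in>P. c \<noteq> c'"
    and dist_closed: "c \<in> C \<Longrightarrow> c' \<in> C \<Longrightarrow> \<delta> c c' \<in> carrier W"
    and dist_gallery: "reduced_word W S ws \<Longrightarrow> c \<in> C \<Longrightarrow> c' \<in> C \<Longrightarrow>
      \<delta> c c' = word_prod W ws \<longleftrightarrow> (\<exists>cs. gallery C E ws cs \<and> hd cs = c \<and> last cs = c')"

definition gallery_dist ::
    "('w, 'm) monoid_scheme \<Rightarrow> 'w set \<Rightarrow> ('c \<Rightarrow> 'c \<Rightarrow> 'w) \<Rightarrow> 'c \<Rightarrow> 'c \<Rightarrow> real" where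
  "gallery_dist W S \<delta> c c' = real (cox_length W S (\<delta> c c'))"

definition apartment ::
    "('w, 'm) monoid_scheme \<Rightarrow> 'c set \<Rightarrow> ('c \<Rightarrow> 'c \<Rightarrow> 'w) \<Rightarrow> 'c set \<Rightarrow> bool" where
  "apartment W C \<delta> A \<longleftrightarrow>
     (\<exists>f \<in> carrier W \<rightarrow> C.
        (\<forall>v\<in>carrier W. \<forall>w\<in>carrier W. \<delta> (f v) (f w) = cox_dist W v w) \<and> A = f ` carrier W)"


section \<open>The Davis realization as a set\<close>

definition spherical :: "('w, 'm) monoid_scheme \<Rightarrow> 'w set \<Rightarrow> 'w set set" where
  "spherical W S = {T. T \<subseteq> S \<and> finite (generate W T)}"

text \<open>A point of the order complex is given by its barycentric coordinates
  \<open>x :: 'w set \<Rightarrow> real\<close>; its support is the vertex set of the simplex carrying it.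
  The support is automatically finite, since the sum would be \<open>0\<close> otherwise.\<close>

definition supp :: "('w set \<Rightarrow> real) \<Rightarrow> 'w set set" where
  "supp x = {T. x T \<noteq> 0}"

definition davis_K :: "('w, 'm) monoid_scheme \<Rightarrow> 'w set \<Rightarrow> ('w set \<Rightarrow> real) set" where
  "davis_K W S = {x. subset.chain (spherical W S) (supp x) \<and> (\<forall>T. 0 \<le> x T) \<and> sum x (supp x) = 1}"

definition davis_mirror :: "('w, 'm) monoid_scheme \<Rightarrow> 'w set \<Rightarrow> 'w \<Rightarrow> ('w set \<Rightarrow> real) set" where
  "davis_mirror W S s = {x \<in> davis_K W S. \<forall>T\<in>supp x. s \<in> T}"

definition davis_type ::
    "('w, 'm) monoid_scheme \<Rightarrow> 'w set \<Rightarrow> ('w set \<Rightarrow> real) \<Rightarrow> 'w set" where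
  "davis_type W S x = {s \<in> S. x \<in> davis_mirror W S s}"

definition davis_rel ::
    "('w, 'm) monoid_scheme \<Rightarrow> 'w set \<Rightarrow> 'c set \<Rightarrow> ('c \<Rightarrow> 'c \<Rightarrow> 'w) \<Rightarrow>
     (('c \<times> ('w set \<Rightarrow> real)) \<times> ('c \<times> ('w set \<Rightarrow> real))) set" where
  "davis_rel W S C \<delta> =
     {((c, x), (c', x')). c \<in> C \<and> c' \<in> C \<and> x \<in> davis_K W S \<and> x = x' \<and>
        \<delta> c c' \<in> generate W (davis_type W S x)}"

definition davis ::
    "('w, 'm) monoid_scheme \<Rightarrow> 'w set \<Rightarrow> 'c set \<Rightarrow> ('c \<Rightarrow> 'c \<Rightarrow> 'w) \<Rightarrow>
     ('c \<times> ('w set \<Rightarrow> real)) set set" where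
  "davis W S C \<delta> = (C \<times> davis_K W S) // davis_rel W S C \<delta>"

definition davis_pt ::
    "('w, 'm) monoid_scheme \<Rightarrow> 'w set \<Rightarrow> 'c set \<Rightarrow> ('c \<Rightarrow> 'c \<Rightarrow> 'w) \<Rightarrow>
     'c \<Rightarrow> ('w set \<Rightarrow> real) \<Rightarrow> ('c \<times> ('w set \<Rightarrow> real)) set" where
  "davis_pt W S C \<delta> c x = davis_rel W S C \<delta> `` {(c, x)}"

definition davis_chamber ::
    "('w, 'm) monoid_scheme \<Rightarrow> 'w set \<Rightarrow> 'c set \<Rightarrow> ('c \<Rightarrow> 'c \<Rightarrow> 'w) \<Rightarrow>
     'c \<Rightarrow> ('c \<times> ('w set \<Rightarrow> real)) set set" where
  "davis_chamber W S C \<delta> c = davis_pt W S C \<delta> c ` davis_K W S"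


section \<open>The piecewise Euclidean metric\<close>

text \<open>For spherical \<open>T\<close>, the space \<open>\<real>\<^sup>T\<close> is rendered by functions \<open>'w \<Rightarrow> real\<close> vanishing
  outside \<open>T\<close>. Its Euclidean structure is the canonical form
  \<open>B(e\<^sub>s, e\<^sub>t) = - cos (\<pi> / m(s,t))\<close>, which is positive definite for spherical \<open>T\<close> and
  invariant under the reflections \<open>\<sigma>\<^sub>s v = v - 2 B(e\<^sub>s, v) e\<^sub>s\<close> by which \<open>W\<^sub>T\<close> acts.
  The \<open>e\<^sub>s\<close> are unit vectors and the closed fundamental chamber is
  \<open>{v. \<forall>s\<in>T. 0 \<le> B(e\<^sub>s, v)}\<close>, so \<open>B(e\<^sub>s, v)\<close> is the distance of a chamber point \<open>v\<close>
  from the wall of \<open>s\<close>.\<close>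

definition cox_form ::
    "('w, 'm) monoid_scheme \<Rightarrow> 'w set \<Rightarrow> ('w \<Rightarrow> real) \<Rightarrow> ('w \<Rightarrow> real) \<Rightarrow> real" where
  "cox_form W T u v = (\<Sum>s\<in>T. \<Sum>t\<in>T. - cos (pi / real (cox_m W s t)) * u s * v t)"

definition root_vec :: "'w \<Rightarrow> 'w \<Rightarrow> real" where
  "root_vec s = (\<lambda>t. if t = s then 1 else 0)"

definition cox_refl :: "('w, 'm) monoid_scheme \<Rightarrow> 'w set \<Rightarrow> 'w \<Rightarrow> ('w \<Rightarrow> real) \<Rightarrow> 'w \<Rightarrow> real" where
  "cox_refl W T s v = (\<lambda>t. v t - 2 * cox_form W T (root_vec s) v * root_vec s t)"

definition base_point :: "('w, 'm) monoid_scheme \<Rightarrow> 'w set \<Rightarrow> 'w \<Rightarrow> real" where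
  "base_point W T =
     (THE v. (\<forall>s. s \<notin> T \<longrightarrow> v s = 0) \<and> (\<forall>s\<in>T. cox_form W T (root_vec s) v = 1))"

definition face_orbit :: "('w, 'm) monoid_scheme \<Rightarrow> 'w set \<Rightarrow> 'w set \<Rightarrow> ('w \<Rightarrow> real) set" where
  "face_orbit W T U = (\<lambda>ws. foldr (cox_refl W T) ws (base_point W T)) ` lists U"

definition face_centre :: "('w, 'm) monoid_scheme \<Rightarrow> 'w set \<Rightarrow> 'w set \<Rightarrow> 'w \<Rightarrow> real" where
  "face_centre W T U =
     (\<lambda>t. (\<Sum>v\<in>face_orbit W T U. v t) / real (card (face_orbit W T U)))"

text \<open>The subcomplex of \<open>K\<close> spanned by the subsets of \<open>T\<close> is embedded in \<open>\<real>\<^sup>T\<close> by sending the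
  vertex \<open>U \<subseteq> T\<close> to the centre of the face of the polytope \<open>conv (W\<^sub>T x\<^sub>T)\<close> with vertex set
  \<open>W\<^sub>U x\<^sub>T\<close>, where \<open>x\<^sub>T\<close> is the base point, and extending affinely over simplices: so \<open>\<emptyset>\<close> goes to
  \<open>x\<^sub>T\<close> and \<open>T\<close> to \<open>0\<close>. This restricts the barycentric subdivision of the polytope to the
  closed fundamental chamber, so the image is the intersection of that chamber with
  \<open>conv (W\<^sub>T x\<^sub>T)\<close>.\<close>

definition davis_block ::
    "('w, 'm) monoid_scheme \<Rightarrow> 'w set \<Rightarrow> 'w set \<Rightarrow> ('w set \<Rightarrow> real) set" where
  "davis_block W S T = {x \<in> davis_K W S. supp x \<subseteq> Pow T}"

definition block_embed ::
    "('w, 'm) monoid_scheme \<Rightarrow> 'w set \<Rightarrow> ('w set \<Rightarrow> real) \<Rightarrow> 'w \<Rightarrow> real" where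
  "block_embed W T x = (\<lambda>t. \<Sum>U\<in>Pow T. x U * face_centre W T U t)"

definition block_dist ::
    "('w, 'm) monoid_scheme \<Rightarrow> 'w set \<Rightarrow> ('w set \<Rightarrow> real) \<Rightarrow> ('w set \<Rightarrow> real) \<Rightarrow> real" where
  "block_dist W T x y =
     (let v = (\<lambda>t. block_embed W T x t - block_embed W T y t) in sqrt (cox_form W T v v))"

text \<open>The length metric is the infimum of the lengths of strings (broken geodesics) from
  \<open>p\<close> to \<open>q\<close>, consecutive points of which lie in a common Euclidean block of some \<open>|c|\<close>.\<close>

inductive davis_string ::
    "('w, 'm) monoid_scheme \<Rightarrow> 'w set \<Rightarrow> 'c set \<Rightarrow> ('c \<Rightarrow> 'c \<Rightarrow> 'w) \<Rightarrow>
     ('c \<times> ('w set \<Rightarrow> real)) set \<Rightarrow> ('c \<times> ('w set \<Rightarrow> real)) set \<Rightarrow> real \<Rightarrow> bool"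
  for W S C \<delta> where
    base: "p \<in> davis W S C \<delta> \<Longrightarrow> davis_string W S C \<delta> p p 0"
  | step: "davis_string W S C \<delta> p (davis_pt W S C \<delta> c x) l \<Longrightarrow>
      c \<in> C \<Longrightarrow> T \<in> spherical W S \<Longrightarrow> x \<in> davis_block W S T \<Longrightarrow> y \<in> davis_block W S T \<Longrightarrow>
      davis_string W S C \<delta> p (davis_pt W S C \<delta> c y) (l + block_dist W T x y)"

definition davis_dist ::
    "('w, 'm) monoid_scheme \<Rightarrow> 'w set \<Rightarrow> 'c set \<Rightarrow> ('c \<Rightarrow> 'c \<Rightarrow> 'w) \<Rightarrow>
     ('c \<times> ('w set \<Rightarrow> real)) set \<Rightarrow> ('c \<times> ('w set \<Rightarrow> real)) set \<Rightarrow> real" where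
  "davis_dist W S C \<delta> p q = Inf {l. davis_string W S C \<delta> p q l}"

end

theory Submission
  imports Defs "Jordan_Normal_Form.Char_Poly"
begin

text \<open>
  The reflections separating two chambers of the Coxeter complex form the walls between them, and
  their number is the gallery distance. A reflection acts on the canonical representation by a
  matrix over an order in the real numbers, and the reduction of this matrix modulo a large integer
  colours the walls with finitely many colours. Two crossing walls cross in a finite dihedral
  residue, so the product of their reflections acts as a nontrivial rotation of finite order, which
  is not the identity modulo that integer: they have different colours. The walls of one colour are
  therefore nested, so they are dual to a tree, and the group embeds isometrically
  into a finite product of trees.

  For a building, consider the retraction \<open>c \<mapsto> \<delta> c0 c\<close> from a chamber \<open>c0\<close>, which is 1-Lipschitz. The
  ball of radius \<open>R\<close> around \<open>w\<close> in \<open>W\<close> lies in a cone of the weak order whose apex \<open>v\<close> is at bounded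
  distance from \<open>w\<close>. Chambers joined by a gallery over this cone are reached from \<open>c0\<close> through the
  same chamber over \<open>v\<close>. Hence the preimage of a bounded set splits into bounded pieces that are far
  from each other, and a cover of \<open>W\<close> lifts to the building with the same number of families.

  The Davis realization is quasi-isometric to the set of chambers: the distance of a point from the
  walls of its chamber is 1-Lipschitz, by the Cauchy-Schwarz inequality for the positive definite
  canonical form, and the walls close to a point generate a finite subgroup. Apartments embed
  isometrically because the inclusion and the retraction map strings to strings of equal length.
\<close>

section \<open>Walls and reflections\<close>

text \<open>Finiteness and equality are proved separately. The product of trees gives only a crude
  bound, \<open>card (Pow I)\<close> for a set \<open>I\<close> of colours; the equality comes from
  lifting a cover with the same \<open>n\<close>, and from an apartment, built by Zorn's lemma, for
  the converse inequality. The obstacle in the lifting is uniformity. Every ball lies in the cone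
  with apex 1; the point is to bound the distance from the centre to the apex independently of the
  centre. An apex that cannot be moved closer has only descents with short conjugates. Elements with
  prescribed short conjugates differ by elements centralizing a set of generators, and
  \<open>descents_bound\<close> controls these by enlarging that set. The obstacle in the colouring
  is that matrix entries are not integers. They lie in a ring spanned over the integers by finitely
  many numbers \<open>2 * cos (k * pi / M)\<close>. Residues modulo \<open>N\<close> are therefore
  finite in number, while the nonzero algebraic integer \<open>2 * cos (2 * k * pi / m) - 2\<close>,
  which measures a rotation against the identity, is not divisible by \<open>N\<close> once
  \<open>N\<close> is large.\<close>

declare in_lists_conv_set [simp]

lemma sum_lessThan_add_split:
  "(\<Sum>j<a+b. f j) = (\<Sum>j<a. f j) + (\<Sum>j<b. f (a+j::nat) :: nat)"
  by (induction b) (auto simp: algebra_simps)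

context coxeter_system begin

abbreviation mul (infixl "\<cdot>" 70) where "x \<cdot> y \<equiv> x \<otimes>\<^bsub>W\<^esub> y"
abbreviation iv where "iv x \<equiv> inv\<^bsub>W\<^esub> x"
abbreviation G where "G \<equiv> carrier W"
abbreviation unit1 ("\<epsilon>") where "\<epsilon> \<equiv> \<one>\<^bsub>W\<^esub>"
abbreviation wp where "wp ws \<equiv> word_prod W ws"
abbreviation len where "len w \<equiv> cox_length W S w"

lemma S_closed [simp, intro]: "s \<in> S \<Longrightarrow> s \<in> G"
  using generators by auto

lemma S_sq [simp]: assumes "s \<in> S" shows "s \<cdot> s = \<epsilon>"
proof -
  have "s [^]\<^bsub>W\<^esub> (2::nat) = \<epsilon>"
    using pow_ord_eq_1[of s] involutions[OF assms] assms by auto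
  then show ?thesis using assms by (simp add: numeral_2_eq_2 nat_pow_Suc)
qed

lemma S_inv [simp]: "s \<in> S \<Longrightarrow> iv s = s"
  using S_sq inv_equality S_closed by blast

lemma S_neq1: "s \<in> S \<Longrightarrow> s \<noteq> \<epsilon>"
  using involutions ord_id by fastforce

lemma cancel_inv_l [simp]: "x \<in> G \<Longrightarrow> y \<in> G \<Longrightarrow> iv x \<cdot> (x \<cdot> y) = y"
  by (metis inv_closed l_inv l_one m_assoc)

lemma cancel_inv_r [simp]: "x \<in> G \<Longrightarrow> y \<in> G \<Longrightarrow> x \<cdot> (iv x \<cdot> y) = y"
  by (metis inv_closed r_inv l_one m_assoc)

lemma S_cancel [simp]: "s \<in> S \<Longrightarrow> y \<in> G \<Longrightarrow> s \<cdot> (s \<cdot> y) = y"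
  by (metis S_closed S_sq l_one m_assoc)

lemma S_conj_eq: "s \<in> S \<Longrightarrow> r \<in> G \<Longrightarrow> t \<in> G \<Longrightarrow> s \<cdot> r \<cdot> s = t \<longleftrightarrow> r = s \<cdot> t \<cdot> s"
  by (auto simp: m_assoc)

lemmas grp = m_assoc inv_mult_group

lemma word_prod_Nil [simp]: "wp [] = \<epsilon>"
  by (simp add: word_prod_def)

lemma word_prod_Cons [simp]: "wp (s # ws) = s \<cdot> wp ws"
  by (simp add: word_prod_def)

lemma word_prod_closed [simp, intro]: "ws \<in> lists S \<Longrightarrow> wp ws \<in> G"
  by (induction ws) auto

lemma word_prod_append [simp]:
  "us \<in> lists S \<Longrightarrow> vs \<in> lists S \<Longrightarrow> wp (us @ vs) = wp us \<cdot> wp vs"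
  by (induction us) (auto simp: m_assoc)

lemma word_prod_rev: "ws \<in> lists S \<Longrightarrow> wp (rev ws) = iv (wp ws)"
  by (induction ws) (auto simp: inv_mult_group)

lemma generate_words:
  assumes "T \<subseteq> S" shows "generate W T = wp ` lists T"
proof
  show "generate W T \<subseteq> wp ` lists T"
  proof
    fix g assume "g \<in> generate W T"
    then show "g \<in> wp ` lists T"
    proof (induction rule: generate.induct)
      case one
      then show ?case by (auto intro!: image_eqI[of _ _ "[]"])
    next
      case (incl h)
      then show ?case using assms by (auto intro!: image_eqI[of _ _ "[h]"])
    next
      case (inv h)
      then show ?case using assms by (auto intro!: image_eqI[of _ _ "[h]"])
    next
      case (eng h1 h2)
      then obtain us vs where "us \<in> lists T" "vs \<in> lists T" "h1 = wp us" "h2 = wp vs" by auto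
      then show ?case using assms
        by (intro image_eqI[of _ _ "us @ vs"]) (auto intro!: word_prod_append[symmetric])
    qed
  qed
  show "wp ` lists T \<subseteq> generate W T"
  proof
    fix g assume "g \<in> wp ` lists T"
    then obtain ws where "ws \<in> lists T" "g = wp ws" by auto
    then show "g \<in> generate W T"
      by (induction ws arbitrary: g) (auto intro: generate.intros)
  qed
qed

lemma wordE:
  assumes "g \<in> G" obtains ws where "ws \<in> lists S" "wp ws = g"
  using assms generate_words[of S] generators by auto

section \<open>Tits's parity argument and inversion sets\<close>

text \<open>For a word s_1 ... s_n this is the parity of the number of \<open>i\<close> with
  \<open>t\<close> equal to s_1 ... s_(i-1) s_i s_(i-1) ... s_1, that is, of the crossings of the
  wall of \<open>t\<close> by the gallery that the word spells. Inequality of truth values is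
  exclusive or.\<close>

primrec eta :: "'w list \<Rightarrow> 'w \<Rightarrow> bool" where
  "eta [] t \<longleftrightarrow> False"
| "eta (s # ws) t \<longleftrightarrow> (t = s) \<noteq> eta ws (s \<cdot> t \<cdot> s)"

lemma eta_append:
  assumes "us \<in> lists S" "t \<in> G"
  shows "eta (us @ vs) t \<longleftrightarrow> eta us t \<noteq> eta vs (iv (wp us) \<cdot> t \<cdot> wp us)"
  using assms
proof (induction us arbitrary: t)
  case Nil
  then show ?case by simp
next
  case (Cons s us)
  then have "s \<in> S" "us \<in> lists S" by auto
  then show ?case using Cons.IH[of "s \<cdot> t \<cdot> s"] Cons.prems by (auto simp: grp)
qed

lemma eta_replicate:
  assumes "s \<in> S" "t \<in> S" "r \<in> G"
  shows "eta (concat (replicate k [s, t])) r \<longleftrightarrow>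
    odd (\<Sum>j<2*k. of_bool (r = (s \<cdot> t) [^]\<^bsub>W\<^esub> j \<cdot> s) :: nat)"
  using assms
proof (induction k arbitrary: r)
  case 0
  then show ?case by simp
next
  case (Suc k)
  let ?p = "s \<cdot> t"
  have p: "?p \<in> G" using Suc.prems by auto
  have 1: "s \<cdot> r \<cdot> s = t \<longleftrightarrow> r = ?p [^]\<^bsub>W\<^esub> Suc 0 \<cdot> s"
    using Suc.prems S_conj_eq[of s r t] by simp
  have 2: "t \<cdot> (s \<cdot> r \<cdot> s) \<cdot> t = ?p [^]\<^bsub>W\<^esub> j \<cdot> s \<longleftrightarrow> r = ?p [^]\<^bsub>W\<^esub> Suc (Suc j) \<cdot> s" for j :: nat
  proof -
    have "?p [^]\<^bsub>W\<^esub> Suc (Suc j) \<cdot> s = ?p \<cdot> (?p [^]\<^bsub>W\<^esub> j \<cdot> s) \<cdot> (t \<cdot> s)"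
    proof -
      have "?p [^]\<^bsub>W\<^esub> Suc (Suc j) = ?p \<cdot> ?p [^]\<^bsub>W\<^esub> j \<cdot> ?p"
        using p by (metis nat_pow_Suc nat_pow_Suc2)
      then show ?thesis using Suc.prems p by (simp add: m_assoc)
    qed
    moreover have "t \<cdot> (s \<cdot> r \<cdot> s) \<cdot> t = x \<longleftrightarrow> r = ?p \<cdot> x \<cdot> (t \<cdot> s)" if "x \<in> G" for x
      using Suc.prems that S_conj_eq[of t "s \<cdot> r \<cdot> s" x] S_conj_eq[of s r "t \<cdot> x \<cdot> t"]
      by (simp add: m_assoc)
    ultimately show ?thesis using p Suc.prems by simp
  qed
  have "eta (concat (replicate (Suc k) [s, t])) r \<longleftrightarrow>
    (r = s) \<noteq> ((s \<cdot> r \<cdot> s = t) \<noteq> eta (concat (replicate k [s, t])) (t \<cdot> (s \<cdot> r \<cdot> s) \<cdot> t))"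
    by simp
  also have "\<dots> \<longleftrightarrow> (r = ?p [^]\<^bsub>W\<^esub> (0::nat) \<cdot> s) \<noteq> ((r = ?p [^]\<^bsub>W\<^esub> Suc 0 \<cdot> s) \<noteq>
     odd (\<Sum>j<2*k. of_bool (r = ?p [^]\<^bsub>W\<^esub> Suc (Suc j) \<cdot> s) :: nat))"
    using Suc.IH[of "t \<cdot> (s \<cdot> r \<cdot> s) \<cdot> t"] Suc.prems 1 2 by auto
  also have "\<dots> \<longleftrightarrow> odd (\<Sum>j<2*Suc k. of_bool (r = ?p [^]\<^bsub>W\<^esub> j \<cdot> s) :: nat)"
    by (simp add: sum.lessThan_Suc_shift del: nat_pow_Suc sum.lessThan_Suc)
  finally show ?case .
qed

lemma word_prod_replicate:
  assumes "s \<in> S" "t \<in> S"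
  shows "wp (concat (replicate k [s, t])) = (s \<cdot> t) [^]\<^bsub>W\<^esub> k"
proof (induction k)
  case (Suc k)
  then show ?case using assms nat_pow_Suc2[of "s \<cdot> t" k] by (simp add: m_assoc)
qed simp

text \<open>The alternating word meets the reflections \<open>(s \<cdot> t)^j \<cdot> s\<close> for
  \<open>j < 2 * m\<close>. Since the \<open>m\<close>-th power of \<open>s \<cdot> t\<close> is 1,
  the second half of this list repeats the first, so each reflection is met an even number of times.
  For \<open>m = 0\<close> the word is empty.\<close>

lemma eta_braid:
  assumes "s \<in> S" "t \<in> S" "r \<in> G"
  shows "\<not> eta (concat (replicate (cox_m W s t) [s, t])) r"
proof -
  let ?m = "cox_m W s t" and ?p = "s \<cdot> t"
  let ?f = "\<lambda>j. of_bool (r = ?p [^]\<^bsub>W\<^esub> (j::nat) \<cdot> s) :: nat"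
  have p: "?p \<in> G" using assms by auto
  have "?p [^]\<^bsub>W\<^esub> (?m + j) = ?p [^]\<^bsub>W\<^esub> j" for j :: nat
    using p pow_ord_eq_1[OF p] by (simp add: cox_m_def nat_pow_mult[symmetric])
  then have "(\<Sum>j<2*?m. ?f j) = 2 * (\<Sum>j<?m. ?f j)"
    using sum_lessThan_add_split[of ?f ?m ?m] by (simp add: mult_2)
  then show ?thesis using eta_replicate[OF assms, of ?m] by simp
qed

text \<open>Combined with \<open>presentation\<close>, which turns equal products into congruent
  words, this makes the parity a function on the group.\<close>

lemma cox_cong_sound:
  assumes "cox_cong W S us vs"
  shows "us \<in> lists S \<and> vs \<in> lists S \<and> wp us = wp vs \<and> (\<forall>t\<in>G. eta us t = eta vs t)"
  using assms
proof (induction rule: cox_cong.induct)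
  case (append us us' vs vs')
  then show ?case by (auto simp: eta_append)
next
  case (braid s t)
  have "set (concat (replicate (cox_m W s t) [s, t])) \<subseteq> {s, t}"
    by auto
  then have "concat (replicate (cox_m W s t) [s, t]) \<in> lists S" using braid by auto
  moreover have "(s \<cdot> t) [^]\<^bsub>W\<^esub> cox_m W s t = \<epsilon>"
    unfolding cox_m_def using braid by (intro pow_ord_eq_1) auto
  ultimately show ?case using braid by (auto simp: word_prod_replicate eta_braid)
qed auto

text \<open>\<open>NN w\<close> is the set of reflections whose walls separate the chambers \<open>1\<close> and \<open>w\<close>.\<close>

definition NN :: "'w \<Rightarrow> 'w set" where
  "NN w = {t\<in>G. \<exists>ws\<in>lists S. wp ws = w \<and> eta ws t}"

lemma NN_word: "ws \<in> lists S \<Longrightarrow> NN (wp ws) = {t\<in>G. eta ws t}"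
  unfolding NN_def using cox_cong_sound presentation by metis

lemma NN_carrier: "t \<in> NN w \<Longrightarrow> t \<in> G"
  by (simp add: NN_def)

lemma NN_one [simp]: "NN \<epsilon> = {}"
  using NN_word[of "[]"] by simp

lemma NN_S [simp]: "s \<in> S \<Longrightarrow> NN s = {s}"
  using NN_word[of "[s]"] by auto

text \<open>The cocycle rule: \<open>NN (v \<cdot> w)\<close> is the symmetric difference of
  \<open>NN v\<close> and the \<open>v\<close>-conjugate of \<open>NN w\<close>. Later wall counts
  are read off from it.\<close>

lemma NN_mult:
  assumes "v \<in> G" "w \<in> G" "t \<in> G"
  shows "t \<in> NN (v \<cdot> w) \<longleftrightarrow> (t \<in> NN v) \<noteq> (iv v \<cdot> t \<cdot> v \<in> NN w)"
proof -
  obtain us vs where "us \<in> lists S" "wp us = v" "vs \<in> lists S" "wp vs = w"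
    using wordE[OF assms(1)] wordE[OF assms(2)] by metis
  moreover from this have "us @ vs \<in> lists S" by auto
  ultimately show ?thesis using assms NN_word[of "us @ vs"] NN_word[of us] NN_word[of vs]
      eta_append[of us t vs] by auto
qed

lemma NN_inv:
  assumes "v \<in> G" "t \<in> G" shows "t \<in> NN (iv v) \<longleftrightarrow> v \<cdot> t \<cdot> iv v \<in> NN v"
  using NN_mult[of "iv v" v t] assms by simp

lemma eta_decompose:
  assumes "eta ws t" "ws \<in> lists S" "t \<in> G"
  shows "\<exists>us s vs. ws = us @ s # vs \<and> t = wp us \<cdot> s \<cdot> iv (wp us)"
  using assms
proof (induction ws arbitrary: t)
  case (Cons s ws)
  show ?case
  proof (cases "t = s")
    case True
    then show ?thesis using Cons.prems by (intro exI[of _ "[]"]) auto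
  next
    case False
    then obtain us r vs where *: "ws = us @ r # vs" "s \<cdot> t \<cdot> s = wp us \<cdot> r \<cdot> iv (wp us)"
      using Cons.IH[of "s \<cdot> t \<cdot> s"] Cons.prems by auto
    have "t = s \<cdot> (s \<cdot> t \<cdot> s) \<cdot> s" using Cons.prems by (auto simp: m_assoc)
    also have "\<dots> = wp (s # us) \<cdot> r \<cdot> iv (wp (s # us))"
      unfolding * using Cons.prems * by (auto simp: grp)
    finally show ?thesis using * by (intro exI[of _ "s # us"]) auto
  qed
qed simp

text \<open>Strong exchange condition: an odd number of occurrences is at least one, and multiplying
  by the reflection strikes out the corresponding letter.\<close>

lemma NN_decompose:
  assumes "t \<in> NN (wp ws)" "ws \<in> lists S"
  obtains us s vs where "ws = us @ s # vs" "t = wp us \<cdot> s \<cdot> iv (wp us)" "t \<cdot> wp ws = wp (us @ vs)"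
proof -
  obtain us s vs where *: "ws = us @ s # vs" "t = wp us \<cdot> s \<cdot> iv (wp us)"
    using eta_decompose[of ws t] NN_word assms by auto
  moreover have "t \<cdot> wp ws = wp (us @ vs)" using * assms by (auto simp: grp)
  ultimately show ?thesis using that by blast
qed

lemma word_ex: "w \<in> G \<Longrightarrow> \<exists>ws. ws \<in> lists S \<and> wp ws = w"
  by (erule wordE) blast

section \<open>Length as the number of inversions\<close>

lemma len_le: "ws \<in> lists S \<Longrightarrow> len (wp ws) \<le> length ws"
  unfolding cox_length_def by (rule Least_le) auto

lemma len_wordE:
  assumes "w \<in> G" obtains ws where "ws \<in> lists S" "wp ws = w" "length ws = len w"
proof -
  obtain us where "us \<in> lists S" "wp us = w" using assms wordE by blast
  then have "\<exists>n. \<exists>ws\<in>lists S. length ws = n \<and> wp ws = w" by auto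
  from LeastI_ex[OF this] show ?thesis using that unfolding cox_length_def by auto
qed

lemma len_word_ex: "w \<in> G \<Longrightarrow> \<exists>ws. ws \<in> lists S \<and> wp ws = w \<and> length ws = len w"
  by (erule len_wordE) blast

lemma len_mult_le: assumes "v \<in> G" "w \<in> G" shows "len (v \<cdot> w) \<le> len v + len w"
proof -
  obtain us vs where "us \<in> lists S" "wp us = v" "length us = len v"
     "vs \<in> lists S" "wp vs = w" "length vs = len w"
    using assms len_word_ex by meson
  then show ?thesis using len_le[of "us @ vs"] by auto
qed

lemma len_inv [simp]: assumes "w \<in> G" shows "len (iv w) = len w"
proof -
  have "len (iv w) \<le> len w" if wG: "w \<in> G" for w
  proof -
    obtain us where "us \<in> lists S" "wp us = w" "length us = len w" using len_word_ex[OF wG] by blast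
    then show ?thesis using len_le[of "rev us"] by (auto simp: word_prod_rev)
  qed
  from this[OF assms] this[of "iv w"] show ?thesis using assms by auto
qed

lemma len_one [simp]: "len \<epsilon> = 0"
  using len_le[of "[]"] by simp

lemma len_0_iff [simp]: "w \<in> G \<Longrightarrow> len w = 0 \<longleftrightarrow> w = \<epsilon>"
  using len_word_ex[of w] by auto

lemma NN_refl_less: assumes "w \<in> G" "t \<in> NN w" shows "len (t \<cdot> w) < len w"
proof -
  obtain ws where ws: "ws \<in> lists S" "wp ws = w" "length ws = len w" using assms len_word_ex by meson
  obtain us s vs where *: "ws = us @ s # vs" "t \<cdot> wp ws = wp (us @ vs)"
    using NN_decompose[of t ws] ws assms by metis
  then have "us @ vs \<in> lists S" using ws by auto
  from len_le[OF this] show ?thesis using * ws by auto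
qed

lemma NN_S_mult: assumes "s \<in> S" "w \<in> G" "t \<in> G"
  shows "t \<in> NN (s \<cdot> w) \<longleftrightarrow> (t = s) \<noteq> (s \<cdot> t \<cdot> s \<in> NN w)"
  using NN_mult[of s w t] assms by auto

text \<open>Induction along a reduced word \<open>s # vs\<close>: conjugation by \<open>s\<close>
  carries \<open>NN v\<close> into \<open>NN w\<close>, and \<open>s\<close> is the only further
  element. It is not already an inversion of \<open>v\<close>, since then
  \<open>w = s \<cdot> v\<close> would be shorter than \<open>v\<close>.\<close>

lemma NN_finite_len: assumes "w \<in> G" shows "finite (NN w) \<and> card (NN w) = len w"
  using assms
proof (induction "len w" arbitrary: w)
  case 0
  then show ?case by simp
next
  case (Suc n)
  obtain ws where ws: "ws \<in> lists S" "wp ws = w" "length ws = len w"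
    using len_word_ex[OF \<open>w \<in> G\<close>] by blast
  then obtain s vs where vs: "ws = s # vs" using Suc.hyps(2) by (cases ws) auto
  define v where "v = wp vs"
  have s: "s \<in> S" and vs': "vs \<in> lists S" using ws vs by auto
  have v: "v \<in> G" using vs' v_def by auto
  have w: "w = s \<cdot> v" using ws vs v_def by auto
  have "len v \<le> n" using len_le[OF vs'] ws vs Suc.hyps(2) v_def by auto
  moreover have "len w \<le> 1 + len v"
    using len_mult_le[of s v] len_le[of "[s]"] s v w by auto
  ultimately have lv: "n = len v" using Suc.hyps(2) by auto
  have IH: "finite (NN v)" "card (NN v) = n" using Suc.hyps(1)[OF lv v] lv by auto
  have sn: "s \<notin> NN v"
    using NN_refl_less[OF v, of s] w lv Suc.hyps(2) by auto
  have "NN w = insert s ((\<lambda>t. s \<cdot> t \<cdot> s) ` NN v)"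
  proof (intro equalityI subsetI)
    fix t assume t: "t \<in> NN w"
    then have "t \<in> G" by (rule NN_carrier)
    then show "t \<in> insert s ((\<lambda>t. s \<cdot> t \<cdot> s) ` NN v)"
      using t s v w NN_S_mult[of s v t] by (auto simp: m_assoc intro!: image_eqI[of _ _ "s \<cdot> t \<cdot> s"])
  next
    fix t assume t: "t \<in> insert s ((\<lambda>t. s \<cdot> t \<cdot> s) ` NN v)"
    then show "t \<in> NN w"
    proof
      assume "t = s"
      then show ?thesis using NN_S_mult[of s v s] s v w sn by (auto simp: m_assoc)
    next
      assume "t \<in> (\<lambda>t. s \<cdot> t \<cdot> s) ` NN v"
      then obtain r where r: "r \<in> NN v" "t = s \<cdot> r \<cdot> s" by auto
      have rG: "r \<in> G" using r NN_carrier by auto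
      have "s \<cdot> t \<cdot> s = r" using rG r s by (auto simp: m_assoc)
      moreover have "t \<noteq> s"
      proof
        assume "t = s"
        then have "r = s" using \<open>s \<cdot> t \<cdot> s = r\<close> s by (auto simp: m_assoc)
        then show False using r sn by auto
      qed
      ultimately show ?thesis using NN_S_mult[of s v t] s v w r rG by auto
    qed
  qed
  moreover have "s \<notin> (\<lambda>t. s \<cdot> t \<cdot> s) ` NN v"
  proof
    assume "s \<in> (\<lambda>t. s \<cdot> t \<cdot> s) ` NN v"
    then obtain r where r: "r \<in> NN v" "s = s \<cdot> r \<cdot> s" by auto
    then have "r = s" using s NN_carrier[OF r(1)]
      by (metis S_cancel S_closed S_sq m_assoc m_closed r_one)
    then show False using r sn by auto
  qed
  moreover have "inj_on (\<lambda>t. s \<cdot> t \<cdot> s) (NN v)"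
    using s NN_carrier by (auto simp: inj_on_def)
  ultimately show ?case using IH Suc.hyps(2) by (auto simp: card_image)
qed

lemma finite_NN [simp]: "w \<in> G \<Longrightarrow> finite (NN w)"
  and len_NN: "w \<in> G \<Longrightarrow> len w = card (NN w)"
  using NN_finite_len by auto

text \<open>Read the reflection as \<open>w\<close>, then \<open>s\<close>, then the inverse of
  \<open>w\<close>: the parities of the two outer parts cancel and the middle letter contributes one
  crossing.\<close>

lemma NN_self:
  assumes "w \<in> G" "s \<in> S" shows "w \<cdot> s \<cdot> iv w \<in> NN (w \<cdot> s \<cdot> iv w)"
proof -
  let ?t = "w \<cdot> s \<cdot> iv w"
  have 1: "?t \<in> NN ?t \<longleftrightarrow> (?t \<in> NN w) \<noteq> (s \<in> NN (s \<cdot> iv w))"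
    using NN_mult[of w "s \<cdot> iv w" ?t] assms by (simp add: grp)
  have "s \<in> NN (s \<cdot> iv w) \<longleftrightarrow> s \<notin> NN (iv w)"
    using NN_S_mult[of s "iv w" s] assms by (auto simp: m_assoc)
  also have "\<dots> \<longleftrightarrow> ?t \<notin> NN w"
    using NN_inv[of w s] assms by auto
  finally show ?thesis using 1 by auto
qed

section \<open>Reflections and the length test for inversions\<close>

definition refls :: "'w set" where
  "refls = {w \<cdot> s \<cdot> iv w | w s. w \<in> G \<and> s \<in> S}"

lemma reflsE:
  assumes "t \<in> refls" obtains w s where "w \<in> G" "s \<in> S" "t = w \<cdot> s \<cdot> iv w"
  using assms unfolding refls_def by blast

lemma refls_closed [simp]: "t \<in> refls \<Longrightarrow> t \<in> G"
  by (erule reflsE) simp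

lemma S_refls: assumes "s \<in> S" shows "s \<in> refls"
proof -
  have "s = \<epsilon> \<cdot> s \<cdot> iv \<epsilon>" using assms by simp
  then show ?thesis unfolding refls_def using assms one_closed by blast
qed

lemma refls_conj: assumes "t \<in> refls" "g \<in> G" shows "g \<cdot> t \<cdot> iv g \<in> refls"
proof -
  obtain w s where "w \<in> G" "s \<in> S" "t = w \<cdot> s \<cdot> iv w" using assms reflsE by blast
  then have "g \<cdot> t \<cdot> iv g = (g \<cdot> w) \<cdot> s \<cdot> iv (g \<cdot> w)" using assms by (simp add: grp)
  then show ?thesis unfolding refls_def using \<open>w \<in> G\<close> \<open>s \<in> S\<close> assms by blast
qed

lemma refls_conj': "t \<in> refls \<Longrightarrow> g \<in> G \<Longrightarrow> iv g \<cdot> t \<cdot> g \<in> refls"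
  using refls_conj[of t "iv g"] by simp

lemma refls_sq [simp]: "t \<in> refls \<Longrightarrow> t \<cdot> t = \<epsilon>"
  by (erule reflsE) (simp add: m_assoc)

lemma refls_inv [simp]: "t \<in> refls \<Longrightarrow> iv t = t"
  by (simp add: inv_equality)

lemma refls_cancel [simp]: "t \<in> refls \<Longrightarrow> y \<in> G \<Longrightarrow> t \<cdot> (t \<cdot> y) = y"
  by (metis refls_closed refls_sq l_one m_assoc)

lemma NN_refls: assumes "t \<in> NN w" "w \<in> G" shows "t \<in> refls"
proof -
  obtain ws where ws: "ws \<in> lists S" "wp ws = w" using assms len_word_ex by meson
  obtain us s vs where "ws = us @ s # vs" "t = wp us \<cdot> s \<cdot> iv (wp us)"
    using NN_decompose[of t ws] ws assms by metis
  moreover from this have "wp us \<in> G" "s \<in> S" using ws by auto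
  ultimately show ?thesis unfolding refls_def by blast
qed

lemma NN_refl_self: "t \<in> refls \<Longrightarrow> t \<in> NN t"
  by (erule reflsE) (simp add: NN_self)

lemma NN_refl_mult:
  assumes "t \<in> refls" "w \<in> G" shows "t \<in> NN (t \<cdot> w) \<longleftrightarrow> t \<notin> NN w"
proof -
  have "iv t \<cdot> t \<cdot> t = t" using assms by simp
  then show ?thesis using NN_mult[of t w t] NN_refl_self assms by simp
qed

text \<open>\<open>t\<close> is an inversion of exactly one of \<open>w\<close> and
  \<open>t \<cdot> w\<close>, and reflecting shortens whichever it is.\<close>

lemma NN_iff_less:
  assumes "t \<in> refls" "w \<in> G"
  shows "t \<in> NN w \<longleftrightarrow> len (t \<cdot> w) < len w"
  using NN_refl_less[of w t] NN_refl_less[of "t \<cdot> w" t] NN_refl_mult[OF assms] assms by fastforce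

lemma not_NN_less:
  assumes "t \<in> refls" "w \<in> G" "t \<notin> NN w" shows "len w < len (t \<cdot> w)"
  using NN_refl_less[of "t \<cdot> w" t] NN_refl_mult[of t w] assms by simp

lemma len_S [simp]: "s \<in> S \<Longrightarrow> len s = 1"
  by (simp add: len_NN)

lemma len_S_mult:
  assumes "s \<in> S" "w \<in> G"
  shows "len (s \<cdot> w) = (if s \<in> NN w then len w - 1 else len w + 1)"
    and "s \<in> NN w \<Longrightarrow> 0 < len w"
proof -
  have 1: "len (s \<cdot> w) \<le> 1 + len w" using len_mult_le[of s w] assms by auto
  have 2: "len w \<le> 1 + len (s \<cdot> w)" using len_mult_le[of s "s \<cdot> w"] assms by auto
  show "len (s \<cdot> w) = (if s \<in> NN w then len w - 1 else len w + 1)"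
    using 1 2 NN_refl_less[of w s] not_NN_less[of s w] assms S_refls[of s] by auto
  show "s \<in> NN w \<Longrightarrow> 0 < len w" using NN_refl_less[of w s] assms by auto
qed

lemma len_mult_S:
  assumes "s \<in> S" "w \<in> G"
  shows "len (w \<cdot> s) = (if s \<in> NN (iv w) then len w - 1 else len w + 1)"
    and "s \<in> NN (iv w) \<Longrightarrow> 0 < len w"
proof -
  have "len (w \<cdot> s) = len (iv (w \<cdot> s))" using assms len_inv[of "w \<cdot> s"] by simp
  also have "iv (w \<cdot> s) = s \<cdot> iv w" using assms by (simp add: inv_mult_group)
  finally show "len (w \<cdot> s) = (if s \<in> NN (iv w) then len w - 1 else len w + 1)"
    using len_S_mult(1)[of s "iv w"] assms by simp
  show "s \<in> NN (iv w) \<Longrightarrow> 0 < len w" using len_S_mult(2)[of s "iv w"] assms by simp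
qed

lemma ball_finite: assumes "finite S" shows "finite {w\<in>G. len w \<le> n}"
proof -
  have "{w\<in>G. len w \<le> n} \<subseteq> wp ` {ws. set ws \<subseteq> S \<and> length ws \<le> n}"
  proof
    fix w assume w: "w \<in> {w\<in>G. len w \<le> n}"
    then obtain ws where "ws \<in> lists S" "wp ws = w" "length ws = len w" using len_word_ex by blast
    then show "w \<in> wp ` {ws. set ws \<subseteq> S \<and> length ws \<le> n}"
      using w by (intro image_eqI[of _ _ ws]) auto
  qed
  moreover have "finite {ws. set ws \<subseteq> S \<and> length ws \<le> n}"
    by (rule finite_lists_length_le[OF assms])
  ultimately show ?thesis by (rule finite_surj[rotated])
qed

section \<open>Parabolic subgroups and cones\<close>

definition par :: "'w set \<Rightarrow> 'w set" where
  "par J = wp ` lists J"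

lemma par_closed: "J \<subseteq> S \<Longrightarrow> a \<in> par J \<Longrightarrow> a \<in> G"
  unfolding par_def by (auto simp: subset_iff)

lemma par_one [simp]: "\<epsilon> \<in> par J"
  unfolding par_def by (rule image_eqI[of _ _ "[]"]) auto

lemma par_generator: "J \<subseteq> S \<Longrightarrow> s \<in> J \<Longrightarrow> s \<in> par J"
  unfolding par_def by (rule image_eqI[of _ _ "[s]"]) auto

lemma par_mult: assumes "J \<subseteq> S" "a \<in> par J" "b \<in> par J" shows "a \<cdot> b \<in> par J"
proof -
  obtain us vs where "us \<in> lists J" "vs \<in> lists J" "a = wp us" "b = wp vs"
    using assms unfolding par_def by blast
  moreover from this have "us \<in> lists S" "vs \<in> lists S" using assms by auto
  ultimately show ?thesis unfolding par_def
    by (intro image_eqI[of _ _ "us @ vs"]) auto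
qed

lemma par_inv: assumes "J \<subseteq> S" "a \<in> par J" shows "iv a \<in> par J"
proof -
  obtain us where "us \<in> lists J" "a = wp us" using assms unfolding par_def by blast
  moreover from this have "us \<in> lists S" using assms by auto
  ultimately show ?thesis unfolding par_def
    by (intro image_eqI[of _ _ "rev us"]) (auto simp: word_prod_rev)
qed

lemma par_generate: "J \<subseteq> S \<Longrightarrow> generate W J = par J"
  unfolding par_def by (rule generate_words)

lemma par_mono: "J \<subseteq> J' \<Longrightarrow> par J \<subseteq> par J'"
  unfolding par_def by (intro image_mono lists_mono)

lemma par_reflE:
  assumes "J \<subseteq> S" "a \<in> par J" "t \<in> NN a"
  obtains b s where "b \<in> par J" "s \<in> J" "t = b \<cdot> s \<cdot> iv b"
proof -
  obtain ws where ws: "ws \<in> lists J" "a = wp ws" using assms unfolding par_def by blast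
  have "ws \<in> lists S" using ws assms by auto
  then obtain us s vs where *: "ws = us @ s # vs" "t = wp us \<cdot> s \<cdot> iv (wp us)"
    using NN_decompose[of t ws] ws assms(3) by metis
  have "wp us \<in> par J" unfolding par_def using ws * by auto
  moreover have "s \<in> J" using ws * by auto
  ultimately show ?thesis using that * by blast
qed

lemma NN_par: assumes "J \<subseteq> S" "a \<in> par J" "t \<in> NN a" shows "t \<in> par J"
proof -
  obtain b s where *: "b \<in> par J" "s \<in> J" "t = b \<cdot> s \<cdot> iv b"
    using par_reflE[OF assms] by metis
  have "b \<cdot> s \<in> par J" by (rule par_mult[OF assms(1) *(1) par_generator[OF assms(1) *(2)]])
  from par_mult[OF assms(1) this par_inv[OF assms(1) *(1)]] show ?thesis using *(3) by simp
qed

text \<open>\<open>z'\<close> has minimal length in the right coset of \<open>z\<close> under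
  \<open>par J\<close>: an inversion inside \<open>par J\<close> could be moved into the factor
  \<open>a\<close> and would leave a shorter element. Geometrically, \<open>z'\<close> is on the
  side of 1 for every wall of \<open>par J\<close>.\<close>

lemma par_coset:
  assumes "J \<subseteq> S" "z \<in> G"
  obtains a z' where "a \<in> par J" "z' \<in> G" "z = a \<cdot> z'" "NN z' \<inter> par J = {}"
proof -
  define P where "P = (\<lambda>x. x \<in> G \<and> (\<exists>a\<in>par J. z = a \<cdot> x))"
  have "P z" unfolding P_def using assms by (auto intro!: bexI[of _ \<epsilon>])
  then obtain z' where z': "P z'" "\<And>y. P y \<Longrightarrow> len z' \<le> len y"
    using ex_has_least_nat[of P z len] by blast
  obtain a where a: "a \<in> par J" "z = a \<cdot> z'" and z'G: "z' \<in> G" using z'(1) unfolding P_def by blast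
  have "NN z' \<inter> par J = {}"
  proof (rule ccontr)
    assume "NN z' \<inter> par J \<noteq> {}"
    then obtain t where t: "t \<in> NN z'" "t \<in> par J" by blast
    have tG: "t \<in> refls" using NN_refls[OF t(1) z'G] .
    have aG: "a \<in> G" using par_closed[OF assms(1) a(1)] .
    have "z = (a \<cdot> t) \<cdot> (t \<cdot> z')" using a(2) aG tG z'G by (simp add: m_assoc)
    moreover have "a \<cdot> t \<in> par J" using par_mult[OF assms(1) a(1) t(2)] .
    ultimately have "P (t \<cdot> z')" unfolding P_def using tG z'G by auto
    then show False using z'(2) NN_refl_less[OF z'G t(1)] by fastforce
  qed
  then show ?thesis using that a z'G by blast
qed

text \<open>Evaluating the cocycle rule on both sides of \<open>z \<cdot> s = s \<cdot> z\<close>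
  shows that conjugation by \<open>s\<close> preserves the inversions of \<open>z\<close>.\<close>

lemma NN_conj_commute:
  assumes "s \<in> S" "z \<in> G" "z \<cdot> s = s \<cdot> z" "r \<in> NN z"
  shows "s \<cdot> r \<cdot> s \<in> NN z"
proof -
  let ?q = "s \<cdot> r \<cdot> s"
  have r: "r \<in> G" using assms(4) NN_carrier by blast
  then have q: "?q \<in> G" "s \<cdot> ?q \<cdot> s = r" using assms(1) by (auto simp: m_assoc)
  have 1: "?q \<in> NN (s \<cdot> z) \<longleftrightarrow> (?q = s) \<noteq> (r \<in> NN z)"
    using NN_S_mult[of s z ?q] assms q by simp
  have 2: "?q \<in> NN (z \<cdot> s) \<longleftrightarrow> (?q \<in> NN z) \<noteq> (iv z \<cdot> ?q \<cdot> z = s)"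
    using NN_mult[of z s ?q] assms q by simp
  have 3: "z \<cdot> s \<cdot> iv z = s"
    using assms by (simp add: m_assoc)
  have "iv z \<cdot> ?q \<cdot> z = s \<longleftrightarrow> ?q = s"
  proof
    assume "iv z \<cdot> ?q \<cdot> z = s"
    then have "z \<cdot> (iv z \<cdot> ?q \<cdot> z) \<cdot> iv z = s" using 3 by simp
    moreover have "z \<cdot> (iv z \<cdot> ?q \<cdot> z) \<cdot> iv z = ?q" using q(1) \<open>z \<in> G\<close>
      by (simp add: m_assoc del: S_cancel)
    ultimately show "?q = s" by simp
  next
    assume q: "?q = s"
    have "iv z \<cdot> s \<cdot> z = iv z \<cdot> (s \<cdot> z)" using assms by (simp add: m_assoc)
    also have "\<dots> = s" using assms by (simp flip: assms(3))
    finally show "iv z \<cdot> ?q \<cdot> z = s" using q by simp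
  qed
  then show ?thesis using 1 2 assms(3,4) by auto
qed

lemma NN_conj_par:
  assumes "J \<subseteq> S" "z \<in> G" "\<And>s. s \<in> J \<Longrightarrow> z \<cdot> s = s \<cdot> z" "r \<in> NN z" "x \<in> par J"
  shows "x \<cdot> r \<cdot> iv x \<in> NN z"
proof -
  obtain ws where "ws \<in> lists J" "x = wp ws" using assms unfolding par_def by blast
  then show ?thesis
  proof (induction ws arbitrary: x)
    case Nil
    then show ?case using assms NN_carrier by auto
  next
    case (Cons s ws)
    then have s: "s \<in> J" "s \<in> S" and ws: "ws \<in> lists J" "ws \<in> lists S" using assms by auto
    have IH: "wp ws \<cdot> r \<cdot> iv (wp ws) \<in> NN z" using Cons.IH[OF HOL.refl] .
    have "s \<cdot> (wp ws \<cdot> r \<cdot> iv (wp ws)) \<cdot> s \<in> NN z"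
      by (rule NN_conj_commute[OF s(2) assms(2) assms(3)[OF s(1)] IH])
    moreover have "s \<cdot> (wp ws \<cdot> r \<cdot> iv (wp ws)) \<cdot> s = x \<cdot> r \<cdot> iv x"
      using Cons.prems s ws NN_carrier[OF assms(4)] by (simp add: grp)
    ultimately show ?case by simp
  qed
qed

lemma par_commute:
  assumes "J \<subseteq> S" "z \<in> G" "\<And>s. s \<in> J \<Longrightarrow> z \<cdot> s = s \<cdot> z" "x \<in> par J"
  shows "z \<cdot> x = x \<cdot> z"
proof -
  obtain ws where "ws \<in> lists J" "x = wp ws" using assms unfolding par_def by blast
  then show ?thesis
  proof (induction ws arbitrary: x)
    case Nil
    then show ?case using assms by auto
  next
    case (Cons s ws)
    then have s: "s \<in> J" "s \<in> S" and ws: "ws \<in> lists J" "ws \<in> lists S" using assms by auto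
    have IH: "z \<cdot> wp ws = wp ws \<cdot> z" using Cons.IH[OF HOL.refl] .
    have "z \<cdot> (s \<cdot> wp ws) = (z \<cdot> s) \<cdot> wp ws" using s ws assms(2) by (simp add: m_assoc)
    also have "\<dots> = s \<cdot> (z \<cdot> wp ws)" using s ws assms(2,3) by (simp add: m_assoc)
    also have "\<dots> = s \<cdot> wp ws \<cdot> z" using s ws assms(2) IH by (simp add: m_assoc)
    finally show ?case using Cons.prems by simp
  qed
qed

text \<open>The walls of \<open>par J\<close> crossed by an element centralizing \<open>J\<close> form a finite union of
  conjugacy classes of \<open>par J\<close>, and there are only finitely many finite classes of reflections.\<close>

lemma centralizer_bound:
  assumes "finite S" "J \<subseteq> S"
  obtains c where "\<And>z a z'. z \<in> G \<Longrightarrow> (\<And>s. s \<in> J \<Longrightarrow> z \<cdot> s = s \<cdot> z) \<Longrightarrow> a \<in> par J \<Longrightarrow> z' \<in> G \<Longrightarrow>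
    z = a \<cdot> z' \<Longrightarrow> NN z' \<inter> par J = {} \<Longrightarrow> len a \<le> c"
proof -
  define cls where "cls = (\<lambda>s. {x \<cdot> s \<cdot> iv x | x. x \<in> par J})"
  define F where "F = (\<Union>s\<in>{s\<in>J. finite (cls s)}. cls s)"
  have "finite J" using assms finite_subset by blast
  then have F: "finite F" unfolding F_def by auto
  have "len a \<le> card F" if z: "z \<in> G" and comm: "\<And>s. s \<in> J \<Longrightarrow> z \<cdot> s = s \<cdot> z" and a: "a \<in> par J"
    and z': "z' \<in> G" "z = a \<cdot> z'" "NN z' \<inter> par J = {}" for z a z'
  proof -
    have aG: "a \<in> G" using par_closed[OF assms(2) a] .
    have "NN a \<subseteq> F"
    proof
      fix t assume t: "t \<in> NN a"
      obtain b s where b: "b \<in> par J" "s \<in> J" "t = b \<cdot> s \<cdot> iv b"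
        using par_reflE[OF assms(2) a t] by metis
      have bG: "b \<in> G" using par_closed[OF assms(2) b(1)] .
      have tP: "t \<in> par J" using NN_par[OF assms(2) a t] .
      have tG: "t \<in> G" using t NN_carrier by blast
      have "iv a \<cdot> t \<cdot> a \<in> par J" using a tP assms(2) par_mult par_inv by simp
      then have "iv a \<cdot> t \<cdot> a \<notin> NN z'" using z'(3) by blast
      then have tz: "t \<in> NN z" using NN_mult[OF aG z'(1) tG] t z'(2) by simp
      have "iv b \<cdot> t \<cdot> iv (iv b) \<in> NN z"
        by (rule NN_conj_par[OF assms(2) z comm tz par_inv[OF assms(2) b(1)]])
      moreover have "iv b \<cdot> t \<cdot> iv (iv b) = s" using b bG assms(2) by (auto simp: m_assoc)
      ultimately have sz: "s \<in> NN z" by simp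
      have "cls s \<subseteq> NN z" unfolding cls_def using NN_conj_par[OF assms(2) z comm sz] by blast
      then have "finite (cls s)" using finite_NN[OF z] finite_subset by blast
      moreover have "t \<in> cls s" unfolding cls_def using b by blast
      ultimately show "t \<in> F" unfolding F_def using b(2) by blast
    qed
    then show ?thesis using F aG by (simp add: len_NN card_mono)
  qed
  then show ?thesis using that by blast
qed

section \<open>Cones with apex at uniformly bounded distance\<close>

lemma len_refl_le: assumes "w \<in> G" "t \<in> NN w" shows "len t \<le> 2 * len w"
proof -
  have t: "t \<in> refls" using NN_refls assms by blast
  have "t = (t \<cdot> w) \<cdot> iv w" using assms t by (simp add: m_assoc)
  then have "len t \<le> len (t \<cdot> w) + len (iv w)"
    using len_mult_le[of "t \<cdot> w" "iv w"] assms t by simp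
  then show ?thesis using NN_refl_less[OF assms] assms by simp
qed

lemma len_conj_le: assumes "b \<in> G" "r \<in> G" shows "len (iv b \<cdot> r \<cdot> b) \<le> 2 * len b + len r"
  using len_mult_le[of "iv b \<cdot> r" b] len_mult_le[of "iv b" r] assms by simp

lemma first_letter: assumes "w \<in> G" "w \<noteq> \<epsilon>" obtains s where "s \<in> S" "s \<in> NN w"
proof -
  obtain ws where ws: "ws \<in> lists S" "wp ws = w" "length ws = len w"
    using len_word_ex[OF assms(1)] by blast
  then obtain s vs where vs: "ws = s # vs" using assms by (cases ws) auto
  have "s \<cdot> w = wp vs" using ws vs by auto
  then have "len (s \<cdot> w) < len w" using len_le[of vs] ws vs by auto
  then show ?thesis using that NN_iff_less[of s w] S_refls[of s] ws vs assms by auto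
qed

text \<open>The conjugates \<open>iv u \<cdot> s \<cdot> u\<close> with \<open>s \<in> J\<close>
  take finitely many values, so \<open>u\<close> is \<open>z\<close> times one of finitely many
  \<open>u0\<close>, with \<open>z\<close> centralizing \<open>J\<close>. Write
  \<open>z = a \<cdot> z'\<close> with \<open>a\<close> short by \<open>centralizer_bound\<close>;
  as \<open>z\<close> commutes with \<open>a\<close>, \<open>u = z' \<cdot> b\<close> with
  \<open>b = a \<cdot> u0\<close> short. If \<open>z'\<close> is trivial, \<open>u\<close> is short.
  Otherwise a left descent \<open>t\<close> of \<open>z'\<close> is outside \<open>J\<close>, hence
  no descent of \<open>u\<close>, so its wall is crossed again within \<open>b\<close>. This makes
  \<open>iv u \<cdot> t \<cdot> u\<close> short, and the induction hypothesis for
  \<open>insert t J\<close> bounds \<open>u\<close>.\<close>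

lemma descents_bound:
  assumes "finite S" "J \<subseteq> S"
  shows "\<exists>R'. \<forall>u\<in>G. (\<forall>s\<in>S. s \<in> NN u \<longrightarrow> s \<in> J) \<longrightarrow> (\<forall>s\<in>J. len (iv u \<cdot> s \<cdot> u) \<le> R) \<longrightarrow> len u \<le> R'"
  using assms(2)
proof (induction "card (S - J)" arbitrary: J R rule: less_induct)
  case less
  note J = \<open>J \<subseteq> S\<close>
  have finJ: "finite J" using J assms finite_subset by blast
  define A where "A = {u\<in>G. (\<forall>s\<in>S. s \<in> NN u \<longrightarrow> s \<in> J) \<and> (\<forall>s\<in>J. len (iv u \<cdot> s \<cdot> u) \<le> R)}"
  define f where "f = (\<lambda>u. restrict (\<lambda>s. iv u \<cdot> s \<cdot> u) J)"
  have "f ` A \<subseteq> J \<rightarrow>\<^sub>E {w\<in>G. len w \<le> R}"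
    unfolding A_def f_def using J by (auto simp: subset_iff)
  then have "finite (f ` A)"
    by (rule finite_subset) (rule finite_PiE[OF finJ ball_finite[OF assms(1)]])
  then have "finite (len ` inv_into A f ` f ` A)" by simp
  then obtain k where k: "\<And>x. x \<in> len ` inv_into A f ` f ` A \<Longrightarrow> x \<le> k"
    unfolding finite_nat_set_iff_bounded_le by blast
  obtain c where c: "\<And>z a z'. z \<in> G \<Longrightarrow> (\<And>s. s \<in> J \<Longrightarrow> z \<cdot> s = s \<cdot> z) \<Longrightarrow> a \<in> par J \<Longrightarrow> z' \<in> G \<Longrightarrow>
    z = a \<cdot> z' \<Longrightarrow> NN z' \<inter> par J = {} \<Longrightarrow> len a \<le> c"
    using centralizer_bound[OF assms(1) J] by blast
  define m where "m = c + k"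
  \<comment> \<open>\<open>4 * m\<close> bounds the conjugate by \<open>b\<close> of an inversion of
    \<open>b\<close>: at most \<open>2 * len b\<close> for the conjugation and
    \<open>2 * len b\<close> for the inversion.\<close>
  define R1 where "R1 = max R (4 * m)"
  have "\<exists>R'. \<forall>u\<in>G. (\<forall>s\<in>S. s \<in> NN u \<longrightarrow> s \<in> insert t J) \<longrightarrow>
      (\<forall>s\<in>insert t J. len (iv u \<cdot> s \<cdot> u) \<le> R1) \<longrightarrow> len u \<le> R'" if "t \<in> S - J" for t
  proof (rule less.hyps)
    show "card (S - insert t J) < card (S - J)"
      using that assms(1) by (intro psubset_card_mono) auto
  qed (use that J in auto)
  then have "\<forall>t\<in>S-J. \<exists>R'. \<forall>u\<in>G. (\<forall>s\<in>S. s \<in> NN u \<longrightarrow> s \<in> insert t J) \<longrightarrow>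
      (\<forall>s\<in>insert t J. len (iv u \<cdot> s \<cdot> u) \<le> R1) \<longrightarrow> len u \<le> R'" by blast
  from bchoice[OF this] obtain h where h: "\<forall>t\<in>S-J. \<forall>u\<in>G. (\<forall>s\<in>S. s \<in> NN u \<longrightarrow> s \<in> insert t J) \<longrightarrow>
      (\<forall>s\<in>insert t J. len (iv u \<cdot> s \<cdot> u) \<le> R1) \<longrightarrow> len u \<le> h t"
    by blast
  have "len u \<le> m + (\<Sum>t\<in>S-J. h t)" if uA: "u \<in> A" for u
  proof (cases "\<exists>t\<in>S-J. len (iv u \<cdot> t \<cdot> u) \<le> R1")
    case True
    then obtain t where t: "t \<in> S - J" "len (iv u \<cdot> t \<cdot> u) \<le> R1" by blast
    have "len u \<le> h t"
      using h t uA unfolding A_def R1_def by (auto simp: le_max_iff_disj)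
    also have "h t \<le> (\<Sum>t\<in>S-J. h t)" using t assms(1) by (intro member_le_sum) auto
    finally show ?thesis by simp
  next
    case False
    have uG: "u \<in> G" using uA unfolding A_def by blast
    define u0 where "u0 = inv_into A f (f u)"
    have u0: "u0 \<in> A" "f u0 = f u"
      unfolding u0_def using uA by (auto intro: inv_into_into f_inv_into_f)
    have lu0: "len u0 \<le> k" using k u0_def uA by blast
    have u0G: "u0 \<in> G" using u0 unfolding A_def by blast
    define z where "z = u \<cdot> iv u0"
    have zG: "z \<in> G" using z_def uG u0G by simp
    have comm: "z \<cdot> s = s \<cdot> z" if "s \<in> J" for s
    proof -
      have sG: "s \<in> G" using that J by auto
      have eq: "iv u0 \<cdot> s \<cdot> u0 = iv u \<cdot> s \<cdot> u"
        using fun_cong[OF u0(2), of s] that unfolding f_def by simp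
      have "z \<cdot> s = u \<cdot> (iv u0 \<cdot> s \<cdot> u0) \<cdot> iv u0" unfolding z_def using uG u0G sG by (simp add: m_assoc)
      also have "\<dots> = s \<cdot> z" unfolding eq z_def using uG u0G sG by (simp add: m_assoc)
      finally show ?thesis .
    qed
    obtain a z' where az: "a \<in> par J" "z' \<in> G" "z = a \<cdot> z'" "NN z' \<inter> par J = {}"
      using par_coset[OF J zG] by blast
    have aG: "a \<in> G" using par_closed[OF J az(1)] .
    have la: "len a \<le> c" by (rule c[OF zG comm az])
    have z'eq: "z' = iv a \<cdot> z" using az aG by simp
    have ueq: "u = z' \<cdot> (a \<cdot> u0)"
    proof -
      have "z' \<cdot> a = iv a \<cdot> (z \<cdot> a)" using z'eq aG zG by (simp add: m_assoc)
      also have "\<dots> = z" using par_commute[OF J zG comm az(1)] aG zG by simp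
      finally have "z' \<cdot> (a \<cdot> u0) = z \<cdot> u0" using az aG u0G by (simp flip: m_assoc)
      then show ?thesis unfolding z_def using uG u0G by (simp add: m_assoc)
    qed
    define b where "b = a \<cdot> u0"
    have bG: "b \<in> G" and lb: "len b \<le> m"
      using aG u0G la lu0 len_mult_le[of a u0] unfolding b_def m_def by auto
    have "z' = \<epsilon>"
    proof (rule ccontr)
      assume "z' \<noteq> \<epsilon>"
      then obtain t where t: "t \<in> S" "t \<in> NN z'" using first_letter[OF az(2)] by blast
      have tJ: "t \<notin> J" using az(4) t par_generator[OF J] by blast
      have "t \<notin> NN u" using uA t tJ unfolding A_def by blast
      then have r: "iv z' \<cdot> t \<cdot> z' \<in> NN b"
        using NN_mult[of z' b t] az(2) bG t ueq b_def by auto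
      have "iv u \<cdot> t \<cdot> u = iv b \<cdot> (iv z' \<cdot> t \<cdot> z') \<cdot> b"
        using ueq bG az(2) t b_def[symmetric] by (simp add: grp)
      then have "len (iv u \<cdot> t \<cdot> u) \<le> 2 * len b + 2 * len b"
        using len_conj_le[OF bG NN_carrier[OF r]] len_refl_le[OF bG r] by simp
      then have "len (iv u \<cdot> t \<cdot> u) \<le> R1" using lb unfolding R1_def by simp
      then show False using False t tJ by blast
    qed
    then have "u = b" using ueq b_def bG by simp
    then show ?thesis using lb by simp
  qed
  then show ?case unfolding A_def by blast
qed

text \<open>For \<open>b\<close> of minimal length with this property, every left descent \<open>s\<close> of \<open>b\<^sup>-\<^sup>1\<close> has a
  conjugate \<open>b s b\<^sup>-\<^sup>1\<close> of length at most \<open>2 R\<close>; hence \<open>b\<close> is short by \<open>descents_bound\<close>.\<close>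

lemma ball_in_cone:
  assumes "finite S"
  obtains R' where "\<And>w. w \<in> G \<Longrightarrow> \<exists>b\<in>G. len b \<le> R' \<and>
    (\<forall>y\<in>G. len y \<le> R \<longrightarrow> len (w \<cdot> y) = len (w \<cdot> b) + len (iv b \<cdot> y))"
proof -
  have "\<forall>J\<in>Pow S. \<exists>R'. \<forall>u\<in>G. (\<forall>s\<in>S. s \<in> NN u \<longrightarrow> s \<in> J) \<longrightarrow>
      (\<forall>s\<in>J. len (iv u \<cdot> s \<cdot> u) \<le> 2 * R) \<longrightarrow> len u \<le> R'"
    using descents_bound[OF assms] by blast
  from bchoice[OF this] obtain h where h: "\<forall>J\<in>Pow S. \<forall>u\<in>G. (\<forall>s\<in>S. s \<in> NN u \<longrightarrow> s \<in> J) \<longrightarrow>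
      (\<forall>s\<in>J. len (iv u \<cdot> s \<cdot> u) \<le> 2 * R) \<longrightarrow> len u \<le> h J"
    by blast
  define R' where "R' = (\<Sum>J\<in>Pow S. h J)"
  have "\<exists>b\<in>G. len b \<le> R' \<and>
    (\<forall>y\<in>G. len y \<le> R \<longrightarrow> len (w \<cdot> y) = len (w \<cdot> b) + len (iv b \<cdot> y))" if w: "w \<in> G" for w
  proof -
    define P where "P = (\<lambda>b. b \<in> G \<and> (\<forall>y\<in>G. len y \<le> R \<longrightarrow> len (w \<cdot> y) = len (w \<cdot> b) + len (iv b \<cdot> y)))"
    \<comment> \<open>This is the apex \<open>w \<cdot> iv w = \<epsilon>\<close>, whose cone is the
      whole group.\<close>
    have "P (iv w)" unfolding P_def using w by auto
    then obtain b where b: "P b" "\<And>y. P y \<Longrightarrow> len b \<le> len y"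
      using ex_has_least_nat[of P "iv w" len] by blast
    have bG: "b \<in> G" using b(1) unfolding P_def by blast
    define J where "J = {s\<in>S. s \<in> NN (iv b)}"
    have "len (iv (iv b) \<cdot> s \<cdot> iv b) \<le> 2 * R" if "s \<in> J" for s
    proof -
      have s: "s \<in> S" "s \<in> NN (iv b)" using that J_def by auto
      have "len (b \<cdot> s) < len b" using len_mult_S[OF s(1) bG] s(2) by auto
      then have "\<not> P (b \<cdot> s)" using b(2)[of "b \<cdot> s"] by auto
      then obtain y where y: "y \<in> G" "len y \<le> R"
        "len (w \<cdot> y) \<noteq> len (w \<cdot> (b \<cdot> s)) + len (iv (b \<cdot> s) \<cdot> y)"
        unfolding P_def using bG s by auto
      have e1: "iv (b \<cdot> s) \<cdot> y = s \<cdot> (iv b \<cdot> y)" using bG s y by (simp add: grp)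
      have e2: "w \<cdot> (b \<cdot> s) = w \<cdot> b \<cdot> s" using bG w s by (simp add: m_assoc)
      have eq: "len (w \<cdot> y) = len (w \<cdot> b) + len (iv b \<cdot> y)" using b(1) y unfolding P_def by blast
      have "w \<cdot> y = (w \<cdot> b \<cdot> s) \<cdot> (s \<cdot> (iv b \<cdot> y))" using bG w s y by (simp add: m_assoc)
      then have tri: "len (w \<cdot> y) \<le> len (w \<cdot> b \<cdot> s) + len (s \<cdot> (iv b \<cdot> y))"
        using len_mult_le[of "w \<cdot> b \<cdot> s" "s \<cdot> (iv b \<cdot> y)"] bG w s y by simp
      \<comment> \<open>\<open>y\<close> violates the cone condition at \<open>b \<cdot> s\<close>.
        If \<open>s\<close> were a descent of \<open>iv b \<cdot> y\<close>, then either
        \<open>w \<cdot> b \<cdot> s\<close> is longer than \<open>w \<cdot> b\<close> and the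
        condition holds after all, or it is shorter and a path through it would be too short for
        \<open>w \<cdot> y\<close>.\<close>
      have "s \<notin> NN (iv b \<cdot> y)"
      proof
        assume sn: "s \<in> NN (iv b \<cdot> y)"
        have "len (s \<cdot> (iv b \<cdot> y)) = len (iv b \<cdot> y) - 1" "0 < len (iv b \<cdot> y)"
          using len_S_mult[OF s(1), of "iv b \<cdot> y"] sn bG y by auto
        moreover have "len (w \<cdot> b \<cdot> s) = len (w \<cdot> b) + 1 \<or> len (w \<cdot> b \<cdot> s) < len (w \<cdot> b)"
          using len_mult_S[OF s(1), of "w \<cdot> b"] bG w by (auto split: if_splits)
        ultimately show False using eq tri y(3) e1 e2 by auto
      qed
      then have "b \<cdot> s \<cdot> iv b \<in> NN y"
        using NN_mult[of "iv b" y s] bG y s by auto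
      then show ?thesis using len_refl_le[OF y(1)] y(2) bG by fastforce
    qed
    then have "len (iv b) \<le> h J" using h[rule_format, of J "iv b"] bG unfolding J_def by auto
    also have "h J \<le> R'" unfolding R'_def J_def using assms by (intro member_le_sum) auto
    finally show ?thesis using b(1) bG unfolding P_def by auto
  qed
  then show ?thesis using that by blast
qed

section \<open>Crossing walls\<close>

text \<open>When lengths add, no wall is crossed twice: a reflection inverted by \<open>a\<close>
  but not by \<open>a \<cdot> b\<close> could be inserted between the factors and would shorten
  both.\<close>

lemma NN_prefix:
  assumes "a \<in> G" "b \<in> G" "len (a \<cdot> b) = len a + len b" "t \<in> NN a"
  shows "t \<in> NN (a \<cdot> b)"
proof (rule ccontr)
  assume "t \<notin> NN (a \<cdot> b)"
  have t: "t \<in> refls" "t \<in> G" using NN_refls[OF assms(4,1)] by auto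
  have tb: "iv a \<cdot> t \<cdot> a \<in> NN b" using NN_mult[OF assms(1,2) t(2)] assms(4) \<open>t \<notin> NN (a \<cdot> b)\<close> by auto
  have "a \<cdot> b = (t \<cdot> a) \<cdot> ((iv a \<cdot> t \<cdot> a) \<cdot> b)" using assms t by (simp add: m_assoc)
  then have "len (a \<cdot> b) \<le> len (t \<cdot> a) + len ((iv a \<cdot> t \<cdot> a) \<cdot> b)"
    using len_mult_le[of "t \<cdot> a" "(iv a \<cdot> t \<cdot> a) \<cdot> b"] assms t by simp
  then show False
    using NN_refl_less[OF assms(1,4)] NN_refl_less[OF assms(2) tb] assms(3) by simp
qed

lemma len_split:
  assumes "us @ vs \<in> lists S" "len (wp (us @ vs)) = length (us @ vs)"
  shows "len (wp us) = length us" "len (wp vs) = length vs" "len (wp us \<cdot> wp vs) = len (wp us) + len (wp vs)"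
proof -
  have "us \<in> lists S" "vs \<in> lists S" using assms by auto
  then show "len (wp us) = length us" "len (wp vs) = length vs"
    "len (wp us \<cdot> wp vs) = len (wp us) + len (wp vs)"
    using len_le[of us] len_le[of vs] len_mult_le[of "wp us" "wp vs"] assms(2) by auto
qed

text \<open>A geodesic from \<open>p\<close> to \<open>q\<close> crosses the wall of
  \<open>t\<close> along an edge from \<open>x\<close> to \<open>x \<cdot> s\<close>. It crosses
  each wall at most once, so it stays on one side of the wall of \<open>t'\<close>, which does not
  separate its ends.\<close>

lemma dual_edge:
  assumes "p \<in> G" "q \<in> G" "t \<notin> NN p" "t \<in> NN q" "t' \<in> refls" "t' \<in> NN p \<longleftrightarrow> t' \<in> NN q"
  obtains x s where "x \<in> G" "s \<in> S" "t = x \<cdot> s \<cdot> iv x" "t \<notin> NN x" "t' \<in> NN x \<longleftrightarrow> t' \<in> NN p"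
proof -
  define u where "u = iv p \<cdot> q"
  have uG: "u \<in> G" and q: "q = p \<cdot> u" unfolding u_def using assms by auto
  have t: "t \<in> G" "t' \<in> G" using assms NN_carrier by auto
  define t0 where "t0 = iv p \<cdot> t \<cdot> p"
  have t0: "t0 \<in> NN u" "t0 \<in> G" "t = p \<cdot> t0 \<cdot> iv p"
    using NN_mult[OF assms(1) uG t(1)] assms q t unfolding t0_def by (auto simp: m_assoc)
  obtain ws where ws: "ws \<in> lists S" "wp ws = u" "length ws = len u" using len_word_ex[OF uG] by blast
  obtain us s vs where dec: "ws = us @ s # vs" "t0 = wp us \<cdot> s \<cdot> iv (wp us)"
    using NN_decompose[of t0 ws] ws t0 by metis
  define a where "a = wp us"
  have usS: "us \<in> lists S" "s \<in> S" "vs \<in> lists S" using ws dec by auto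
  have aG: "a \<in> G" using a_def usS by auto
  define b where "b = s \<cdot> wp vs"
  have bG: "b \<in> G" using b_def usS by auto
  have l1: "len a = length us" "len (a \<cdot> b) = len a + len b" and uab: "u = a \<cdot> b"
    using len_split[of us "s # vs"] ws dec usS unfolding a_def b_def by auto
  have l2: "len (a \<cdot> s) = length us + 1"
    using len_split(1)[of "us @ [s]" vs] ws dec usS unfolding a_def by auto
  have "t0 \<notin> NN a"
  proof
    assume "t0 \<in> NN a"
    then have "len (t0 \<cdot> a) < len a" by (rule NN_refl_less[OF aG])
    moreover have "t0 \<cdot> a = a \<cdot> s" using dec a_def aG usS by (simp add: m_assoc)
    ultimately show False using l1 l2 by simp
  qed
  then have 1: "t \<notin> NN (p \<cdot> a)"
    using NN_mult[OF assms(1) aG t(1)] assms(3) unfolding t0_def by simp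
  have "iv p \<cdot> t' \<cdot> p \<notin> NN u"
    using NN_mult[OF assms(1) uG t(2)] assms(6) q by blast
  then have "iv p \<cdot> t' \<cdot> p \<notin> NN a" using NN_prefix[OF aG bG l1(2)] uab by metis
  then have 2: "t' \<in> NN (p \<cdot> a) \<longleftrightarrow> t' \<in> NN p"
    using NN_mult[OF assms(1) aG t(2)] by simp
  have "t = p \<cdot> (a \<cdot> s \<cdot> iv a) \<cdot> iv p" using t0(3) dec a_def by simp
  also have "\<dots> = (p \<cdot> a) \<cdot> s \<cdot> iv (p \<cdot> a)" using assms(1) aG usS by (simp add: grp)
  finally show ?thesis using that[of "p \<cdot> a" s] 1 2 assms(1) aG usS by simp
qed

text \<open>The inversions of \<open>a\<close> lie in \<open>par J\<close>, and the
  \<open>a\<close>-conjugates of those of \<open>z\<close> avoid them, so the symmetric difference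
  in the cocycle rule is a disjoint union.\<close>

lemma par_len_add:
  assumes J: "J \<subseteq> S" and a: "a \<in> par J" and z: "z \<in> G" "NN z \<inter> par J = {}"
  shows "len (a \<cdot> z) = len a + len z"
proof -
  have aG: "a \<in> G" using par_closed[OF J a] .
  have disj: "iv a \<cdot> t \<cdot> a \<notin> NN z" if "t \<in> NN a" for t
  proof -
    have "t \<in> par J" using NN_par[OF J a that] .
    then have "iv a \<cdot> t \<cdot> a \<in> par J" using par_mult[OF J] par_inv[OF J] a by simp
    then show ?thesis using z by blast
  qed
  have "NN (a \<cdot> z) = NN a \<union> (\<lambda>t. a \<cdot> t \<cdot> iv a) ` NN z"
  proof (intro equalityI subsetI)
    fix t assume t: "t \<in> NN (a \<cdot> z)"
    then have tG: "t \<in> G" by (rule NN_carrier)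
    have "t = a \<cdot> (iv a \<cdot> t \<cdot> a) \<cdot> iv a" using tG aG by (simp add: m_assoc)
    then show "t \<in> NN a \<union> (\<lambda>t. a \<cdot> t \<cdot> iv a) ` NN z"
      using NN_mult[OF aG z(1) tG] t by blast
  next
    fix t assume "t \<in> NN a \<union> (\<lambda>t. a \<cdot> t \<cdot> iv a) ` NN z"
    then show "t \<in> NN (a \<cdot> z)"
    proof
      assume "t \<in> NN a"
      then show ?thesis using disj NN_mult[OF aG z(1) NN_carrier] by blast
    next
      assume "t \<in> (\<lambda>t. a \<cdot> t \<cdot> iv a) ` NN z"
      then obtain r where r: "r \<in> NN z" "t = a \<cdot> r \<cdot> iv a" by blast
      have rG: "r \<in> G" using r NN_carrier by blast
      have eq: "iv a \<cdot> t \<cdot> a = r" using r rG aG by (simp add: m_assoc)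
      have "t \<notin> NN a" using disj[of t] eq r by auto
      then show ?thesis using NN_mult[OF aG z(1), of t] eq r rG aG by simp
    qed
  qed
  moreover have "NN a \<inter> (\<lambda>t. a \<cdot> t \<cdot> iv a) ` NN z = {}"
  proof -
    have "a \<cdot> r \<cdot> iv a \<notin> NN a" if "r \<in> NN z" for r
    proof
      assume "a \<cdot> r \<cdot> iv a \<in> NN a"
      from disj[OF this] show False using that aG NN_carrier[OF that] by (simp add: m_assoc)
    qed
    then show ?thesis by blast
  qed
  moreover have "inj_on (\<lambda>t. a \<cdot> t \<cdot> iv a) (NN z)"
  proof (rule inj_onI)
    fix x y assume "x \<in> NN z" "y \<in> NN z" and eq: "a \<cdot> x \<cdot> iv a = a \<cdot> y \<cdot> iv a"
    then have "x \<in> G" "y \<in> G" using NN_carrier by auto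
    then show "x = y" using eq aG by simp
  qed
  ultimately show ?thesis using aG z
    by (simp add: len_NN card_Un_disjoint card_image)
qed

text \<open>The exchange condition deletes letters and introduces none. Hence an element of
  \<open>par J\<close> has a reduced word in \<open>J\<close>.\<close>

lemma reduced_subword:
  assumes "ws \<in> lists S"
  shows "\<exists>vs. set vs \<subseteq> set ws \<and> wp vs = wp ws \<and> length vs = len (wp ws)"
  using assms
proof (induction ws)
  case Nil
  then show ?case by (auto intro!: exI[of _ "[]"])
next
  case (Cons s ws)
  then obtain vs where vs: "set vs \<subseteq> set ws" "wp vs = wp ws" "length vs = len (wp ws)" by auto
  have s: "s \<in> S" and wsS: "ws \<in> lists S" and vsS: "vs \<in> lists S" using Cons vs by auto
  show ?case
  proof (cases "s \<in> NN (wp ws)")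
    case False
    then have "len (wp (s # ws)) = len (wp ws) + 1" using len_S_mult(1)[of s "wp ws"] s wsS by simp
    then show ?thesis using vs by (intro exI[of _ "s # vs"]) auto
  next
    case True
    then have l: "len (wp (s # ws)) = len (wp ws) - 1" using len_S_mult(1)[of s "wp ws"] s wsS by simp
    obtain us r vs' where *: "vs = us @ r # vs'" "s \<cdot> wp vs = wp (us @ vs')"
      using NN_decompose[of s vs] True vs vsS by metis
    have "set (us @ vs') \<subseteq> set (s # ws)" using vs(1) * by auto
    then show ?thesis using * vs l by (intro exI[of _ "us @ vs'"]) auto
  qed
qed

lemma par_reduced_word:
  assumes "J \<subseteq> S" "a \<in> par J"
  obtains ws where "ws \<in> lists J" "wp ws = a" "length ws = len a"
proof -
  obtain us where us: "us \<in> lists J" "a = wp us" using assms unfolding par_def by blast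
  then have "us \<in> lists S" using assms by auto
  from reduced_subword[OF this] obtain vs where "set vs \<subseteq> set us" "wp vs = wp us" "length vs = len (wp us)"
    by blast
  then show ?thesis using that[of vs] us by auto
qed

section \<open>Dihedral subgroups and the walk along a wall\<close>

lemma dihedral_conj:
  assumes "s \<in> S" "s' \<in> S"
  shows "s \<cdot> (s \<cdot> s') [^]\<^bsub>W\<^esub> (k::int) = (s \<cdot> s') [^]\<^bsub>W\<^esub> (- k) \<cdot> s"
proof -
  let ?p = "s \<cdot> s'"
  have p: "?p \<in> G" using assms by simp
  have nat: "s \<cdot> ?p [^]\<^bsub>W\<^esub> (int n) = ?p [^]\<^bsub>W\<^esub> (- int n) \<cdot> s" for n
  proof (induction n)
    case 0
    then show ?case using assms by simp
  next
    case (Suc n)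
    have "s \<cdot> ?p [^]\<^bsub>W\<^esub> int (Suc n) = s \<cdot> (?p [^]\<^bsub>W\<^esub> int n \<cdot> ?p)"
      using p int_pow_mult[of ?p "int n" 1] by (simp add: add.commute)
    also have "\<dots> = ?p [^]\<^bsub>W\<^esub> (- int n) \<cdot> s \<cdot> ?p"
      using Suc.IH p assms by (simp flip: m_assoc)
    also have "\<dots> = ?p [^]\<^bsub>W\<^esub> (- int n) \<cdot> (iv ?p \<cdot> s)"
      using p assms by (simp add: grp)
    also have "\<dots> = ?p [^]\<^bsub>W\<^esub> (- int (Suc n)) \<cdot> s"
      using p assms int_pow_mult[of ?p "- int n" "- 1"] int_pow_neg[of ?p 1]
      by (simp add: m_assoc add.commute)
    finally show ?case .
  qed
  show ?thesis
  proof (cases k rule: int_cases2)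
    case (nonneg n)
    then show ?thesis using nat by simp
  next
    case (nonpos n)
    have "s \<cdot> (?p [^]\<^bsub>W\<^esub> (- int n) \<cdot> s) = s \<cdot> (s \<cdot> ?p [^]\<^bsub>W\<^esub> (int n))" using nat[of n] by simp
    also have "\<dots> = ?p [^]\<^bsub>W\<^esub> (int n)" using assms p by simp
    finally have "s \<cdot> (?p [^]\<^bsub>W\<^esub> (- int n) \<cdot> s) \<cdot> s = ?p [^]\<^bsub>W\<^esub> (int n) \<cdot> s" by simp
    then show ?thesis using nonpos assms p by (simp add: m_assoc)
  qed
qed

lemma dihedral_form:
  assumes "s \<in> S" "s' \<in> S" "a \<in> par {s, s'}"
  shows "\<exists>k::int. a = (s \<cdot> s') [^]\<^bsub>W\<^esub> k \<or> a = (s \<cdot> s') [^]\<^bsub>W\<^esub> k \<cdot> s"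
proof -
  let ?p = "s \<cdot> s'"
  have p: "?p \<in> G" using assms by simp
  have ls: "\<exists>k::int. s \<cdot> x = ?p [^]\<^bsub>W\<^esub> k \<or> s \<cdot> x = ?p [^]\<^bsub>W\<^esub> k \<cdot> s"
    if "x = ?p [^]\<^bsub>W\<^esub> k \<or> x = ?p [^]\<^bsub>W\<^esub> k \<cdot> s" for x and k :: int
  proof -
    have 1: "s \<cdot> ?p [^]\<^bsub>W\<^esub> k = ?p [^]\<^bsub>W\<^esub> (- k) \<cdot> s" by (rule dihedral_conj[OF assms(1,2)])
    have "s \<cdot> (?p [^]\<^bsub>W\<^esub> k \<cdot> s) = s \<cdot> ?p [^]\<^bsub>W\<^esub> k \<cdot> s" using p assms by (simp add: m_assoc)
    also have "\<dots> = ?p [^]\<^bsub>W\<^esub> (- k)" unfolding 1 using p assms by (simp add: m_assoc)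
    finally show ?thesis using that 1 by metis
  qed
  have lp: "\<exists>k::int. ?p \<cdot> x = ?p [^]\<^bsub>W\<^esub> k \<or> ?p \<cdot> x = ?p [^]\<^bsub>W\<^esub> k \<cdot> s"
    if "x = ?p [^]\<^bsub>W\<^esub> k \<or> x = ?p [^]\<^bsub>W\<^esub> k \<cdot> s" for x and k :: int
  proof -
    have "?p \<cdot> ?p [^]\<^bsub>W\<^esub> k = ?p [^]\<^bsub>W\<^esub> (1 + k)" using int_pow_mult[OF p, of 1 k] p by simp
    moreover from this have "?p \<cdot> (?p [^]\<^bsub>W\<^esub> k \<cdot> s) = ?p [^]\<^bsub>W\<^esub> (1 + k) \<cdot> s"
      using p assms m_assoc[of ?p "?p [^]\<^bsub>W\<^esub> k" s] by simp
    ultimately show ?thesis using that by metis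
  qed
  obtain ws where "ws \<in> lists {s, s'}" "a = wp ws" using assms unfolding par_def by blast
  then show ?thesis
  proof (induction ws arbitrary: a)
    case Nil
    then show ?case by (intro exI[of _ 0]) simp
  next
    case (Cons r ws)
    then obtain k :: int where k: "wp ws = ?p [^]\<^bsub>W\<^esub> k \<or> wp ws = ?p [^]\<^bsub>W\<^esub> k \<cdot> s" by blast
    have wsG: "wp ws \<in> G" using k p assms by auto
    consider "r = s" | "r = s'" using Cons by auto
    then show ?case
    proof cases
      case 1
      then show ?thesis using ls[OF k] Cons.prems by simp
    next
      case 2
      obtain k' :: int where k': "?p \<cdot> wp ws = ?p [^]\<^bsub>W\<^esub> k' \<or> ?p \<cdot> wp ws = ?p [^]\<^bsub>W\<^esub> k' \<cdot> s"
        using lp[OF k] by blast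
      have "s \<cdot> (?p \<cdot> wp ws) = a" using 2 Cons.prems wsG assms by (simp add: m_assoc)
      then show ?thesis using ls[OF k'] by simp
    qed
  qed
qed

text \<open>In an infinite dihedral group \<open>s\<close> commutes only with 1 and
  \<open>s\<close>, and is not conjugate to \<open>s'\<close>. Concretely,
  \<open>iv a \<cdot> s \<cdot> a\<close> would be a nonzero even power of
  \<open>s \<cdot> s'\<close> times \<open>s\<close>, whereas \<open>s\<close> and \<open>s'\<close>
  have the exponents 0 and -1.\<close>

lemma dihedral_finite:
  assumes "s \<in> S" "s' \<in> S" "a \<in> par {s, s'}" "a \<noteq> \<epsilon>" "a \<noteq> s" "iv a \<cdot> s \<cdot> a \<in> {s, s'}"
  shows "cox_m W s s' \<noteq> 0"
proof
  let ?p = "s \<cdot> s'"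
  assume "cox_m W s s' = 0"
  then have ord: "i = 0" if "?p [^]\<^bsub>W\<^esub> (i::int) = \<epsilon>" for i
    using that int_pow_eq_id[of ?p i] assms unfolding cox_m_def by simp
  have p: "?p \<in> G" using assms by simp
  obtain k :: int where k: "a = ?p [^]\<^bsub>W\<^esub> k \<or> a = ?p [^]\<^bsub>W\<^esub> k \<cdot> s"
    using dihedral_form[OF assms(1-3)] by blast
  have "k \<noteq> 0" using k assms by auto
  have inv: "iv (?p [^]\<^bsub>W\<^esub> k) = ?p [^]\<^bsub>W\<^esub> (- k)" using p by (simp add: int_pow_neg)
  have c1: "?p [^]\<^bsub>W\<^esub> (- k) \<cdot> s \<cdot> ?p [^]\<^bsub>W\<^esub> k = ?p [^]\<^bsub>W\<^esub> (- 2 * k) \<cdot> s"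
  proof -
    have "?p [^]\<^bsub>W\<^esub> (- k) \<cdot> s \<cdot> ?p [^]\<^bsub>W\<^esub> k = ?p [^]\<^bsub>W\<^esub> (- k) \<cdot> (?p [^]\<^bsub>W\<^esub> (- k) \<cdot> s)"
      using dihedral_conj[OF assms(1,2), of k] p assms by (simp add: m_assoc)
    also have "\<dots> = ?p [^]\<^bsub>W\<^esub> (- k + - k) \<cdot> s" using p assms by (simp only: int_pow_mult) (simp add: m_assoc)
    finally show ?thesis by simp
  qed
  have "\<exists>j. j \<noteq> 0 \<and> even j \<and> iv a \<cdot> s \<cdot> a = ?p [^]\<^bsub>W\<^esub> (j::int) \<cdot> s"
    using k
  proof
    assume "a = ?p [^]\<^bsub>W\<^esub> k"
    then show ?thesis using c1 inv \<open>k \<noteq> 0\<close> by (intro exI[of _ "- 2 * k"]) auto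
  next
    assume a: "a = ?p [^]\<^bsub>W\<^esub> k \<cdot> s"
    have "iv a \<cdot> s \<cdot> a = s \<cdot> (?p [^]\<^bsub>W\<^esub> (- k) \<cdot> s \<cdot> ?p [^]\<^bsub>W\<^esub> k) \<cdot> s"
      unfolding a using p assms inv by (simp add: grp)
    also have "\<dots> = s \<cdot> ?p [^]\<^bsub>W\<^esub> (- 2 * k)" unfolding c1 using p assms by (simp add: m_assoc)
    also have "\<dots> = ?p [^]\<^bsub>W\<^esub> (2 * k) \<cdot> s" using dihedral_conj[OF assms(1,2), of "- 2 * k"] by simp
    finally show ?thesis using \<open>k \<noteq> 0\<close> by (intro exI[of _ "2 * k"]) auto
  qed
  then obtain j :: int where j: "j \<noteq> 0" "even j" "iv a \<cdot> s \<cdot> a = ?p [^]\<^bsub>W\<^esub> j \<cdot> s" by blast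
  consider "?p [^]\<^bsub>W\<^esub> j \<cdot> s = s" | "?p [^]\<^bsub>W\<^esub> j \<cdot> s = s'" using assms(6) j(3) by auto
  then show False
  proof cases
    case 1
    then have "?p [^]\<^bsub>W\<^esub> j = \<epsilon>" using p assms by simp
    then show False using ord j by blast
  next
    case 2
    have "s \<cdot> (?p [^]\<^bsub>W\<^esub> j \<cdot> s) = ?p [^]\<^bsub>W\<^esub> (- j)"
    proof -
      have "s \<cdot> (?p [^]\<^bsub>W\<^esub> j \<cdot> s) = (s \<cdot> ?p [^]\<^bsub>W\<^esub> j) \<cdot> s" using p assms by (simp add: m_assoc)
      also have "\<dots> = ?p [^]\<^bsub>W\<^esub> (- j)" unfolding dihedral_conj[OF assms(1,2)] using p assms by (simp add: m_assoc)
      finally show ?thesis .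
    qed
    then have "?p = ?p [^]\<^bsub>W\<^esub> (- j)" using 2 by simp
    then have "?p [^]\<^bsub>W\<^esub> (- j - 1) = \<epsilon>" using p int_pow_diff[OF p, of "-j" 1] by simp
    from ord[OF this] show False using j(2) by presburger
  qed
qed

text \<open>One walks along the wall of \<open>t\<close> from the edge at \<open>x\<close> to the edge at \<open>y\<close>, each step passing to
  the opposite edge of a finite residue of rank 2. The side of \<open>t'\<close> changes in one of these
  residues, whose walls then include both.\<close>

lemma crossing_walk:
  assumes "x \<in> G" "y \<in> G" "s \<in> S" "s' \<in> S" "t = x \<cdot> s \<cdot> iv x" "t = y \<cdot> s' \<cdot> iv y"
    "t \<notin> NN x" "t \<notin> NN y" "t' \<in> refls" "t' \<noteq> t" "(t' \<in> NN x) \<noteq> (t' \<in> NN y)"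
  shows "\<exists>x\<in>G. \<exists>s\<in>S. \<exists>s1\<in>S. \<exists>r\<in>par {s, s1}. cox_m W s s1 \<noteq> 0 \<and>
    t = x \<cdot> s \<cdot> iv x \<and> t' = x \<cdot> r \<cdot> iv x"
  using assms
proof (induction "len (iv x \<cdot> y)" arbitrary: x s rule: less_induct)
  case less
  note xG = \<open>x \<in> G\<close> and yG = \<open>y \<in> G\<close> and sS = \<open>s \<in> S\<close>
  define g where "g = iv x \<cdot> y"
  have gG: "g \<in> G" and y: "y = x \<cdot> g" using g_def less.prems by auto
  have "g \<noteq> \<epsilon>" using y less.prems by auto
  \<comment> \<open>The first letter of a geodesic from \<open>x\<close> to \<open>y\<close> selects
    the residue to be crossed; below, \<open>a\<close> is the part of \<open>g\<close> spent in
    it.\<close>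
  then obtain s1 where s1: "s1 \<in> S" "s1 \<in> NN g" using first_letter[OF gG] by blast
  have tG: "t \<in> G" "t' \<in> G" using less.prems by auto
  have xtx: "iv x \<cdot> t \<cdot> x = s"
    unfolding \<open>t = x \<cdot> s \<cdot> iv x\<close> using xG sS by (simp add: m_assoc)
  have sg: "s \<notin> NN g"
    using NN_mult[OF xG gG tG(1)] less.prems xtx y by simp
  define J where "J = {s, s1}"
  have J: "J \<subseteq> S" using J_def s1 sS by simp
  obtain a g' where a: "a \<in> par J" "g' \<in> G" "g = a \<cdot> g'" "NN g' \<inter> par J = {}"
    using par_coset[OF J gG] by blast
  have aG: "a \<in> G" using par_closed[OF J a(1)] .
  have NNa: "r \<in> NN a \<longleftrightarrow> r \<in> NN g" if "r \<in> par J" for r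
  proof -
    have "iv a \<cdot> r \<cdot> a \<in> par J" using par_mult[OF J] par_inv[OF J] a that by simp
    then have "iv a \<cdot> r \<cdot> a \<notin> NN g'" using a by blast
    then show ?thesis using NN_mult[OF aG a(2) par_closed[OF J that]] a by simp
  qed
  have sa: "s \<notin> NN a" "s1 \<in> NN a" using NNa par_generator[OF J] sg s1 J_def by auto
  have ane: "a \<noteq> \<epsilon>" "a \<noteq> s" using sa sS by auto
  have s_eq: "s = g \<cdot> s' \<cdot> iv g"
  proof -
    have "s = iv x \<cdot> (y \<cdot> s' \<cdot> iv y) \<cdot> x" using xtx \<open>t = y \<cdot> s' \<cdot> iv y\<close> by metis
    also have "\<dots> = g \<cdot> s' \<cdot> iv g" unfolding g_def using xG yG \<open>s' \<in> S\<close> by (simp add: grp)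
    finally show ?thesis .
  qed
  define r2 where "r2 = iv a \<cdot> s \<cdot> a"
  have r2: "r2 = g' \<cdot> s' \<cdot> iv g'"
    unfolding r2_def s_eq a(3) using aG a(2) less.prems by (simp add: grp)
  have r2P: "r2 \<in> par J"
    unfolding r2_def using par_mult[OF J] par_inv[OF J] a par_generator[OF J, of s] J_def by simp
  have r2G: "r2 \<in> G" using par_closed[OF J r2P] .
  \<comment> \<open>Lengths add on the left, while the right side is at most one letter longer than
    \<open>g'\<close>. So \<open>r2\<close> is a single generator, the type of the opposite edge at
    \<open>x \<cdot> a\<close>.\<close>
  have "r2 \<cdot> g' = g' \<cdot> s'" unfolding r2 using a less.prems by (simp add: m_assoc)
  then have "len r2 + len g' = len (g' \<cdot> s')" using par_len_add[OF J r2P a(2,4)] by simp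
  then have "len r2 \<le> 1" using len_mult_S(1)[OF \<open>s' \<in> S\<close> a(2)] by (auto split: if_splits)
  moreover have "r2 \<noteq> \<epsilon>"
  proof
    assume "r2 = \<epsilon>"
    then have "a \<cdot> (iv a \<cdot> s \<cdot> a) \<cdot> iv a = \<epsilon>" unfolding r2_def using aG by simp
    then have "s = \<epsilon>" using aG sS by (simp add: m_assoc)
    then show False using S_neq1[OF sS] by simp
  qed
  ultimately have "len r2 = 1" using r2G by (cases "len r2") auto
  then obtain ws where "ws \<in> lists J" "wp ws = r2" "length ws = 1"
    using par_reduced_word[OF J r2P] by metis
  then have r2J: "r2 \<in> J" using J by (auto simp: length_Suc_conv)
  then have r2S: "r2 \<in> S" using J by blast
  have m: "cox_m W s s1 \<noteq> 0"
    using dihedral_finite[OF sS s1(1) _ ane] a(1) r2J unfolding J_def r2_def by blast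
  define r where "r = iv x \<cdot> t' \<cdot> x"
  have t'r: "t' = x \<cdot> r \<cdot> iv x" unfolding r_def using xG tG by (simp add: m_assoc)
  show ?case
  proof (cases "r \<in> NN a")
    case True
    then have "r \<in> par {s, s1}" using NN_par[OF J a(1)] J_def by simp
    then show ?thesis using m t'r less.prems s1 by blast
  next
    case False
    have 1: "t' \<in> NN (x \<cdot> a) \<longleftrightarrow> t' \<in> NN x"
      using NN_mult[OF xG aG tG(2)] False r_def by simp
    have 2: "t \<notin> NN (x \<cdot> a)" using NN_mult[OF xG aG tG(1)] sa less.prems xtx by simp
    have 3: "t = (x \<cdot> a) \<cdot> r2 \<cdot> iv (x \<cdot> a)"
      unfolding r2_def using xG aG sS less.prems by (simp add: grp)
    have 4: "iv (x \<cdot> a) \<cdot> y = g'" using xG aG a y by (simp add: grp)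
    have "len g = len a + len g'" using par_len_add[OF J a(1,2,4)] a(3) by simp
    moreover have "len a \<noteq> 0" using len_0_iff[OF aG] ane(1) by blast
    ultimately have lt: "len (iv (x \<cdot> a) \<cdot> y) < len (iv x \<cdot> y)" using 4 g_def by simp
    show ?thesis
      by (rule less.hyps[OF lt _ yG r2S \<open>s' \<in> S\<close> 3 \<open>t = y \<cdot> s' \<cdot> iv y\<close> 2 \<open>t \<notin> NN y\<close> \<open>t' \<in> refls\<close> \<open>t' \<noteq> t\<close>])
        (use xG aG 1 less.prems in auto)
  qed
qed

lemma len_parity:
  assumes "ws \<in> lists S" shows "even (length ws) \<longleftrightarrow> even (len (wp ws))"
  using assms
proof (induction ws)
  case (Cons s ws)
  then show ?case using len_S_mult[of s "wp ws"] by auto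
qed simp

lemma len_mult_parity:
  assumes "v \<in> G" "w \<in> G" shows "even (len (v \<cdot> w)) \<longleftrightarrow> (even (len v) \<longleftrightarrow> even (len w))"
proof -
  obtain us vs where "us \<in> lists S" "wp us = v" "vs \<in> lists S" "wp vs = w"
    using word_ex[OF assms(1)] word_ex[OF assms(2)] by blast
  then show ?thesis using len_parity[of us] len_parity[of vs] len_parity[of "us @ vs"] by auto
qed

text \<open>The fourth quadrant always contains \<open>\<epsilon>\<close>, so this says that all
  four intersections of half-spaces are nonempty.\<close>

definition crossing :: "'w \<Rightarrow> 'w \<Rightarrow> bool" where
  "crossing t t' \<longleftrightarrow> t \<in> refls \<and> t' \<in> refls \<and>
     (\<exists>x\<in>G. t \<in> NN x \<and> t' \<in> NN x) \<and> (\<exists>x\<in>G. t \<in> NN x \<and> t' \<notin> NN x) \<and> (\<exists>x\<in>G. t \<notin> NN x \<and> t' \<in> NN x)"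

text \<open>By \<open>dual_edge\<close> the wall of \<open>t\<close> has an edge on each side of the
  wall of \<open>t'\<close>, which starts \<open>crossing_walk\<close>. The reflection
  \<open>r\<close> has odd length, so it is not a power of \<open>s \<cdot> s1\<close>; then
  \<open>s \<cdot> r\<close> is one.\<close>

lemma crossing_dihedral:
  assumes "crossing t t'"
  obtains x s s1 r k where "x \<in> G" "s \<in> S" "s1 \<in> S" "r \<in> G" "cox_m W s s1 \<noteq> 0"
    "t = x \<cdot> s \<cdot> iv x" "t' = x \<cdot> r \<cdot> iv x" "s \<cdot> r = (s \<cdot> s1) [^]\<^bsub>W\<^esub> (k::int)" "s \<cdot> r \<noteq> \<epsilon>"
proof -
  obtain q' q p' where *: "t \<in> refls" "t' \<in> refls" "q' \<in> G" "t \<in> NN q'" "t' \<in> NN q'"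
      "q \<in> G" "t \<in> NN q" "t' \<notin> NN q" "p' \<in> G" "t \<notin> NN p'" "t' \<in> NN p'"
    using assms unfolding crossing_def by blast
  have ne: "t' \<noteq> t" using * by blast
  obtain x s where x: "x \<in> G" "s \<in> S" "t = x \<cdot> s \<cdot> iv x" "t \<notin> NN x" "t' \<in> NN x \<longleftrightarrow> t' \<in> NN \<epsilon>"
    by (rule dual_edge[of \<epsilon> q t t']) (use * in auto)
  obtain y s' where y: "y \<in> G" "s' \<in> S" "t = y \<cdot> s' \<cdot> iv y" "t \<notin> NN y" "t' \<in> NN y \<longleftrightarrow> t' \<in> NN p'"
    by (rule dual_edge[of p' q' t t']) (use * in auto)
  have "\<exists>x\<in>G. \<exists>s\<in>S. \<exists>s1\<in>S. \<exists>r\<in>par {s, s1}. cox_m W s s1 \<noteq> 0 \<and>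
    t = x \<cdot> s \<cdot> iv x \<and> t' = x \<cdot> r \<cdot> iv x"
    by (rule crossing_walk[OF x(1) y(1) x(2) y(2) x(3) y(3) x(4) y(4)]) (use * ne x y in auto)
  then obtain x s s1 r where c: "x \<in> G" "s \<in> S" "s1 \<in> S" "r \<in> par {s, s1}" "cox_m W s s1 \<noteq> 0"
    "t = x \<cdot> s \<cdot> iv x" "t' = x \<cdot> r \<cdot> iv x" by blast
  let ?p = "s \<cdot> s1"
  have p: "?p \<in> G" using c by simp
  have J: "{s, s1} \<subseteq> S" using c by simp
  have rG: "r \<in> G" using par_closed[OF J c(4)] .
  have "r = iv x \<cdot> t' \<cdot> x" using c rG by (simp add: m_assoc)
  then have rr: "r \<in> refls" using refls_conj'[OF *(2) c(1)] by simp
  obtain w s2 where "w \<in> G" "s2 \<in> S" "r = w \<cdot> s2 \<cdot> iv w" using reflsE[OF rr] by blast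
  then have odd: "odd (len r)" by (simp add: len_mult_parity)
  obtain k :: int where k: "r = ?p [^]\<^bsub>W\<^esub> k \<or> r = ?p [^]\<^bsub>W\<^esub> k \<cdot> s"
    using dihedral_form[OF c(2,3,4)] by blast
  have nat: "even (len (?p [^]\<^bsub>W\<^esub> n))" for n :: nat
  proof (induction n)
    case (Suc n)
    then show ?case using p c by (simp add: len_mult_parity)
  qed simp
  have "even (len (?p [^]\<^bsub>W\<^esub> k))"
    using nat p by (cases k rule: int_cases2) (auto simp: int_pow_int int_pow_neg)
  then have "r = ?p [^]\<^bsub>W\<^esub> k \<cdot> s" using k odd by auto
  then have "s \<cdot> r = (s \<cdot> ?p [^]\<^bsub>W\<^esub> k) \<cdot> s" using p c by (simp add: m_assoc)
  also have "\<dots> = ?p [^]\<^bsub>W\<^esub> (- k)"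
    unfolding dihedral_conj[OF c(2,3)] using p c by (simp add: m_assoc)
  finally have "s \<cdot> r = ?p [^]\<^bsub>W\<^esub> (- k)" .
  moreover have "s \<cdot> r \<noteq> \<epsilon>"
  proof
    assume "s \<cdot> r = \<epsilon>"
    then have "s \<cdot> (s \<cdot> r) = s" using c by simp
    then have "r = s" using c rG by simp
    then show False using ne c by simp
  qed
  ultimately show ?thesis using that c rG by blast
qed

end

section \<open>Asymptotic dimension\<close>

text \<open>An arbitrary index set in place of an initial segment of the naturals lets sets of tree
  factors serve as colours.\<close>

definition coloured_cover ::
    "'p set \<Rightarrow> 'a set \<Rightarrow> ('a \<Rightarrow> 'a \<Rightarrow> real) \<Rightarrow> real \<Rightarrow> ('p \<Rightarrow> 'a set set) \<Rightarrow> real \<Rightarrow> bool" where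
  "coloured_cover P X d r \<U> D \<longleftrightarrow> (\<Union>p\<in>P. \<Union>(\<U> p)) = X \<and>
     (\<forall>p\<in>P. \<forall>U\<in>\<U> p. \<forall>x\<in>U. \<forall>y\<in>U. d x y \<le> D) \<and>
     (\<forall>p\<in>P. \<forall>U\<in>\<U> p. \<forall>V\<in>\<U> p. U \<noteq> V \<longrightarrow> (\<forall>x\<in>U. \<forall>y\<in>V. r \<le> d x y))"

lemma asdim_le_iff_coloured_cover:
  "asdim_le X d n \<longleftrightarrow> (\<forall>r>0. \<exists>\<U> D. coloured_cover {..n} X d r \<U> D)"
proof -
  have all: "(\<forall>i\<in>{..n}. P i) = (\<forall>i\<le>n. P i)" for P :: "nat \<Rightarrow> bool" by auto
  show ?thesis unfolding asdim_le_def coloured_cover_def all ex_simps ..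
qed

lemma coloured_coverI:
  assumes "\<And>x. x \<in> X \<Longrightarrow> \<exists>p\<in>P. \<exists>U\<in>\<U> p. x \<in> U"
    and "\<And>p U. p \<in> P \<Longrightarrow> U \<in> \<U> p \<Longrightarrow> U \<subseteq> X"
    and "\<And>p U x y. p \<in> P \<Longrightarrow> U \<in> \<U> p \<Longrightarrow> x \<in> U \<Longrightarrow> y \<in> U \<Longrightarrow> d x y \<le> D"
    and "\<And>p U V x y. p \<in> P \<Longrightarrow> U \<in> \<U> p \<Longrightarrow> V \<in> \<U> p \<Longrightarrow> U \<noteq> V \<Longrightarrow> x \<in> U \<Longrightarrow> y \<in> V \<Longrightarrow> r \<le> d x y"
  shows "coloured_cover P X d r \<U> D"
proof -
  have "(\<Union>p\<in>P. \<Union>(\<U> p)) = X" using assms(1,2) by fast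
  then show ?thesis unfolding coloured_cover_def using assms(3,4) by simp
qed

lemma coloured_coverD:
  assumes "coloured_cover P X d r \<U> D"
  shows "x \<in> X \<Longrightarrow> \<exists>p\<in>P. \<exists>U\<in>\<U> p. x \<in> U"
    and "p \<in> P \<Longrightarrow> U \<in> \<U> p \<Longrightarrow> U \<subseteq> X"
    and "p \<in> P \<Longrightarrow> U \<in> \<U> p \<Longrightarrow> x \<in> U \<Longrightarrow> y \<in> U \<Longrightarrow> d x y \<le> D"
    and "p \<in> P \<Longrightarrow> U \<in> \<U> p \<Longrightarrow> V \<in> \<U> p \<Longrightarrow> U \<noteq> V \<Longrightarrow> x \<in> U \<Longrightarrow> y \<in> V \<Longrightarrow> r \<le> d x y"
proof -
  have X: "X = (\<Union>p\<in>P. \<Union>(\<U> p))"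
    and 3: "\<forall>p\<in>P. \<forall>U\<in>\<U> p. \<forall>x\<in>U. \<forall>y\<in>U. d x y \<le> D"
    and 4: "\<forall>p\<in>P. \<forall>U\<in>\<U> p. \<forall>V\<in>\<U> p. U \<noteq> V \<longrightarrow> (\<forall>x\<in>U. \<forall>y\<in>V. r \<le> d x y)"
    using assms unfolding coloured_cover_def by simp_all
  show "x \<in> X \<Longrightarrow> \<exists>p\<in>P. \<exists>U\<in>\<U> p. x \<in> U" using X by simp
  show "p \<in> P \<Longrightarrow> U \<in> \<U> p \<Longrightarrow> U \<subseteq> X" using X by auto
  show "p \<in> P \<Longrightarrow> U \<in> \<U> p \<Longrightarrow> x \<in> U \<Longrightarrow> y \<in> U \<Longrightarrow> d x y \<le> D" using 3 by simp
  show "p \<in> P \<Longrightarrow> U \<in> \<U> p \<Longrightarrow> V \<in> \<U> p \<Longrightarrow> U \<noteq> V \<Longrightarrow> x \<in> U \<Longrightarrow> y \<in> V \<Longrightarrow> r \<le> d x y"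
    using 4 by simp
qed

text \<open>A cover of \<open>Y\<close> at a scale dictated by \<open>control\<close> is pulled back
  along \<open>f\<close>; \<open>expand\<close> keeps the preimages bounded.\<close>

lemma asdim_le_coarse_embedding:
  assumes "asdim_le Y e n"
    and map: "\<And>x. x \<in> X \<Longrightarrow> f x \<in> Y"
    and expand: "\<And>D. \<exists>D'. \<forall>x\<in>X. \<forall>y\<in>X. e (f x) (f y) \<le> D \<longrightarrow> d x y \<le> D'"
    and control: "\<And>r. \<exists>r'. \<forall>x\<in>X. \<forall>y\<in>X. d x y < r \<longrightarrow> e (f x) (f y) < r'"
  shows "asdim_le X d n"
  unfolding asdim_le_iff_coloured_cover
proof (intro allI impI)
  fix r :: real
  obtain r0 where r0: "\<forall>x\<in>X. \<forall>y\<in>X. d x y < r \<longrightarrow> e (f x) (f y) < r0" using control by blast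
  \<comment> \<open>The maximum with 1 gives a positive scale, as \<open>asdim_le\<close>
    requires.\<close>
  define r' where "r' = max r0 1"
  have r': "r' > 0" and r'2: "\<And>x y. x \<in> X \<Longrightarrow> y \<in> X \<Longrightarrow> d x y < r \<Longrightarrow> e (f x) (f y) < r'"
    using r0 unfolding r'_def by (auto simp: less_max_iff_disj)
  obtain \<U> D where U: "coloured_cover {..n} Y e r' \<U> D"
    using assms(1) r' unfolding asdim_le_iff_coloured_cover by blast
  obtain D' where D': "\<forall>x\<in>X. \<forall>y\<in>X. e (f x) (f y) \<le> D \<longrightarrow> d x y \<le> D'" using expand by blast
  define \<V> where "\<V> = (\<lambda>i. (\<lambda>U. {x\<in>X. f x \<in> U}) ` \<U> i)"
  have "coloured_cover {..n} X d r \<V> D'"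
  proof (rule coloured_coverI)
    fix x assume x: "x \<in> X"
    then obtain i U where "i \<in> {..n}" "U \<in> \<U> i" "f x \<in> U" using coloured_coverD(1)[OF U map[OF x]] by blast
    then show "\<exists>p\<in>{..n}. \<exists>U\<in>\<V> p. x \<in> U" unfolding \<V>_def using x
      by (intro bexI[of _ i] bexI[of _ "{x\<in>X. f x \<in> U}"]) auto
  next
    fix i U assume "U \<in> \<V> i" then show "U \<subseteq> X" unfolding \<V>_def by auto
  next
    fix i U x y assume "i \<in> {..n}" "U \<in> \<V> i" "x \<in> U" "y \<in> U"
    then show "d x y \<le> D'" unfolding \<V>_def using coloured_coverD(3)[OF U] D' by auto
  next
    fix i U V x y assume *: "i \<in> {..n}" "U \<in> \<V> i" "V \<in> \<V> i" "U \<noteq> V" "x \<in> U" "y \<in> V"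
    then obtain U' V' where UV: "U' \<in> \<U> i" "U = {x\<in>X. f x \<in> U'}" "V' \<in> \<U> i" "V = {x\<in>X. f x \<in> V'}"
      unfolding \<V>_def by auto
    then have "U' \<noteq> V'" using * by auto
    then have "r' \<le> e (f x) (f y)" using coloured_coverD(4)[OF U, of i U' V' "f x" "f y"] UV * by simp
    moreover have "x \<in> X" "y \<in> X" using UV * by auto
    ultimately show "r \<le> d x y" using r'2[of x y] by linarith
  qed
  then show "\<exists>\<U> D. coloured_cover {..n} X d r \<U> D" by blast
qed

lemma asdim_le_isometric_embedding:
  assumes "asdim_le Y e n" "\<And>x. x \<in> X \<Longrightarrow> f x \<in> Y"
    and iso: "\<And>x y. x \<in> X \<Longrightarrow> y \<in> X \<Longrightarrow> e (f x) (f y) = d x y"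
  shows "asdim_le X d n"
proof (rule asdim_le_coarse_embedding[OF assms(1,2)])
  show "\<exists>D'. \<forall>x\<in>X. \<forall>y\<in>X. e (f x) (f y) \<le> D \<longrightarrow> d x y \<le> D'" for D
    using iso by (intro exI[of _ D]) simp
  show "\<exists>r'. \<forall>x\<in>X. \<forall>y\<in>X. d x y < r \<longrightarrow> e (f x) (f y) < r'" for r
    using iso by (intro exI[of _ r]) simp
qed

lemma asdim_cong:
  assumes "\<And>n. asdim_le X d n \<longleftrightarrow> asdim_le Y e n" shows "asdim X d = asdim Y e"
proof -
  have "{n. asdim_le X d n} = {n. asdim_le Y e n}" using assms by blast
  then show ?thesis unfolding asdim_def by (rule arg_cong)
qed

lemma asdim_isometric:
  assumes "isometric X d Y e" shows "asdim X d = asdim Y e"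
proof (rule asdim_cong)
  fix n
  obtain f where f: "bij_betw f X Y" and iso: "\<And>x y. x \<in> X \<Longrightarrow> y \<in> X \<Longrightarrow> e (f x) (f y) = d x y"
    using assms unfolding isometric_def by blast
  define g where "g = inv_into X f"
  have g: "g y \<in> X" "f (g y) = y" if "y \<in> Y" for y
    using f that unfolding g_def bij_betw_def by (auto intro: inv_into_into f_inv_into_f)
  show "asdim_le X d n \<longleftrightarrow> asdim_le Y e n"
  proof
    assume "asdim_le X d n"
    then show "asdim_le Y e n"
    proof (rule asdim_le_isometric_embedding)
      show "d (g x) (g y) = e x y" if "x \<in> Y" "y \<in> Y" for x y
        using iso[of "g x" "g y"] g that by simp
    qed (rule g)
  next
    assume "asdim_le Y e n"
    then show "asdim_le X d n"
    proof (rule asdim_le_isometric_embedding)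
      show "f x \<in> Y" if "x \<in> X" for x using f that unfolding bij_betw_def by blast
    qed (rule iso)
  qed
qed

lemma asdim_finite: assumes "asdim_le X d n" shows "asdim X d \<noteq> \<infinity>"
proof -
  have "asdim X d \<le> enat n" unfolding asdim_def using assms by (intro Inf_lower) auto
  then show ?thesis by (metis enat_ord_simps(5) enat.distinct(1))
qed

lemma asdim_le_finite_index:
  fixes P :: "'p set"
  assumes "finite P"
    and cover: "\<And>r. r > 0 \<Longrightarrow> \<exists>\<U> D. coloured_cover P X d r \<U> D"
  shows "asdim_le X d (card P)"
  unfolding asdim_le_iff_coloured_cover
proof (intro allI impI)
  fix r :: real assume "r > 0"
  then obtain \<U> D where U: "coloured_cover P X d r \<U> D" using cover by blast
  obtain h where "bij_betw h {0..<card P} P" using ex_bij_betw_nat_finite[OF assms(1)] by blast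
  then have h: "h ` {0..<card P} = P" unfolding bij_betw_def by blast
  \<comment> \<open>\<open>asdim_le\<close> with \<open>card P\<close> asks for one family more than
    there are indices; the last one is empty.\<close>
  define \<V> where "\<V> = (\<lambda>i. if i < card P then \<U> (h i) else {})"
  have V: "h i \<in> P \<and> V \<in> \<U> (h i)" if "V \<in> \<V> i" for i V
    using h that unfolding \<V>_def by (auto split: if_splits)
  have "coloured_cover {..card P} X d r \<V> D"
  proof (rule coloured_coverI)
    fix x assume "x \<in> X"
    then obtain p V where p: "p \<in> P" "V \<in> \<U> p" "x \<in> V" using coloured_coverD(1)[OF U] by blast
    then obtain i where "i < card P" "p = h i" using h by (metis atLeastLessThan_iff imageE)
    then show "\<exists>p\<in>{..card P}. \<exists>U\<in>\<V> p. x \<in> U" using p unfolding \<V>_def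
      by (intro bexI[of _ i] bexI[of _ V]) auto
  next
    fix i V assume "V \<in> \<V> i"
    then show "V \<subseteq> X" using V[of V i] coloured_coverD(2)[OF U, of "h i" V] by simp
  next
    fix i V x y assume "V \<in> \<V> i" "x \<in> V" "y \<in> V"
    then show "d x y \<le> D" using V[of V i] coloured_coverD(3)[OF U, of "h i" V x y] by simp
  next
    fix i V V' x y assume "V \<in> \<V> i" "V' \<in> \<V> i" "V \<noteq> V'" "x \<in> V" "y \<in> V'"
    then show "r \<le> d x y"
      using V[of V i] V[of V' i] coloured_coverD(4)[OF U, of "h i" V V' x y] by simp
  qed
  then show "\<exists>\<U> D. coloured_cover {..card P} X d r \<U> D" by blast
qed

lemma card_sym_diff:
  assumes "finite A" "finite B"
  shows "int (card ((A - B) \<union> (B - A))) = int (card A) + int (card B) - 2 * int (card (A \<inter> B))"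
proof -
  have 1: "card ((A - B) \<union> (B - A)) = card (A - B) + card (B - A)"
    using assms by (intro card_Un_disjoint) auto
  have "card A = card (A - B) + card (A \<inter> B)"
    using card_Un_disjoint[of "A - B" "A \<inter> B"] assms by (auto simp: Un_Diff_Int)
  moreover have "card B = card (B - A) + card (A \<inter> B)"
  proof -
    have "B = (B - A) \<union> (A \<inter> B)" by blast
    moreover have "(B - A) \<inter> (A \<inter> B) = {}" by blast
    ultimately show ?thesis using card_Un_disjoint[of "B - A" "A \<inter> B"] assms by simp
  qed
  ultimately show ?thesis using 1 by simp
qed

text \<open>The hypothesis \<open>tree\<close> says that the sets \<open>N i x\<close> are the geodesics from a base point to
  the points of a forest: two initial segments of one geodesic are nested. The pieces of the
  cover consist of the points of an annulus of width \<open>2 r\<close> whose geodesics agree up to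
  distance \<open>r\<close> from the annulus, in every factor.\<close>

lemma asdim_le_tree_product:
  fixes N :: "'i \<Rightarrow> 'a \<Rightarrow> 't set"
  assumes I: "finite I"
    and fin: "\<And>i x. i \<in> I \<Longrightarrow> x \<in> X \<Longrightarrow> finite (N i x)"
    and tree: "\<And>i x y z. i \<in> I \<Longrightarrow> x \<in> X \<Longrightarrow> y \<in> X \<Longrightarrow> z \<in> X \<Longrightarrow>
      N i x \<inter> N i y \<subseteq> N i z \<or> N i y \<inter> N i z \<subseteq> N i x"
    and dist: "\<And>x y. x \<in> X \<Longrightarrow> y \<in> X \<Longrightarrow>
      d x y = real (\<Sum>i\<in>I. card ((N i x - N i y) \<union> (N i y - N i x)))"
  shows "asdim_le X d (card (Pow I))"
proof (rule asdim_le_finite_index)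
  show "finite (Pow I)" using I by simp
  fix r0 :: real assume "r0 > 0"
  define r where "r = nat \<lceil>r0\<rceil>"
  have r: "0 < r" "r0 \<le> real r" using \<open>r0 > 0\<close> unfolding r_def by linarith+
  define k where "k = (\<lambda>i x. card (N i x) div (2 * r))"
  define R where "R = (\<lambda>x y. \<forall>i\<in>I. k i x = k i y \<and> int (2 * r * k i x) - int r \<le> int (card (N i x \<inter> N i y)))"
  define V where "V = (\<lambda>x. {y\<in>X. R x y})"
  \<comment> \<open>The colour of a point is the set of factors in which it lies in an odd annulus.
    Points of one colour in different annuli of some factor have geodesics there whose lengths
    differ by more than \<open>2 * r\<close>.\<close>
  define \<U> where "\<U> = (\<lambda>p. V ` {x\<in>X. {i\<in>I. odd (k i x)} = p})"
  define D where "D = (\<lambda>i x y. (N i x - N i y) \<union> (N i y - N i x))"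
  have kle: "2 * r * k i x \<le> card (N i x)" for i x
    unfolding k_def by (simp add: mult.commute)
  have klt: "card (N i x) < 2 * r * k i x + 2 * r" for i x
    unfolding k_def using r dividend_less_times_div[of "2*r" "card (N i x)"] by simp
  have cD: "int (card (D i x y)) = int (card (N i x)) + int (card (N i y)) - 2 * int (card (N i x \<inter> N i y))"
    if "i \<in> I" "x \<in> X" "y \<in> X" for i x y
    unfolding D_def using card_sym_diff fin that by blast
  have Rrefl: "R x x" for x
    unfolding R_def
  proof
    fix i
    have "int (2 * r * k i x) \<le> int (card (N i x))" using kle[of i x] by (simp only: of_nat_le_iff) 
    then show "k i x = k i x \<and> int (2 * r * k i x) - int r \<le> int (card (N i x \<inter> N i x))" by simp
  qed
  have Rsym: "R y x" if "R x y" for x y using that unfolding R_def by (auto simp: Int_commute)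
  have Rtrans: "R x z" if "R x y" "R y z" "x \<in> X" "y \<in> X" "z \<in> X" for x y z
    unfolding R_def
  proof
    fix i assume i: "i \<in> I"
    have kk: "k i x = k i y" "k i y = k i z" using that i unfolding R_def by auto
    have c: "int (2 * r * k i x) - int r \<le> int (card (N i x \<inter> N i y))"
         "int (2 * r * k i x) - int r \<le> int (card (N i y \<inter> N i z))"
      using that i kk unfolding R_def by auto
    \<comment> \<open>One of the two common initial segments is shared by \<open>x\<close> and
      \<open>z\<close> as well, which carries the lower bound over.\<close>
    have "N i x \<inter> N i y \<subseteq> N i z \<or> N i y \<inter> N i z \<subseteq> N i x" using tree[OF i] that by blast
    then have "N i x \<inter> N i y \<subseteq> N i x \<inter> N i z \<or> N i y \<inter> N i z \<subseteq> N i x \<inter> N i z" by blast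
    then have "card (N i x \<inter> N i y) \<le> card (N i x \<inter> N i z) \<or> card (N i y \<inter> N i z) \<le> card (N i x \<inter> N i z)"
      using card_mono fin[OF i] that by (meson finite_Int)
    then show "k i x = k i z \<and> int (2 * r * k i x) - int r \<le> int (card (N i x \<inter> N i z))"
      using c kk by linarith
  qed
  have close: "R x y" if "x \<in> X" "y \<in> X" "{i\<in>I. odd (k i x)} = {i\<in>I. odd (k i y)}" "d x y < r0" for x y
    unfolding R_def
  proof
    fix i assume i: "i \<in> I"
    have "card (D i x y) \<le> (\<Sum>i\<in>I. card (D i x y))" using i I by (intro member_le_sum) auto
    then have "real (card (D i x y)) \<le> d x y" using dist[OF that(1,2)] unfolding D_def by linarith
    then have small: "card (D i x y) < r" using that(4) r(2) by linarith
    have "card (N i x \<inter> N i y) \<le> card (N i x)" "card (N i x \<inter> N i y) \<le> card (N i y)"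
      using fin[OF i] that by (auto intro!: card_mono)
    then have hd: "card (N i x) < card (N i y) + r" "card (N i y) < card (N i x) + r"
      using cD[OF i that(1,2)] small by linarith+
    have par: "odd (k i x) \<longleftrightarrow> odd (k i y)" using that(3) i by blast
    have "\<not> k i x < k i y"
    proof
      assume "k i x < k i y"
      then have "k i x + 2 \<le> k i y" using par by presburger
      then have "2 * r * (k i x + 2) \<le> 2 * r * k i y" by (rule mult_le_mono2)
      then show False using kle[of i y] klt[of i x] hd by (simp add: algebra_simps)
    qed
    moreover have "\<not> k i y < k i x"
    proof
      assume "k i y < k i x"
      then have "k i y + 2 \<le> k i x" using par by presburger
      then have "2 * r * (k i y + 2) \<le> 2 * r * k i x" by (rule mult_le_mono2)
      then show False using kle[of i x] klt[of i y] hd by (simp add: algebra_simps)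
    qed
    ultimately have kk: "k i x = k i y" by simp
    have "int (2 * r * k i x) \<le> int (card (N i x))" "int (2 * r * k i x) \<le> int (card (N i y))"
      using kle[of i x] kle[of i y] kk by (auto simp only: of_nat_le_iff)
    then have "int (2 * r * k i x) - int r \<le> int (card (N i x \<inter> N i y))"
      using cD[OF i that(1,2)] small by linarith
    then show "k i x = k i y \<and> int (2 * r * k i x) - int r \<le> int (card (N i x \<inter> N i y))"
      using kk by blast
  qed
  have "coloured_cover (Pow I) X d r0 \<U> (real (card I * (6 * r)))"
  proof (rule coloured_coverI)
    fix x assume "x \<in> X"
    then show "\<exists>p\<in>Pow I. \<exists>U\<in>\<U> p. x \<in> U"
      unfolding \<U>_def V_def using Rrefl
      by (intro bexI[of _ "{i\<in>I. odd (k i x)}"] bexI[of _ "{y\<in>X. R x y}"]) auto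
  next
    fix p U assume "U \<in> \<U> p" then show "U \<subseteq> X" unfolding \<U>_def V_def by auto
  next
    fix p U x y assume "p \<in> Pow I" "U \<in> \<U> p" and xy: "x \<in> U" "y \<in> U"
    then obtain z where "z \<in> X" "U = V z" unfolding \<U>_def by blast
    then have *: "x \<in> X" "y \<in> X" "R x y" using xy Rsym[of z x] Rtrans[of x z y] unfolding V_def by auto
    \<comment> \<open>Each geodesic is shorter than \<open>2 * r * k + 2 * r\<close> and shares at
      least \<open>2 * r * k - r\<close> with the other, so each contributes at most
      \<open>3 * r\<close>.\<close>
    have "card (D i x y) \<le> 6 * r" if i: "i \<in> I" for i
    proof -
      have "k i x = k i y" "int (2 * r * k i x) - int r \<le> int (card (N i x \<inter> N i y))"
        using * i unfolding R_def by auto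
      moreover have "int (card (N i x)) < int (2 * r * k i x) + 2 * int r"
         "int (card (N i y)) < int (2 * r * k i y) + 2 * int r"
        using klt[of i x] klt[of i y] by linarith+
      ultimately show ?thesis using cD[OF i *(1,2)] by simp
    qed
    then have "(\<Sum>i\<in>I. card (D i x y)) \<le> card I * (6 * r)"
      using sum_bounded_above[of I "\<lambda>i. card (D i x y)" "6 * r"] by simp
    then show "d x y \<le> real (card I * (6 * r))"
      using dist[OF *(1,2)] unfolding D_def by (simp only: of_nat_le_iff) 
  next
    fix p U U' x y assume "U \<in> \<U> p" "U' \<in> \<U> p" and ne: "U \<noteq> U'" and xy: "x \<in> U" "y \<in> U'"
    then obtain z z' where z: "z \<in> X" "U = V z" "{i\<in>I. odd (k i z)} = p"
       "z' \<in> X" "U' = V z'" "{i\<in>I. odd (k i z')} = p" unfolding \<U>_def by auto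
    have x: "x \<in> X" "R z x" and y: "y \<in> X" "R z' y" using xy z unfolding V_def by auto
    have "k i z = k i x" "k i z' = k i y" if "i \<in> I" for i
      using x y that unfolding R_def by blast+
    then have "{i\<in>I. odd (k i x)} = {i\<in>I. odd (k i z)}" "{i\<in>I. odd (k i y)} = {i\<in>I. odd (k i z')}"
      by auto
    then have par: "{i\<in>I. odd (k i x)} = p" "{i\<in>I. odd (k i y)} = p"
      using z by simp_all
    show "r0 \<le> d x y"
    proof (rule ccontr)
      assume "\<not> r0 \<le> d x y"
      then have "R x y" using close[of x y] x(1) y(1) par by simp
      then have "R z y" using Rtrans[of z x y] x y z by simp
      then have zz: "R z z'" using Rtrans[of z y z'] Rsym y z by simp
      have "R z a \<longleftrightarrow> R z' a" if "a \<in> X" for a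
        using Rtrans[of z z' a] Rtrans[of z' z a] Rsym[OF zz] zz z that by auto
      then have "V z = V z'" unfolding V_def by auto
      then show False using ne z by simp
    qed
  qed
  then show "\<exists>\<U> D. coloured_cover (Pow I) X d r0 \<U> D" by blast
qed

section \<open>Orders in the real numbers\<close>

definition zspan :: "(nat \<Rightarrow> real) \<Rightarrow> nat \<Rightarrow> real set" where
  "zspan g n = {x. \<exists>a :: nat \<Rightarrow> int. x = (\<Sum>k<n. of_int (a k) * g k)}"

lemma zspanI: "x = (\<Sum>k<n. of_int (a k) * g k) \<Longrightarrow> x \<in> zspan g n"
  unfolding zspan_def by blast

lemma zspanE:
  assumes "x \<in> zspan g n" obtains a :: "nat \<Rightarrow> int" where "x = (\<Sum>k<n. of_int (a k) * g k)"
  using assms unfolding zspan_def by blast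

lemma zspan_generator: assumes "i < n" shows "g i \<in> zspan g n"
proof (rule zspanI)
  have "(\<Sum>k<n. of_int (if k = i then 1 else 0) * g k) = (\<Sum>k<n. if k = i then g k else 0)"
    by (rule sum.cong) auto
  then show "g i = (\<Sum>k<n. of_int (if k = i then 1 else 0) * g k)" using assms by simp
qed

lemma zspan_add: assumes "x \<in> zspan g n" "y \<in> zspan g n" shows "x + y \<in> zspan g n"
proof -
  obtain a b :: "nat \<Rightarrow> int" where "x = (\<Sum>k<n. of_int (a k) * g k)" "y = (\<Sum>k<n. of_int (b k) * g k)"
    using assms zspanE by metis
  then have "x + y = (\<Sum>k<n. of_int (a k + b k) * g k)"
    by (simp add: sum.distrib algebra_simps)
  then show ?thesis by (rule zspanI)
qed

lemma zspan_of_int_mult: assumes "x \<in> zspan g n" shows "of_int c * x \<in> zspan g n"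
proof -
  obtain a :: "nat \<Rightarrow> int" where "x = (\<Sum>k<n. of_int (a k) * g k)"
    using assms zspanE by metis
  then have "of_int c * x = (\<Sum>k<n. of_int (c * a k) * g k)"
    by (simp add: sum_distrib_left algebra_simps)
  then show ?thesis by (rule zspanI)
qed

lemma zspan_0: "0 \<in> zspan g n"
  by (rule zspanI[where a = "\<lambda>_. 0"]) simp

lemma zspan_minus: "x \<in> zspan g n \<Longrightarrow> - x \<in> zspan g n"
  using zspan_of_int_mult[of x g n "-1"] by simp

lemma zspan_diff: "x \<in> zspan g n \<Longrightarrow> y \<in> zspan g n \<Longrightarrow> x - y \<in> zspan g n"
  using zspan_add[of x g n "- y"] zspan_minus[of y g n] by simp

lemma zspan_sum: "(\<And>i. i \<in> I \<Longrightarrow> f i \<in> zspan g n) \<Longrightarrow> (\<Sum>i\<in>I. f i) \<in> zspan g n"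
  by (induction I rule: infinite_finite_induct) (auto intro: zspan_0 zspan_add)

locale real_order =
  fixes g :: "nat \<Rightarrow> real" and n :: nat
  assumes one: "1 \<in> zspan g n"
    and generators_mult: "i < n \<Longrightarrow> j < n \<Longrightarrow> g i * g j \<in> zspan g n"
begin

abbreviation A where "A \<equiv> zspan g n"

lemma mult_generator: assumes "x \<in> A" "i < n" shows "x * g i \<in> A"
proof -
  obtain a :: "nat \<Rightarrow> int" where "x = (\<Sum>k<n. of_int (a k) * g k)"
    using assms zspanE by metis
  then have "x * g i = (\<Sum>k<n. of_int (a k) * (g k * g i))"
    by (simp add: sum_distrib_right mult.assoc)
  then show ?thesis using generators_mult assms by (auto intro!: zspan_sum zspan_of_int_mult)
qed

lemma mult: assumes "x \<in> A" "y \<in> A" shows "x * y \<in> A"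
proof -
  obtain a :: "nat \<Rightarrow> int" where "y = (\<Sum>k<n. of_int (a k) * g k)"
    using assms zspanE by metis
  then have "x * y = (\<Sum>k<n. of_int (a k) * (x * g k))"
    by (simp add: sum_distrib_left algebra_simps)
  then show ?thesis using mult_generator assms by (auto intro!: zspan_sum zspan_of_int_mult)
qed

lemma of_int_mem: "of_int c \<in> A"
  using zspan_of_int_mult[OF one, of c] by simp

lemma poly_mem: "x \<in> A \<Longrightarrow> poly (map_poly of_int p) x \<in> A"
  by (induction p) (auto simp: map_poly_pCons intro: zspan_add of_int_mem mult zspan_0)

text \<open>Multiplication by \<open>x\<close> acts on the generators through an integer matrix, of
  which the vector of generators is an eigenvector; it is nonzero because 1 is in the span. So
  \<open>x\<close> is a root of a monic integer characteristic polynomial.\<close>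

lemma algebraic_int: assumes x: "x \<in> A" shows "algebraic_int x"
proof -
  have "\<forall>i\<in>{..<n}. \<exists>b :: nat \<Rightarrow> int. x * g i = (\<Sum>k<n. of_int (b k) * g k)"
    using mult_generator[OF x] unfolding zspan_def by simp
  from bchoice[OF this] obtain b :: "nat \<Rightarrow> nat \<Rightarrow> int"
    where b: "\<forall>i\<in>{..<n}. x * g i = (\<Sum>k<n. of_int (b i k) * g k)" by blast
  define B where "B = Matrix.mat n n (\<lambda>(i, k). b i k)"
  define B' :: "real Matrix.mat" where "B' = map_mat of_int B"
  define v where "v = Matrix.vec n g"
  have B: "B \<in> carrier_mat n n" "B' \<in> carrier_mat n n" unfolding B_def B'_def by auto
  have v: "v \<in> carrier_vec n" unfolding v_def by simp
  have "v \<noteq> 0\<^sub>v n"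
  proof
    assume "v = 0\<^sub>v n"
    then have "g i = 0" if "i < n" for i
    proof -
      have "vec_index v i = vec_index (0\<^sub>v n) i" using \<open>v = 0\<^sub>v n\<close> by simp
      then show ?thesis using that unfolding v_def by simp
    qed
    then have "1 = (0::real)" using one unfolding zspan_def by auto
    then show False by simp
  qed
  moreover have "B' *\<^sub>v v = x \<cdot>\<^sub>v v"
  proof (rule eq_vecI)
    fix i assume i: "i < dim_vec (x \<cdot>\<^sub>v v)"
    then have i: "i < n" using v by simp
    have "vec_index (B' *\<^sub>v v) i = (\<Sum>k<n. of_int (b i k) * g k)"
      using i unfolding B'_def B_def v_def
      by (simp add: scalar_prod_def atLeast0LessThan)
    then show "vec_index (B' *\<^sub>v v) i = vec_index (x \<cdot>\<^sub>v v) i"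
      using b i unfolding v_def by simp
  qed (use B v in auto)
  ultimately have "eigenvalue B' x"
    unfolding eigenvalue_def eigenvector_def using B v by auto
  then have "poly (char_poly B') x = 0" using eigenvalue_root_char_poly[OF B(2)] by simp
  moreover have "char_poly B' = map_poly of_int (char_poly B)"
    unfolding B'_def by (rule of_int_hom.char_poly_hom[OF B(1)])
  moreover have "lead_coeff (char_poly B) = 1" using degree_monic_char_poly[OF B(1)] by simp
  ultimately show ?thesis unfolding algebraic_int_altdef_ipoly by metis
qed

text \<open>A nonzero element divides a nonzero integer \<open>c\<close>, the constant term of an integer
  polynomial, and only the divisors \<open>N\<close> of \<open>c\<close> in the integers divide it in \<open>A\<close>.\<close>

lemma not_divisible:
  assumes x: "x \<in> A" "x \<noteq> 0"
  obtains c :: nat where "\<And>N y. N > c \<Longrightarrow> y \<in> A \<Longrightarrow> x \<noteq> real N * y"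
proof -
  obtain p :: "int poly" where p: "poly (map_poly of_int p) x = 0" "lead_coeff p = 1"
    using algebraic_int[OF x(1)] unfolding algebraic_int_altdef_ipoly by blast
  then have "p \<noteq> 0" by auto
  \<comment> \<open>Powers of the variable are divided out until the constant term is nonzero, which
    is possible because \<open>x\<close> is nonzero.\<close>
  then have "\<exists>q :: int poly. poly.coeff q 0 \<noteq> 0 \<and> poly (map_poly of_int q) x = 0"
    using p(1)
  proof (induction p)
    case (pCons a p)
    show ?case
    proof (cases "a = 0")
      case True
      then have "p \<noteq> 0" using pCons.prems by auto
      moreover have "poly (map_poly of_int p) x = 0"
        using pCons.prems True x(2) by (auto simp: map_poly_pCons)
      ultimately show ?thesis using pCons.IH by blast
    next
      case False
      then show ?thesis using pCons.prems by (intro exI[of _ "pCons a p"]) auto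
    qed
  qed simp
  then obtain q :: "int poly" where q: "poly.coeff q 0 \<noteq> 0" "poly (map_poly of_int q) x = 0" by blast
  obtain c p' where qc: "q = pCons c p'" by (cases q)
  have c: "c \<noteq> 0" "of_int c = - x * poly (map_poly of_int p') x"
    using q unfolding qc by (auto simp: map_poly_pCons algebra_simps add_eq_0_iff)
  have "x \<noteq> real N * y" if N: "N > nat \<bar>c\<bar>" and y: "y \<in> A" for N y
  proof
    assume eq: "x = real N * y"
    define z where "z = - y * poly (map_poly of_int p') x"
    have "z \<in> A" unfolding z_def using y x poly_mem by (intro mult zspan_minus)
    have "of_int c = real N * z" using c(2) unfolding z_def eq by simp
    moreover have "N > 0" using N by simp
    ultimately have z: "z = of_int c / of_nat N" by (simp add: field_simps)
    then have "z \<in> \<rat>" by simp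
    then obtain d :: int where "z = of_int d"
      using rational_algebraic_int_is_int[OF algebraic_int[OF \<open>z \<in> A\<close>]] by (auto elim: Ints_cases)
    then have "real_of_int c = real_of_int (int N * d)" using \<open>of_int c = real N * z\<close> by simp
    then have "c = int N * d" by (simp only: of_int_eq_iff)
    then have "int N dvd c" by simp
    then have "int N \<le> \<bar>c\<bar>" using dvd_imp_le_int[OF c(1), of "int N"] by simp
    then show False using N by simp
  qed
  then show ?thesis using that by blast
qed

end

text \<open>The span is closed under products because \<open>2 * cos a * (2 * cos b)\<close> is
  \<open>2 * cos (a + b) + 2 * cos (a - b)\<close>, and it is finitely generated because the numbers
  are periodic in \<open>k\<close> with period \<open>2 * M\<close>. Generator 0 is 1 instead of
  \<open>2 * cos 0\<close>, so that the span contains 1.\<close>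

lemma cos_order:
  assumes "M > 0"
  defines "g \<equiv> \<lambda>k. if k = 0 then 1 else 2 * cos (real k * pi / real M)"
  shows cos_mem: "2 * cos (real k * pi / real M) \<in> zspan g (2 * M + 1)"
    and cos_real_order: "real_order g (2 * M + 1)"
proof -
  define h where "h = (\<lambda>k::nat. 2 * cos (real k * pi / real M))"
  let ?A = "zspan g (2 * M + 1)"
  have h: "h k \<in> ?A" for k
  proof -
    have "h k = h (k mod (2 * M))"
    proof -
      have "real k = real (k mod (2 * M) + 2 * M * (k div (2 * M)))" by simp
      then have "real k = real (k mod (2 * M)) + 2 * real M * real (k div (2 * M))"
        by (simp only: of_nat_add of_nat_mult of_nat_numeral)
      then have "real k * pi / real M = real (k mod (2 * M)) * pi / real M + real (k div (2 * M)) * (2 * pi)"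
        using assms(1) by (simp add: field_simps)
      moreover have "cos (real m * (2 * pi)) = 1" "sin (real m * (2 * pi)) = 0" for m
        using cos_2npi[of m] sin_2npi[of m] by (simp_all add: algebra_simps)
      ultimately show ?thesis unfolding h_def by (simp add: cos_add)
    qed
    also have "\<dots> \<in> ?A"
    proof (cases "k mod (2 * M) = 0")
      case True
      have "of_int 2 * g 0 \<in> ?A" by (intro zspan_of_int_mult zspan_generator) simp
      then show ?thesis using True unfolding h_def g_def by simp
    next
      case False
      then have "h (k mod (2 * M)) = g (k mod (2 * M))" unfolding h_def g_def by simp
      moreover have "k mod (2 * M) < 2 * M + 1" using assms(1) by (meson less_SucI mod_less_divisor mult_pos_pos zero_less_numeral Suc_eq_plus1 less_add_one order.strict_trans)
      ultimately show ?thesis using zspan_generator[of _ _ g] by simp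
    qed
    finally show ?thesis .
  qed
  then show "2 * cos (real k * pi / real M) \<in> ?A" for k unfolding h_def .
  have one: "g 0 \<in> ?A" by (rule zspan_generator) simp
  show "real_order g (2 * M + 1)"
  proof
    show "1 \<in> ?A" using one unfolding g_def by simp
    fix i j assume ij: "i < 2 * M + 1" "j < 2 * M + 1"
    have hh: "h a * h b \<in> ?A" if "a \<le> b" for a b
    proof -
      have "h a * h b = h (a + b) + h (b - a)"
        using that unfolding h_def
        by (simp add: of_nat_diff cos_add cos_diff ring_distribs add_divide_distrib diff_divide_distrib)
      then show ?thesis using h zspan_add by simp
    qed
    then have "h i * h j \<in> ?A" using hh[of i j] hh[of j i] by (cases "i \<le> j") (simp_all add: mult.commute)
    moreover have "g i = (if i = 0 then 1 else h i)" "g j = (if j = 0 then 1 else h j)"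
      unfolding g_def h_def by auto
    ultimately show "g i * g j \<in> ?A" using h one zspan_generator[OF ij(1)] zspan_generator[OF ij(2)]
      by auto
  qed
qed

section \<open>The canonical representation\<close>

context coxeter_system begin

text \<open>An infinite order is encoded by \<open>cox_m = 0\<close>; then the quotient
  \<open>pi / 0\<close> is 0 and the value is -1, the usual convention.\<close>

definition BB :: "'w \<Rightarrow> 'w \<Rightarrow> real" where
  "BB s t = - cos (pi / real (cox_m W s t))"

definition bil :: "'w set \<Rightarrow> 'w \<Rightarrow> ('w \<Rightarrow> real) \<Rightarrow> real" where
  "bil T s v = (\<Sum>t\<in>T. BB s t * v t)"

lemma cox_m_sym: assumes "s \<in> S" "t \<in> S" shows "cox_m W s t = cox_m W t s"
proof -
  have "iv (s \<cdot> t) = t \<cdot> s" using assms by (simp add: inv_mult_group)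
  then show ?thesis unfolding cox_m_def using ord_inv[of "s \<cdot> t"] assms by simp
qed

lemma cox_m_self [simp]: "s \<in> S \<Longrightarrow> cox_m W s s = 1"
  unfolding cox_m_def by simp

lemma cox_m_neq1: assumes "s \<in> S" "t \<in> S" "s \<noteq> t" shows "cox_m W s t \<noteq> 1"
proof
  assume "cox_m W s t = 1"
  then have "s \<cdot> t = \<epsilon>" unfolding cox_m_def using ord_eq_1 assms by simp
  then have "s \<cdot> (s \<cdot> t) = s" using assms by simp
  then show False using assms by simp
qed

lemma BB_self [simp]: "s \<in> S \<Longrightarrow> BB s s = 1"
  unfolding BB_def by simp

lemma BB_sym: "s \<in> S \<Longrightarrow> t \<in> S \<Longrightarrow> BB s t = BB t s"
  unfolding BB_def using cox_m_sym by simp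

lemma BB_nonpos: assumes "s \<in> S" "t \<in> S" "s \<noteq> t" shows "BB s t \<le> 0"
proof (cases "cox_m W s t = 0")
  case True
  then show ?thesis unfolding BB_def by simp
next
  case False
  then have "2 \<le> cox_m W s t" using cox_m_neq1[OF assms] by linarith
  then have "pi / real (cox_m W s t) \<le> pi / 2" by (intro divide_left_mono) auto
  moreover have "- (pi / 2) \<le> 0" "0 \<le> pi / real (cox_m W s t)" by auto
  ultimately show ?thesis unfolding BB_def using cos_ge_zero[of "pi / real (cox_m W s t)"] by linarith
qed

lemma cox_form_bil: "cox_form W T u v = (\<Sum>s\<in>T. u s * bil T s v)"
  unfolding cox_form_def bil_def BB_def by (simp add: sum_distrib_left algebra_simps)

lemma cox_form_root: assumes "finite T" "s \<in> T" shows "cox_form W T (root_vec s) v = bil T s v"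
proof -
  have "(\<Sum>x\<in>T. root_vec s x * bil T x v) = (\<Sum>x\<in>T. if x = s then bil T x v else 0)"
    by (rule sum.cong) (auto simp: root_vec_def)
  then show ?thesis unfolding cox_form_bil using assms by simp
qed

lemma cox_refl_bil:
  assumes "finite T" "s \<in> T"
  shows "cox_refl W T s v = (\<lambda>t. v t - 2 * bil T s v * root_vec s t)"
  unfolding cox_refl_def cox_form_root[OF assms] ..

lemma bil_lincomb: "bil T s (\<lambda>t. a * u t + b * v t) = a * bil T s u + b * bil T s v"
  unfolding bil_def by (simp add: sum.distrib sum_distrib_left algebra_simps)

lemma bil_root: assumes "finite T" "t \<in> T" shows "bil T s (root_vec t) = BB s t"
proof -
  have "bil T s (root_vec t) = (\<Sum>x\<in>T. if x = t then BB s x else 0)"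
    unfolding bil_def by (rule sum.cong) (auto simp: root_vec_def)
  then show ?thesis using assms by simp
qed

lemma bil_sub: "bil T s (\<lambda>t. u t - v t) = bil T s u - bil T s v"
  unfolding bil_def by (simp add: sum_subtractf algebra_simps)

lemma bil_sum: "bil T s (\<lambda>r. \<Sum>y\<in>Y. c y * f y r) = (\<Sum>y\<in>Y. c y * bil T s (f y))"
proof -
  have "bil T s (\<lambda>r. \<Sum>y\<in>Y. c y * f y r) = (\<Sum>t\<in>T. \<Sum>y\<in>Y. c y * (BB s t * f y t))"
    unfolding bil_def by (simp add: sum_distrib_left algebra_simps)
  also have "\<dots> = (\<Sum>y\<in>Y. \<Sum>t\<in>T. c y * (BB s t * f y t))" by (rule sum.swap)
  finally show ?thesis unfolding bil_def by (simp add: sum_distrib_left)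
qed

lemma bil_superset:
  assumes "finite T'" "T \<subseteq> T'" "\<And>t. t \<notin> T \<Longrightarrow> v t = 0"
  shows "bil T' s v = bil T s v"
  unfolding bil_def using assms by (intro sum.mono_neutral_right) auto

definition act :: "'w set \<Rightarrow> 'w list \<Rightarrow> ('w \<Rightarrow> real) \<Rightarrow> 'w \<Rightarrow> real" where
  "act T ws v = foldr (cox_refl W T) ws v"

lemma act_Nil [simp]: "act T [] v = v"
  and act_Cons [simp]: "act T (s # ws) v = cox_refl W T s (act T ws v)"
  and act_append: "act T (us @ vs) v = act T us (act T vs v)"
  unfolding act_def by simp_all

text \<open>The plane spanned by \<^term>\<open>root_vec s\<close> and \<^term>\<open>root_vec t\<close> is identified with the complex
  plane, with \<^term>\<open>root_vec s\<close> corresponding to \<open>1\<close> and \<^term>\<open>root_vec t\<close> to \<open>-cis (-\<theta>)\<close>; then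
  the product of the two reflections is the rotation by \<open>2 \<theta>\<close>.\<close>

definition plane :: "'w \<Rightarrow> 'w \<Rightarrow> ('w \<Rightarrow> real) \<Rightarrow> complex \<Rightarrow> 'w \<Rightarrow> real" where
  "plane s t v x = (let \<theta> = pi / real (cox_m W s t) in
     (\<lambda>r. v r + (Re x + cos \<theta> * Im x / sin \<theta>) * root_vec s r + Im x / sin \<theta> * root_vec t r))"

context
  fixes T s t and \<theta> :: real
  assumes T: "finite T" "T \<subseteq> S" "s \<in> T" "t \<in> T" "s \<noteq> t" and m: "cox_m W s t \<noteq> 0"
  defines "\<theta> \<equiv> pi / real (cox_m W s t)"
begin

lemma sin_theta: "sin \<theta> > 0"
proof -
  have "s \<in> S" "t \<in> S" using T by auto
  then have "cox_m W s t \<noteq> 1" using cox_m_neq1 T by blast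
  then have "1 < cox_m W s t" using m by linarith
  then have "0 < \<theta>" "\<theta> < pi" unfolding \<theta>_def by (auto simp: field_simps)
  then show ?thesis by (rule sin_gt_zero)
qed

lemma BB_st: "BB s t = - cos \<theta>" "BB t s = - cos \<theta>"
proof -
  have "s \<in> S" "t \<in> S" using T by auto
  then have "BB t s = BB s t" by (rule BB_sym[symmetric])
  then show "BB s t = - cos \<theta>" "BB t s = - cos \<theta>" unfolding BB_def \<theta>_def by auto
qed

lemma bil_plane:
  assumes "bil T s v = 0" "bil T t v = 0"
  shows "bil T s (plane s t v x) = Re x"
    and "bil T t (plane s t v x) = sin \<theta> * Im x - cos \<theta> * Re x"
proof -
  have *: "plane s t v x = (\<lambda>r. 1 * v r + 1 * ((Re x + cos \<theta> * Im x / sin \<theta>) * root_vec s r + Im x / sin \<theta> * root_vec t r))"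
    unfolding plane_def \<theta>_def Let_def by auto
  have st: "s \<in> S" "t \<in> S" using T by auto
  show "bil T s (plane s t v x) = Re x"
    unfolding * bil_lincomb using assms T st by (simp add: bil_root BB_st)
  have "bil T t (plane s t v x) = - (Re x + cos \<theta> * Im x / sin \<theta>) * cos \<theta> + Im x / sin \<theta>"
    unfolding * bil_lincomb using assms T st by (simp add: bil_root BB_st algebra_simps)
  also have "\<dots> = Im x * (1 - (cos \<theta>)\<^sup>2) / sin \<theta> - cos \<theta> * Re x"
    using sin_theta by (simp add: field_simps power2_eq_square)
  also have "1 - (cos \<theta>)\<^sup>2 = (sin \<theta>)\<^sup>2" using sin_cos_squared_add[of \<theta>] by linarith
  finally show "bil T t (plane s t v x) = sin \<theta> * Im x - cos \<theta> * Re x"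
    using sin_theta by (simp add: power2_eq_square)
qed

lemma plane_add:
  "plane s t v (Complex (Re x + a) (Im x + b)) = (\<lambda>r. plane s t v x r +
    ((a + cos \<theta> * b / sin \<theta>) * root_vec s r + b / sin \<theta> * root_vec t r))"
  unfolding plane_def Let_def \<theta>_def[symmetric]
  by (simp add: fun_eq_iff add_divide_distrib distrib_left distrib_right)

lemma refl_plane:
  assumes "bil T s v = 0" "bil T t v = 0"
  shows "cox_refl W T s (cox_refl W T t (plane s t v x)) = plane s t v (cis (2 * \<theta>) * x)"
proof -
  define l where "l = sin \<theta> * Im x - cos \<theta> * Re x"
  define y where "y = Complex (Re x + 2 * cos \<theta> * l) (Im x + (- 2 * sin \<theta> * l))"
  have 1: "cox_refl W T t (plane s t v x) = plane s t v y"
    unfolding cox_refl_bil[OF T(1,4)] bil_plane[OF assms] y_def plane_add l_def[symmetric]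
    using sin_theta by (simp add: fun_eq_iff)
  have "- cnj y = Complex (Re y + (- 2 * Re y)) (Im y + 0)"
    by (rule complex_eqI) auto
  then have 2: "cox_refl W T s (plane s t v y) = plane s t v (- cnj y)"
    unfolding cox_refl_bil[OF T(1,3)] bil_plane[OF assms]
    by (simp only: plane_add) (simp add: fun_eq_iff)
  have "- cnj y = cis (2 * \<theta>) * x"
  proof (rule complex_eqI)
    have s2: "sin \<theta> * sin \<theta> = 1 - cos \<theta> * cos \<theta>"
      using sin_cos_squared_add[of \<theta>] by (simp add: power2_eq_square)
    have e: "cis (2 * \<theta>) = Complex (2 * cos \<theta> * cos \<theta> - 1) (2 * sin \<theta> * cos \<theta>)"
      by (rule complex_eqI) (simp_all only: cis.sel complex.sel cos_double_cos sin_double power2_eq_square mult.assoc)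
    show "Re (- cnj y) = Re (cis (2 * \<theta>) * x)"
      unfolding y_def l_def e by (simp add: algebra_simps)
    have "Im (- cnj y) = Im x - 2 * (sin \<theta> * sin \<theta>) * Im x + 2 * sin \<theta> * cos \<theta> * Re x"
      unfolding y_def l_def by (simp add: algebra_simps)
    then show "Im (- cnj y) = Im (cis (2 * \<theta>) * x)"
      unfolding s2 e by (simp add: algebra_simps)
  qed
  then show ?thesis using 1 2 by simp
qed

lemma act_rotation:
  assumes "bil T s v = 0" "bil T t v = 0"
  shows "act T (concat (replicate k [s, t])) (plane s t v x) = plane s t v (cis (2 * real k * \<theta>) * x)"
proof (induction k)
  case (Suc k)
  have "act T (concat (replicate (Suc k) [s, t])) (plane s t v x) =
    plane s t v (cis (2 * \<theta>) * (cis (2 * real k * \<theta>) * x))"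
    using Suc refl_plane[OF assms] by simp
  also have "cis (2 * \<theta>) * (cis (2 * real k * \<theta>) * x) = cis (2 * real (Suc k) * \<theta>) * x"
    unfolding mult.assoc[symmetric] cis_mult by (simp add: algebra_simps)
  finally show ?case .
qed simp

text \<open>\<open>v\<close> is a part orthogonal to both roots, which is fixed, plus a part in
  their plane, which returns after \<open>cox_m W s t\<close> rotations by twice \<theta>.\<close>

lemma act_braid_neq: "act T (concat (replicate (cox_m W s t) [s, t])) v = v"
proof -
  define p q where "p = bil T s v" and "q = bil T t v"
  \<comment> \<open>\<open>a\<close> and \<open>b\<close> solve the linear system that makes
    \<open>v'\<close> orthogonal to both roots; its determinant is the square of the sine.\<close>
  define b where "b = (q + cos \<theta> * p) / (sin \<theta>)\<^sup>2"
  define a where "a = p + cos \<theta> * b"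
  define v' where "v' = (\<lambda>r. v r - (a * root_vec s r + b * root_vec t r))"
  have st: "s \<in> S" "t \<in> S" using T by auto
  have s2: "1 - (cos \<theta>)\<^sup>2 = (sin \<theta>)\<^sup>2" using sin_cos_squared_add[of \<theta>] by linarith
  have "b - cos \<theta> * a = b * (1 - (cos \<theta>)\<^sup>2) - cos \<theta> * p" unfolding a_def by (simp add: algebra_simps power2_eq_square)
  also have "\<dots> = q" unfolding s2 b_def using sin_theta by simp
  finally have q: "b - cos \<theta> * a = q" .
  have 1: "bil T s v' = 0" unfolding v'_def bil_sub bil_lincomb
    using T st by (simp add: bil_root BB_st p_def[symmetric] a_def)
  have 2: "bil T t v' = 0" unfolding v'_def bil_sub bil_lincomb
    using T st q by (simp add: bil_root BB_st q_def[symmetric] algebra_simps)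
  have v: "v = plane s t v' (Complex (a - cos \<theta> * b) (b * sin \<theta>))"
    unfolding plane_def Let_def \<theta>_def[symmetric] v'_def using sin_theta by (auto simp: fun_eq_iff)
  have "2 * real (cox_m W s t) * \<theta> = 2 * pi" unfolding \<theta>_def using m by simp
  then show ?thesis using act_rotation[OF 1 2, of "cox_m W s t"] v by (metis cis_2pi mult_1)
qed

text \<open>The matrix coefficient that later tells a nontrivial rotation from the identity, for
  which it would be 1.\<close>

lemma bil_act_rotation:
  "bil T s (act T (concat (replicate k [s, t])) (root_vec s)) = cos (2 * real k * \<theta>)"
proof -
  have z: "bil T s (\<lambda>_. 0) = 0" "bil T t (\<lambda>_. 0) = 0" unfolding bil_def by auto
  have "root_vec s = plane s t (\<lambda>_. 0) 1" unfolding plane_def Let_def by auto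
  then show ?thesis using act_rotation[OF z, of k 1] bil_plane(1)[OF z] by simp
qed

end

lemma refl_refl:
  assumes "finite T" "T \<subseteq> S" "s \<in> T"
  shows "cox_refl W T s (cox_refl W T s v) = v"
proof -
  have sS: "s \<in> S" using assms by auto
  have "bil T s (\<lambda>t. 1 * v t + (- 2 * bil T s v) * root_vec s t) = - bil T s v"
    unfolding bil_lincomb using assms sS by (simp add: bil_root)
  then have "bil T s (\<lambda>t. v t - 2 * bil T s v * root_vec s t) = - bil T s v" by simp
  then show ?thesis unfolding cox_refl_bil[OF assms(1,3)] by simp
qed

lemma act_cong:
  assumes "finite S" "us \<in> lists S" "vs \<in> lists S" "wp us = wp vs"
  shows "act S us v = act S vs v"
proof -
  have "cox_cong W S us vs" using presentation assms by blast
  then show ?thesis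
  proof (induction arbitrary: v rule: cox_cong.induct)
    case (append us us' vs vs')
    then show ?case by (simp add: act_append)
  next
    case (braid s t)
    show ?case
    proof (cases "s = t \<or> cox_m W s t = 0")
      case True
      then show ?thesis
      proof
        assume "s = t"
        then show ?thesis using braid refl_refl[OF assms(1)] by simp
      qed simp
    next
      case False
      then show ?thesis using act_braid_neq[OF assms(1) order_refl braid] by simp
    qed
  qed auto
qed

lemma act_supp:
  assumes "finite T" "ws \<in> lists T" "\<And>t. t \<notin> T \<Longrightarrow> v t = 0" "t \<notin> T"
  shows "act T ws v t = 0"
  using assms(2)
proof (induction ws)
  case (Cons s ws)
  then show ?case using assms by (auto simp: cox_refl_bil root_vec_def)
qed (use assms in simp)

text \<open>Vectors supported on \<open>T\<close> stay so under the reflections in \<open>T\<close>;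
  the polytope of a spherical subset can therefore be studied in the representation of the whole
  group.\<close>

lemma act_subset:
  assumes "finite S" "T \<subseteq> S" "ws \<in> lists T" "\<And>t. t \<notin> T \<Longrightarrow> v t = 0"
  shows "act T ws v = act S ws v"
  using assms(3)
proof (induction ws)
  case (Cons s ws)
  have fT: "finite T" using assms finite_subset by blast
  have s: "s \<in> T" "ws \<in> lists T" using Cons by auto
  have "cox_refl W T s (act T ws v) = cox_refl W S s (act T ws v)"
    unfolding cox_refl_bil[OF fT s(1)] cox_refl_bil[OF assms(1) subsetD[OF assms(2) s(1)]]
    using bil_superset[OF assms(1,2), of "act T ws v"] act_supp[OF fT s(2) assms(4)] by simp
  then show ?case using Cons.IH by simp
qed simp

lemma act_lincomb:
  assumes "finite T" "ws \<in> lists T"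
  shows "act T ws (\<lambda>r. \<Sum>y\<in>Y. c y * f y r) = (\<lambda>r. \<Sum>y\<in>Y. c y * act T ws (f y) r)"
  using assms(2)
proof (induction ws)
  case (Cons s ws)
  have s: "s \<in> T" using Cons by auto
  show ?case
    by (simp add: Cons.IH cox_refl_bil[OF assms(1) s] bil_sum fun_eq_iff sum_subtractf
        sum_distrib_left sum_distrib_right algebra_simps)
qed simp

lemma act_sub:
  assumes "finite T" "ws \<in> lists T"
  shows "act T ws (\<lambda>r. u r - v r) = (\<lambda>r. act T ws u r - act T ws v r)"
  using assms(2)
proof (induction ws)
  case (Cons s ws)
  have s: "s \<in> T" using Cons by auto
  show ?case
    by (simp add: Cons.IH cox_refl_bil[OF assms(1) s] bil_sub fun_eq_iff algebra_simps)
qed simp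

section \<open>Asymptotic dimension of Coxeter groups\<close>

definition some_word :: "'w \<Rightarrow> 'w list" where
  "some_word w = (SOME ws. ws \<in> lists S \<and> wp ws = w)"

lemma some_word: assumes "w \<in> G" shows "some_word w \<in> lists S" "wp (some_word w) = w"
  using someI_ex[OF word_ex[OF assms]] unfolding some_word_def by blast+

definition ract :: "'w \<Rightarrow> ('w \<Rightarrow> real) \<Rightarrow> 'w \<Rightarrow> real" where
  "ract w v = act S (some_word w) v"

lemma ract_word: assumes "finite S" "ws \<in> lists S" shows "ract (wp ws) v = act S ws v"
proof -
  have "wp ws \<in> G" using assms(2) by (rule word_prod_closed)
  from some_word[OF this] show ?thesis unfolding ract_def using act_cong[OF assms(1)] assms(2) by blast
qed

lemma ract_one: "finite S \<Longrightarrow> ract \<epsilon> v = v"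
  using ract_word[of "[]" v] by simp

lemma ract_mult:
  assumes "finite S" "v \<in> G" "w \<in> G" shows "ract (v \<cdot> w) f = ract v (ract w f)"
proof -
  have "some_word v @ some_word w \<in> lists S" using some_word(1) assms by auto
  moreover have "wp (some_word v @ some_word w) = v \<cdot> w"
    using some_word assms by simp
  ultimately show ?thesis using ract_word[OF assms(1), of "some_word v @ some_word w" f]
    by (simp add: act_append ract_def)
qed

lemma ract_sub:
  assumes "finite S" "w \<in> G"
  shows "ract w (\<lambda>r. u r - v r) = (\<lambda>r. ract w u r - ract w v r)"
  unfolding ract_def by (rule act_sub[OF assms(1) some_word(1)[OF assms(2)]])

lemma ract_lincomb:
  assumes "finite S" "w \<in> G"
  shows "ract w (\<lambda>r. \<Sum>y\<in>Y. c y * f y r) = (\<lambda>r. \<Sum>y\<in>Y. c y * ract w (f y) r)"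
  unfolding ract_def by (rule act_lincomb[OF assms(1) some_word(1)[OF assms(2)]])

lemma ract_scale:
  assumes "finite S" "w \<in> G" shows "ract w (\<lambda>r. a * f r) = (\<lambda>r. a * ract w f r)"
  using ract_lincomb[OF assms, where Y = "{()}" and c = "\<lambda>_. a" and f = "\<lambda>_. f"] by simp

text \<open>\<open>M\<close> is the product of the finite orders, so all angles involved are integer
  multiples of \<open>pi / M\<close>. The factor 2 turns the cosines into algebraic
  integers.\<close>

lemma order_two_BB:
  assumes "finite S"
  obtains g n where "real_order g n" "\<And>s t. s \<in> S \<Longrightarrow> t \<in> S \<Longrightarrow> 2 * BB s t \<in> zspan g n"
    "\<And>s t k. s \<in> S \<Longrightarrow> t \<in> S \<Longrightarrow> cox_m W s t \<noteq> 0 \<Longrightarrow>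
       2 * cos (2 * real (k::nat) * (pi / real (cox_m W s t))) \<in> zspan g n"
proof -
  define M where "M = (\<Prod>(s, t)\<in>S \<times> S. if cox_m W s t = 0 then 1 else cox_m W s t)"
  have M: "M > 0" unfolding M_def by (intro prod_pos) auto
  define g where "g = (\<lambda>k. if k = 0 then 1 else 2 * cos (real k * pi / real M))"
  let ?A = "zspan g (2 * M + 1)"
  have cosA: "2 * cos (real k * pi / real M) \<in> ?A" for k
    unfolding g_def by (rule cos_mem[OF M])
  have 1: "2 * cos (real k * (pi / real (cox_m W s t))) \<in> ?A"
    if "s \<in> S" "t \<in> S" "cox_m W s t \<noteq> 0" for s t k
  proof -
    have "(\<lambda>(s, t). if cox_m W s t = 0 then 1 else cox_m W s t) (s, t) dvd M"
      unfolding M_def using assms that by (intro dvd_prodI) auto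
    then have "cox_m W s t dvd M" using that(3) by simp
    then obtain c where c: "M = cox_m W s t * c" by blast
    then have "c \<noteq> 0" using M by auto
    then have "real k * (pi / real (cox_m W s t)) = real (k * c) * pi / real M"
      using that(3) unfolding c by (simp add: field_simps)
    then show ?thesis using cosA[of "k * c"] by simp
  qed
  show ?thesis
  proof (rule that)
    show "real_order g (2 * M + 1)" unfolding g_def by (rule cos_real_order[OF M])
  next
    fix s t assume st: "s \<in> S" "t \<in> S"
    have "2 * cos (pi / real (cox_m W s t)) \<in> ?A"
    proof (cases "cox_m W s t = 0")
      case True
      then show ?thesis using cosA[of 0] by simp
    next
      case False
      then show ?thesis using 1[OF st, of 1] by simp
    qed
    from zspan_minus[OF this] show "2 * BB s t \<in> ?A" unfolding BB_def by simp
  next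
    fix s t k assume "s \<in> S" "t \<in> S" "cox_m W s t \<noteq> 0"
    then show "2 * cos (2 * real (k::nat) * (pi / real (cox_m W s t))) \<in> ?A"
      using 1[of s t "2 * k"] by simp
  qed
qed

section \<open>Reduction of the representation modulo an integer\<close>

context
  fixes g n
  assumes S: "finite S" and ord: "real_order g n"
    and BBA: "\<And>s t. s \<in> S \<Longrightarrow> t \<in> S \<Longrightarrow> 2 * BB s t \<in> zspan g n"
begin

interpretation real_order g n by (rule ord)

text \<open>The free module over the order with the roots as basis. It is stable under the
  reflections, whose coefficients are the numbers \<open>2 * BB s t\<close>.\<close>

definition lattice :: "('w \<Rightarrow> real) set" where
  "lattice = {v. (\<forall>s\<in>S. v s \<in> zspan g n) \<and> (\<forall>s. s \<notin> S \<longrightarrow> v s = 0)}"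

lemma root_lattice: "s \<in> S \<Longrightarrow> root_vec s \<in> lattice"
  unfolding lattice_def root_vec_def using one zspan_0 by auto

lemma two_bil_lattice: assumes "v \<in> lattice" "s \<in> S" shows "2 * bil S s v \<in> A"
proof -
  have "2 * bil S s v = (\<Sum>t\<in>S. (2 * BB s t) * v t)" unfolding bil_def
    by (simp add: sum_distrib_left mult.assoc)
  moreover have "(2 * BB s t) * v t \<in> A" if "t \<in> S" for t
    using that assms(1) unfolding lattice_def by (auto intro!: mult[OF BBA[OF assms(2) that]])
  ultimately show ?thesis using zspan_sum[of S "\<lambda>t. (2 * BB s t) * v t"] by simp
qed

lemma act_lattice: "ws \<in> lists S \<Longrightarrow> v \<in> lattice \<Longrightarrow> act S ws v \<in> lattice"
proof (induction ws)
  case (Cons s ws)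
  then have s: "s \<in> S" and v: "act S ws v \<in> lattice" by auto
  have "act S ws v t - 2 * bil S s (act S ws v) * root_vec s t \<in> A" if "t \<in> S" for t
    using v two_bil_lattice[OF v s] that unfolding lattice_def root_vec_def
    by (auto intro: zspan_diff)
  moreover have "act S ws v t - 2 * bil S s (act S ws v) * root_vec s t = 0" if "t \<notin> S" for t
    using v s that unfolding lattice_def root_vec_def by auto
  ultimately show ?case by (auto simp: cox_refl_bil[OF S s] lattice_def)
qed simp

lemma ract_lattice: "w \<in> G \<Longrightarrow> v \<in> lattice \<Longrightarrow> ract w v \<in> lattice"
  unfolding ract_def by (rule act_lattice[OF some_word(1)])

definition mod_lattice :: "nat \<Rightarrow> ('w \<Rightarrow> real) set" where
  "mod_lattice N = {\<lambda>r. real N * u r | u. u \<in> lattice}"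

lemma mod_lattice_ract: assumes "w \<in> G" "v \<in> mod_lattice N" shows "ract w v \<in> mod_lattice N"
proof -
  obtain u where "u \<in> lattice" "v = (\<lambda>r. real N * u r)" using assms unfolding mod_lattice_def by blast
  then show ?thesis unfolding mod_lattice_def using ract_scale[OF S assms(1)] ract_lattice[OF assms(1)] by auto
qed

lemma lincomb_lattice:
  assumes "\<And>y. y \<in> S \<Longrightarrow> c y \<in> A" "\<And>y. y \<in> S \<Longrightarrow> f y \<in> lattice"
  shows "(\<lambda>r. \<Sum>y\<in>S. c y * f y r) \<in> lattice"
  using assms unfolding lattice_def by (auto intro!: zspan_sum mult)

lemma lincomb_mod_lattice:
  assumes "\<And>y. y \<in> S \<Longrightarrow> c y \<in> A" "\<And>y. y \<in> S \<Longrightarrow> f y \<in> mod_lattice N"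
  shows "(\<lambda>r. \<Sum>y\<in>S. c y * f y r) \<in> mod_lattice N"
proof -
  have "\<forall>y\<in>S. \<exists>u. u \<in> lattice \<and> f y = (\<lambda>r. real N * u r)" using assms(2) unfolding mod_lattice_def by auto
  from bchoice[OF this] obtain u where u: "\<forall>y\<in>S. u y \<in> lattice \<and> f y = (\<lambda>r. real N * u y r)" by blast
  have "(\<lambda>r. \<Sum>y\<in>S. c y * f y r) = (\<lambda>r. real N * (\<Sum>y\<in>S. c y * u y r))"
    unfolding sum_distrib_left by (intro ext sum.cong) (use u in auto)
  moreover have "(\<lambda>r. \<Sum>y\<in>S. c y * u y r) \<in> lattice" using u assms(1) by (intro lincomb_lattice) auto
  ultimately show ?thesis unfolding mod_lattice_def by auto
qed

text \<open>\<open>colour N w\<close> is the matrix of \<open>w\<close> modulo \<open>N\<close>.\<close>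

definition coef :: "real \<Rightarrow> nat \<Rightarrow> int" where
  "coef x = (SOME a. x = (\<Sum>k<n. of_int (a k) * g k))"

lemma coef: "x \<in> A \<Longrightarrow> x = (\<Sum>k<n. of_int (coef x k) * g k)"
  unfolding coef_def zspan_def mem_Collect_eq
  by (rule someI_ex[where P = "\<lambda>a. x = (\<Sum>k<n. of_int (a k) * g k)"])

definition colour :: "nat \<Rightarrow> 'w \<Rightarrow> 'w \<times> 'w \<Rightarrow> nat \<Rightarrow> int" where
  "colour N w = restrict (\<lambda>(x, y). restrict (\<lambda>k. coef (ract w (root_vec y) x) k mod int N) {..<n}) (S \<times> S)"

lemma finite_colour: assumes "N > 0" shows "finite (range (colour N))"
proof (rule finite_subset)
  show "range (colour N) \<subseteq> (S \<times> S) \<rightarrow>\<^sub>E ({..<n} \<rightarrow>\<^sub>E {0..<int N})"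
    unfolding colour_def using assms by (auto split: if_splits)
  show "finite ((S \<times> S) \<rightarrow>\<^sub>E ({..<n} \<rightarrow>\<^sub>E {0..<int N}))"
    using S by (intro finite_PiE) auto
qed

text \<open>The generators may be dependent over the integers, so \<open>coef\<close> makes a choice
  of coordinates. Equal residues of the chosen coordinates still put the difference of two entries
  into \<open>N\<close> times the order.\<close>

lemma colour_eq:
  assumes "w \<in> G" "w' \<in> G" "colour N w = colour N w'" "v \<in> lattice"
  shows "(\<lambda>r. ract w v r - ract w' v r) \<in> mod_lattice N"
proof -
  have entry: "\<exists>b\<in>A. ract w (root_vec y) x - ract w' (root_vec y) x = real N * b"
    if xy: "x \<in> S" "y \<in> S" for x y
  proof -
    let ?a = "ract w (root_vec y) x" and ?b = "ract w' (root_vec y) x"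
    have A: "?a \<in> A" "?b \<in> A"
      using ract_lattice[OF _ root_lattice[OF xy(2)]] assms xy unfolding lattice_def by auto
    have c: "(coef ?a k - coef ?b k) = int N * ((coef ?a k - coef ?b k) div int N)" if "k < n" for k
    proof -
      have "coef ?a k mod int N = coef ?b k mod int N"
        using fun_cong[OF fun_cong[OF assms(3), of "(x, y)"], of k] xy that unfolding colour_def by simp
      then show ?thesis by (simp add: mod_eq_dvd_iff)
    qed
    have "?a - ?b = (\<Sum>k<n. of_int (coef ?a k - coef ?b k) * g k)"
      using coef[OF A(1)] coef[OF A(2)] by (simp add: sum_subtractf algebra_simps)
    also have "\<dots> = (\<Sum>k<n. real N * (of_int ((coef ?a k - coef ?b k) div int N) * g k))"
    proof (rule sum.cong)
      fix k assume "k \<in> {..<n}"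
      then have "real_of_int (coef ?a k - coef ?b k) = real_of_int (int N * ((coef ?a k - coef ?b k) div int N))"
        using c[of k] by simp
      then show "real_of_int (coef ?a k - coef ?b k) * g k =
          real N * (of_int ((coef ?a k - coef ?b k) div int N) * g k)" by simp
    qed simp
    finally have "?a - ?b = real N * (\<Sum>k<n. of_int ((coef ?a k - coef ?b k) div int N) * g k)"
      by (simp add: sum_distrib_left)
    moreover have "(\<Sum>k<n. of_int ((coef ?a k - coef ?b k) div int N) * g k) \<in> A" by (rule zspanI) simp
    ultimately show ?thesis by blast
  qed
  have col: "(\<lambda>r. ract w (root_vec y) r - ract w' (root_vec y) r) \<in> mod_lattice N" if y: "y \<in> S" for y
  proof -
    have "\<forall>x\<in>S. \<exists>b. b \<in> A \<and> ract w (root_vec y) x - ract w' (root_vec y) x = real N * b"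
      using entry y by blast
    from bchoice[OF this] obtain b where b: "\<forall>x\<in>S. b x \<in> A \<and>
      ract w (root_vec y) x - ract w' (root_vec y) x = real N * b x" by blast
    define u where "u = (\<lambda>x. if x \<in> S then b x else 0)"
    have "u \<in> lattice" unfolding u_def lattice_def using b by auto
    moreover have "ract w (root_vec y) r - ract w' (root_vec y) r = real N * u r" for r
      using b ract_lattice[OF assms(1) root_lattice[OF y]] ract_lattice[OF assms(2) root_lattice[OF y]]
      unfolding u_def lattice_def by auto
    ultimately show ?thesis unfolding mod_lattice_def by auto
  qed
  have v: "v = (\<lambda>r. \<Sum>y\<in>S. v y * root_vec y r)"
  proof
    fix r
    have "(\<Sum>y\<in>S. v y * root_vec y r) = (\<Sum>y\<in>S. if y = r then v y else 0)"
      by (rule sum.cong) (auto simp: root_vec_def)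
    then show "v r = (\<Sum>y\<in>S. v y * root_vec y r)" using S assms(4) unfolding lattice_def by auto
  qed
  have "(\<lambda>r. ract w v r - ract w' v r) = (\<lambda>r. \<Sum>y\<in>S. v y * (ract w (root_vec y) r - ract w' (root_vec y) r))"
    by (subst (1 2) v) (simp add: ract_lincomb[OF S] assms sum_subtractf right_diff_distrib)
  then show ?thesis using lincomb_mod_lattice[OF _ col] assms(4) unfolding lattice_def by auto
qed

lemma two_bil_mod_lattice:
  assumes "v \<in> mod_lattice N" "s \<in> S" shows "\<exists>b\<in>A. 2 * bil S s v = real N * b"
proof -
  obtain u where u: "u \<in> lattice" "v = (\<lambda>r. real N * u r)" using assms unfolding mod_lattice_def by blast
  have "2 * bil S s v = real N * (2 * bil S s u)"
    unfolding u(2) bil_def by (simp add: sum_distrib_left algebra_simps)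
  then show ?thesis using two_bil_lattice[OF u(1) assms(2)] by blast
qed

text \<open>Both reflections are applied to \<open>ract x (ract r (root_vec s))\<close> and
  \<open>x\<close> is undone: one yields the rotation \<open>s \<cdot> r\<close> of
  \<open>root_vec s\<close>, the other \<open>root_vec s\<close> itself. Equal colours make the
  difference divisible by \<open>N\<close>, and pairing it with \<open>root_vec s\<close> gives a
  divisibility in the order.\<close>

lemma crossing_colour:
  assumes "crossing t t'" "colour N t = colour N t'"
  obtains s s1 k b where "s \<in> S" "s1 \<in> S" "0 < k" "k < cox_m W s s1" "b \<in> A"
    "2 * cos (2 * real (k::nat) * (pi / real (cox_m W s s1))) - 2 = real N * b"
proof -
  obtain x s s1 r and j :: int where c: "x \<in> G" "s \<in> S" "s1 \<in> S" "r \<in> G" "cox_m W s s1 \<noteq> 0"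
    "t = x \<cdot> s \<cdot> iv x" "t' = x \<cdot> r \<cdot> iv x" "s \<cdot> r = (s \<cdot> s1) [^]\<^bsub>W\<^esub> j" "s \<cdot> r \<noteq> \<epsilon>"
    using crossing_dihedral[OF assms(1)] by metis
  have t': "t \<in> G" "t' \<in> G" "t' \<in> refls" using assms(1) unfolding crossing_def by auto
  define m where "m = cox_m W s s1"
  have m: "m > 0" using c m_def by simp
  let ?p = "s \<cdot> s1"
  have p: "?p \<in> G" using c by simp
  \<comment> \<open>The exponent is reduced modulo the order of the rotation; it is not 0, because
    \<open>s \<cdot> r\<close> is nontrivial.\<close>
  define k where "k = nat (j mod int m)"
  have k: "int k = j mod int m" unfolding k_def using m by simp
  have "int m dvd int k - j" unfolding k by (metis dvd_minus_mod dvd_minus_iff minus_diff_eq)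
  then have "?p [^]\<^bsub>W\<^esub> j = ?p [^]\<^bsub>W\<^esub> int k"
    using int_pow_eq[OF p, of j "int k"] unfolding m_def cox_m_def by simp
  then have srk: "s \<cdot> r = ?p [^]\<^bsub>W\<^esub> k" using c(8) by (simp add: int_pow_int)
  have "k \<noteq> 0" using srk c(9) by (metis nat_pow_0)
  have "int k < int m" unfolding k using m by simp
  then have kb: "0 < k" "k < m" using \<open>k \<noteq> 0\<close> by auto
  have sne: "s \<noteq> s1" using kb cox_m_self[OF c(2)] unfolding m_def by auto
  have rr: "r \<cdot> r = \<epsilon>"
  proof -
    have "r = iv x \<cdot> t' \<cdot> x" using c by (simp add: m_assoc)
    then have "r \<in> refls" using refls_conj'[OF t'(3) c(1)] by simp
    then show ?thesis by simp
  qed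
  let ?e = "root_vec s"
  define v where "v = ract x (ract r ?e)"
  have eL: "?e \<in> lattice" by (rule root_lattice[OF c(2)])
  have "v \<in> lattice" unfolding v_def using c eL by (intro ract_lattice)
  then have "(\<lambda>q. ract t v q - ract t' v q) \<in> mod_lattice N" using colour_eq t' assms(2) by blast
  then have "ract (iv x) (\<lambda>q. ract t v q - ract t' v q) \<in> mod_lattice N"
    using mod_lattice_ract c(1) by simp
  moreover have "ract (iv x) (\<lambda>q. ract t v q - ract t' v q) = (\<lambda>q. ract (s \<cdot> r) ?e q - ?e q)"
  proof -
    have "ract (iv x) (ract t v) = ract (iv x \<cdot> (t \<cdot> (x \<cdot> r))) ?e"
      unfolding v_def using ract_mult[OF S] c t' by simp
    also have "iv x \<cdot> (t \<cdot> (x \<cdot> r)) = s \<cdot> r" using c by (simp add: m_assoc)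
    finally have 1: "ract (iv x) (ract t v) = ract (s \<cdot> r) ?e" .
    have "ract (iv x) (ract t' v) = ract (iv x \<cdot> (t' \<cdot> (x \<cdot> r))) ?e"
      unfolding v_def using ract_mult[OF S] c t' by simp
    also have "iv x \<cdot> (t' \<cdot> (x \<cdot> r)) = \<epsilon>" using c rr by (simp add: m_assoc)
    finally have 2: "ract (iv x) (ract t' v) = ?e" using ract_one[OF S] by simp
    show ?thesis using ract_sub[OF S, of "iv x"] c(1) 1 2 by simp
  qed
  ultimately have "(\<lambda>q. ract (s \<cdot> r) ?e q - ?e q) \<in> mod_lattice N" by simp
  from two_bil_mod_lattice[OF this c(2)] obtain b where
    b: "b \<in> A" "2 * bil S s (\<lambda>q. ract (s \<cdot> r) ?e q - ?e q) = real N * b" by blast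
  have "concat (replicate k [s, s1]) \<in> lists S" using c by auto
  then have "ract (s \<cdot> r) ?e = act S (concat (replicate k [s, s1])) ?e"
    using ract_word[OF S, of "concat (replicate k [s, s1])" ?e] word_prod_replicate[OF c(2,3), of k] srk by simp
  then have "bil S s (ract (s \<cdot> r) ?e) = cos (2 * real k * (pi / real (cox_m W s s1)))"
    using bil_act_rotation[OF S order_refl c(2,3) sne c(5)] by simp
  moreover have "bil S s ?e = 1" using bil_root[OF S c(2)] c(2) by simp
  ultimately have "2 * cos (2 * real k * (pi / real (cox_m W s s1))) - 2 = real N * b"
    using b(2) unfolding bil_sub by simp
  then show ?thesis using that c kb b(1) unfolding m_def by blast
qed

end

lemma cos_rotation_neq_1:
  assumes "0 < k" "k < m" shows "cos (2 * real (k::nat) * (pi / real m)) \<noteq> 1"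
proof
  assume "cos (2 * real k * (pi / real m)) = 1"
  then obtain i :: int where "2 * real k * (pi / real m) = of_int i * (2 * pi)"
    unfolding cos_one_2pi_int by auto
  then have "real k = of_int i * real m" using assms by (simp add: field_simps)
  then have "real_of_int (int k) = real_of_int (i * int m)" by simp
  then have "int k = i * int m" by (simp only: of_int_eq_iff)
  then have "m dvd k" by (metis dvd_triv_right int_dvd_int_iff)
  then show False using assms by (auto dest: dvd_imp_le)
qed

text \<open>Only finitely many differences \<open>2 * cos (...) - 2\<close> arise, none of them
  zero, and each excludes all moduli beyond some bound. \<open>N\<close> exceeds all these
  bounds.\<close>

lemma crossing_free_colouring:
  assumes "finite S"
  obtains \<kappa> :: "'w \<Rightarrow> 'w \<times> 'w \<Rightarrow> nat \<Rightarrow> int"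
    where "finite (range \<kappa>)" "\<And>t t'. \<kappa> t = \<kappa> t' \<Longrightarrow> \<not> crossing t t'"
proof -
  obtain g n where ord: "real_order g n" and BBA: "\<And>s t. s \<in> S \<Longrightarrow> t \<in> S \<Longrightarrow> 2 * BB s t \<in> zspan g n"
    and cosA: "\<And>s t k. s \<in> S \<Longrightarrow> t \<in> S \<Longrightarrow> cox_m W s t \<noteq> 0 \<Longrightarrow>
       2 * cos (2 * real (k::nat) * (pi / real (cox_m W s t))) \<in> zspan g n"
    by (rule order_two_BB[OF assms]) blast
  interpret real_order g n by (rule ord)
  define F where "F = (\<Union>s\<in>S. \<Union>t\<in>S. (\<lambda>k. 2 * cos (2 * real k * (pi / real (cox_m W s t))) - 2) ` {k. 0 < k \<and> k < cox_m W s t})"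
  have "finite F" unfolding F_def using assms by auto
  have F: "\<exists>c. \<forall>N y. N > c \<longrightarrow> y \<in> A \<longrightarrow> f \<noteq> real N * y" if fF: "f \<in> F" for f
  proof -
    obtain s t k where *: "s \<in> S" "t \<in> S" "0 < k" "k < cox_m W s t"
      "f = 2 * cos (2 * real k * (pi / real (cox_m W s t))) - 2"
      using fF unfolding F_def by auto
    have "of_int 2 \<in> A" by (rule of_int_mem)
    then have "f \<in> A" unfolding *(5) using cosA[OF *(1,2)] *(4) by (intro zspan_diff) auto
    moreover have "f \<noteq> 0" unfolding *(5) using cos_rotation_neq_1[OF *(3,4)] by simp
    ultimately show ?thesis using not_divisible by metis
  qed
  then have "\<forall>f\<in>F. \<exists>c. \<forall>N y. N > c \<longrightarrow> y \<in> A \<longrightarrow> f \<noteq> real N * y" by blast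
  from bchoice[OF this] obtain c where
    c: "\<forall>f\<in>F. \<forall>N y. N > c f \<longrightarrow> y \<in> A \<longrightarrow> f \<noteq> real N * y" by blast
  define N where "N = Suc (\<Sum>f\<in>F. c f)"
  have N: "f \<noteq> real N * y" if "f \<in> F" "y \<in> A" for f y
  proof -
    have "c f \<le> (\<Sum>f\<in>F. c f)" using that \<open>finite F\<close> by (intro member_le_sum) auto
    then have "N > c f" unfolding N_def by simp
    then show ?thesis using c that by blast
  qed
  have fin: "finite (range (colour g n N))"
    using finite_colour[OF assms ord BBA] N_def by simp
  have nc: "\<not> crossing t t'" if "colour g n N t = colour g n N t'" for t t'
  proof
    assume "crossing t t'"
    from crossing_colour[OF assms ord BBA this that]
    obtain s s1 k b where *: "s \<in> S" "s1 \<in> S" "0 < k" "k < cox_m W s s1" "b \<in> A"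
      "2 * cos (2 * real (k::nat) * (pi / real (cox_m W s s1))) - 2 = real N * b" by metis
    then have "2 * cos (2 * real k * (pi / real (cox_m W s s1))) - 2 \<in> F" unfolding F_def by blast
    then show False using N * by blast
  qed
  show ?thesis by (rule that[OF fin nc])
qed

section \<open>Embedding of the group into a product of trees\<close>

lemma len_diff_NN:
  assumes "v \<in> G" "w \<in> G"
  shows "len (iv v \<cdot> w) = card ((NN v - NN w) \<union> (NN w - NN v))"
proof -
  let ?u = "iv v \<cdot> w"
  have u: "?u \<in> G" "w = v \<cdot> ?u" using assms by auto
  have mem: "t \<in> NN w \<longleftrightarrow> (t \<in> NN v) \<noteq> (iv v \<cdot> t \<cdot> v \<in> NN ?u)" if "t \<in> G" for t
    using NN_mult[OF assms(1) u(1) that] u(2) by simp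
  have "(NN v - NN w) \<union> (NN w - NN v) = (\<lambda>r. v \<cdot> r \<cdot> iv v) ` NN ?u"
  proof (intro equalityI subsetI)
    fix t assume t: "t \<in> (NN v - NN w) \<union> (NN w - NN v)"
    then have tG: "t \<in> G" using NN_carrier by blast
    then have "iv v \<cdot> t \<cdot> v \<in> NN ?u" using mem t by blast
    moreover have "t = v \<cdot> (iv v \<cdot> t \<cdot> v) \<cdot> iv v" using tG assms by (simp add: m_assoc)
    ultimately show "t \<in> (\<lambda>r. v \<cdot> r \<cdot> iv v) ` NN ?u" by blast
  next
    fix t assume "t \<in> (\<lambda>r. v \<cdot> r \<cdot> iv v) ` NN ?u"
    then obtain r where r: "r \<in> NN ?u" "t = v \<cdot> r \<cdot> iv v" by blast
    have rG: "r \<in> G" using r NN_carrier by blast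
    then have tG: "t \<in> G" and "iv v \<cdot> t \<cdot> v = r" using r assms by (auto simp: m_assoc)
    then show "t \<in> (NN v - NN w) \<union> (NN w - NN v)" using mem r by blast
  qed
  moreover have "inj_on (\<lambda>r. v \<cdot> r \<cdot> iv v) (NN ?u)"
  proof (rule inj_onI)
    fix x y assume "x \<in> NN ?u" "y \<in> NN ?u" and eq: "v \<cdot> x \<cdot> iv v = v \<cdot> y \<cdot> iv v"
    then have "x \<in> G" "y \<in> G" using NN_carrier by auto
    then show "x = y" using eq assms(1) by simp
  qed
  ultimately show ?thesis using u(1) by (simp add: len_NN card_image)
qed

theorem asdim_le_coxeter_group:
  assumes "finite S"
  obtains n where "asdim_le G (gallery_dist W S (cox_dist W)) n"
proof -
  obtain \<kappa> :: "'w \<Rightarrow> 'w \<times> 'w \<Rightarrow> nat \<Rightarrow> int"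
    where fin: "finite (range \<kappa>)" and nc: "\<And>t t'. \<kappa> t = \<kappa> t' \<Longrightarrow> \<not> crossing t t'"
    using crossing_free_colouring[OF assms] by metis
  define N where "N = (\<lambda>i w. {t \<in> NN w. \<kappa> t = i})"
  have "asdim_le G (gallery_dist W S (cox_dist W)) (card (Pow (range \<kappa>)))"
  proof (rule asdim_le_tree_product[OF fin, where N = N])
    show "finite (N i x)" if "x \<in> G" for i x using that unfolding N_def by simp
    show "N i x \<inter> N i y \<subseteq> N i z \<or> N i y \<inter> N i z \<subseteq> N i x" if "x \<in> G" "y \<in> G" "z \<in> G" for i x y z
    proof (rule ccontr)
      assume "\<not> ?thesis"
      \<comment> \<open>\<open>x\<close> is beyond the wall of \<open>t\<close> alone,
        \<open>z\<close> beyond that of \<open>t'\<close> alone, and \<open>y\<close> beyond both,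
        so two walls of one colour would cross.\<close>
      then obtain t t' where t: "t \<in> N i x" "t \<in> N i y" "t \<notin> N i z" "t' \<in> N i y" "t' \<in> N i z" "t' \<notin> N i x"
        by blast
      then have "crossing t t'" unfolding crossing_def N_def using that NN_refls by blast
      moreover have "\<kappa> t = \<kappa> t'" using t unfolding N_def by simp
      ultimately show False using nc by blast
    qed
    show "gallery_dist W S (cox_dist W) x y =
      real (\<Sum>i\<in>range \<kappa>. card ((N i x - N i y) \<union> (N i y - N i x)))" if xy: "x \<in> G" "y \<in> G" for x y
    proof -
      let ?D = "(NN x - NN y) \<union> (NN y - NN x)"
      have fD: "finite ?D" using xy by simp
      have "?D = (\<Union>i\<in>range \<kappa>. (N i x - N i y) \<union> (N i y - N i x))" unfolding N_def by auto
      moreover have "card (\<Union>i\<in>range \<kappa>. (N i x - N i y) \<union> (N i y - N i x)) =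
         (\<Sum>i\<in>range \<kappa>. card ((N i x - N i y) \<union> (N i y - N i x)))"
      proof (rule card_UN_disjoint)
        show "finite (range \<kappa>)" by (rule fin)
        show "\<forall>i\<in>range \<kappa>. finite ((N i x - N i y) \<union> (N i y - N i x))" using xy unfolding N_def by simp
        show "\<forall>i\<in>range \<kappa>. \<forall>j\<in>range \<kappa>. i \<noteq> j \<longrightarrow>
          ((N i x - N i y) \<union> (N i y - N i x)) \<inter> ((N j x - N j y) \<union> (N j y - N j x)) = {}"
          unfolding N_def by auto
      qed
      ultimately show ?thesis unfolding gallery_dist_def cox_dist_def using len_diff_NN[OF xy] by simp
    qed
  qed
  then show ?thesis by (rule that)
qed

end

section \<open>Galleries and apartments\<close>

context building begin

definition gal :: "'w list \<Rightarrow> 'c \<Rightarrow> 'c \<Rightarrow> bool" where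
  "gal ws c d \<longleftrightarrow> (\<exists>cs. gallery C E ws cs \<and> hd cs = c \<and> last cs = d)"

lemma gal_Nil: "gal [] c d \<longleftrightarrow> c \<in> C \<and> c = d"
proof
  assume "gal [] c d"
  then obtain cs where "gallery C E [] cs" "hd cs = c" "last cs = d" unfolding gal_def by blast
  then show "c \<in> C \<and> c = d" unfolding gallery_def by (auto simp: length_Suc_conv)
next
  assume "c \<in> C \<and> c = d"
  then have "gallery C E [] [c] \<and> hd [c] = c \<and> last [c] = d" unfolding gallery_def by auto
  then show "gal [] c d" unfolding gal_def by blast
qed

lemma E_closed: assumes "s \<in> S" "(c, d) \<in> E s" shows "c \<in> C" "d \<in> C"
  using equivalence[OF assms(1)] assms(2) unfolding equiv_def refl_on_def by auto

lemma E_sym: "s \<in> S \<Longrightarrow> (c, d) \<in> E s \<Longrightarrow> (d, c) \<in> E s"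
  using equivalence unfolding equiv_def sym_def by blast

lemma E_trans: "s \<in> S \<Longrightarrow> (c, d) \<in> E s \<Longrightarrow> (d, e) \<in> E s \<Longrightarrow> (c, e) \<in> E s"
  using equivalence unfolding equiv_def trans_def by blast

lemma gal_Cons: assumes "s \<in> S"
  shows "gal (s # ws) c e \<longleftrightarrow> (\<exists>d. c \<noteq> d \<and> (c, d) \<in> E s \<and> gal ws d e)"
proof
  assume "gal (s # ws) c e"
  then obtain cs where cs: "gallery C E (s # ws) cs" "hd cs = c" "last cs = e" unfolding gal_def by blast
  then have "length cs = Suc (Suc (length ws))" unfolding gallery_def by simp
  then obtain a b cs' where ab: "cs = a # b # cs'" "length cs' = length ws"
    by (auto simp: length_Suc_conv)
  have adj: "cs ! i \<noteq> cs ! Suc i \<and> (cs ! i, cs ! Suc i) \<in> E ((s # ws) ! i)" if "i < Suc (length ws)" for i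
    using cs(1) that unfolding gallery_def by simp
  have "gallery C E ws (b # cs')"
    unfolding gallery_def
  proof (intro conjI allI impI)
    show "set (b # cs') \<subseteq> C" using cs(1) ab unfolding gallery_def by auto
    show "length (b # cs') = Suc (length ws)" using ab by simp
    fix i assume "i < length ws"
    then show "(b # cs') ! i \<noteq> (b # cs') ! Suc i" "((b # cs') ! i, (b # cs') ! Suc i) \<in> E (ws ! i)"
      using adj[of "Suc i"] ab by auto
  qed
  then have "gal ws b e" unfolding gal_def using cs ab by (intro exI[of _ "b # cs'"]) auto
  moreover have "c \<noteq> b" "(c, b) \<in> E s" using adj[of 0] ab cs by auto
  ultimately show "\<exists>d. c \<noteq> d \<and> (c, d) \<in> E s \<and> gal ws d e" by blast
next
  assume "\<exists>d. c \<noteq> d \<and> (c, d) \<in> E s \<and> gal ws d e"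
  then obtain d cs where d: "c \<noteq> d" "(c, d) \<in> E s" and cs: "gallery C E ws cs" "hd cs = d" "last cs = e"
    unfolding gal_def by blast
  have ne: "cs \<noteq> []" using cs(1) unfolding gallery_def by auto
  have "gallery C E (s # ws) (c # cs)"
    unfolding gallery_def
  proof (intro conjI allI impI)
    show "set (c # cs) \<subseteq> C" using cs(1) E_closed[OF assms d(2)] unfolding gallery_def by auto
    show "length (c # cs) = Suc (length (s # ws))" using cs(1) unfolding gallery_def by simp
    fix i assume i: "i < length (s # ws)"
    have "cs ! 0 = d" using cs(2) ne by (simp add: hd_conv_nth)
    moreover have "cs ! j \<noteq> cs ! Suc j \<and> (cs ! j, cs ! Suc j) \<in> E (ws ! j)" if "j < length ws" for j
      using cs(1) that unfolding gallery_def by simp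
    ultimately have "(c # cs) ! i \<noteq> (c # cs) ! Suc i \<and> ((c # cs) ! i, (c # cs) ! Suc i) \<in> E ((s # ws) ! i)"
      using d i by (cases i) simp_all
    then show "(c # cs) ! i \<noteq> (c # cs) ! Suc i" "((c # cs) ! i, (c # cs) ! Suc i) \<in> E ((s # ws) ! i)"
      by blast+
  qed
  then show "gal (s # ws) c e" unfolding gal_def using cs ne by (intro exI[of _ "c # cs"]) auto
qed

lemma gal_closed: "ws \<in> lists S \<Longrightarrow> gal ws c d \<Longrightarrow> c \<in> C \<and> d \<in> C"
proof (induction ws arbitrary: c)
  case Nil
  then show ?case by (auto simp: gal_Nil)
next
  case (Cons s ws)
  then have s: "s \<in> S" "ws \<in> lists S" by auto
  then obtain e where "(c, e) \<in> E s" "gal ws e d" using Cons.prems(2) gal_Cons by blast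
  then show ?case using E_closed[OF s(1)] Cons.IH[OF s(2)] by blast
qed

lemma gal_append:
  assumes "us \<in> lists S" "vs \<in> lists S"
  shows "gal (us @ vs) c e \<longleftrightarrow> (\<exists>d. gal us c d \<and> gal vs d e)"
  using assms(1)
proof (induction us arbitrary: c)
  case Nil
  then show ?case using gal_closed[OF assms(2)] by (auto simp: gal_Nil)
next
  case (Cons s us)
  then show ?case by (auto simp: gal_Cons)
qed

lemma dist_gal:
  assumes "ws \<in> lists S" "len (wp ws) = length ws" "c \<in> C" "d \<in> C"
  shows "\<delta> c d = wp ws \<longleftrightarrow> gal ws c d"
  using dist_gallery[of ws c d] assms unfolding reduced_word_def gal_def by blast

lemma dist_galE:
  assumes "c \<in> C" "d \<in> C"
  obtains ws where "ws \<in> lists S" "wp ws = \<delta> c d" "length ws = len (\<delta> c d)" "gal ws c d"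
proof -
  obtain ws where "ws \<in> lists S" "wp ws = \<delta> c d" "length ws = len (\<delta> c d)"
    using len_word_ex[OF dist_closed[OF assms]] by blast
  then show ?thesis using that dist_gal[of ws c d] assms by simp
qed

lemma dist_self [simp]: "c \<in> C \<Longrightarrow> \<delta> c c = \<epsilon>"
  using dist_gal[of "[]" c c] by (simp add: gal_Nil)

lemma dist_one_iff: "c \<in> C \<Longrightarrow> d \<in> C \<Longrightarrow> \<delta> c d = \<epsilon> \<longleftrightarrow> c = d"
  using dist_gal[of "[]" c d] by (simp add: gal_Nil)

lemma dist_mult:
  assumes "c \<in> C" "d \<in> C" "e \<in> C" "len (\<delta> c d \<cdot> \<delta> d e) = len (\<delta> c d) + len (\<delta> d e)"
  shows "\<delta> c e = \<delta> c d \<cdot> \<delta> d e"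
proof -
  obtain us where us: "us \<in> lists S" "wp us = \<delta> c d" "length us = len (\<delta> c d)" "gal us c d"
    using dist_galE[OF assms(1,2)] by blast
  obtain vs where vs: "vs \<in> lists S" "wp vs = \<delta> d e" "length vs = len (\<delta> d e)" "gal vs d e"
    using dist_galE[OF assms(2,3)] by blast
  have "gal (us @ vs) c e" using gal_append us vs by blast
  moreover have "us @ vs \<in> lists S" "wp (us @ vs) = \<delta> c d \<cdot> \<delta> d e" using us vs by auto
  ultimately show ?thesis using dist_gal[of "us @ vs" c e] assms us vs by simp
qed

lemma dist_split:
  assumes "c \<in> C" "e \<in> C" "\<delta> c e = v \<cdot> w" "v \<in> G" "w \<in> G" "len (v \<cdot> w) = len v + len w"
  obtains d where "d \<in> C" "\<delta> c d = v" "\<delta> d e = w"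
proof -
  obtain us where us: "us \<in> lists S" "wp us = v" "length us = len v" using len_word_ex assms by blast
  obtain vs where vs: "vs \<in> lists S" "wp vs = w" "length vs = len w" using len_word_ex assms by blast
  have uv: "us @ vs \<in> lists S" "wp (us @ vs) = v \<cdot> w" using us vs by auto
  then have "gal (us @ vs) c e" using dist_gal[of "us @ vs" c e] assms us vs by simp
  then obtain d where d: "gal us c d" "gal vs d e" using gal_append us vs by blast
  then have "d \<in> C" using gal_closed us by blast
  then show ?thesis using that d dist_gal[of us c d] dist_gal[of vs d e] us vs assms by simp
qed

lemma dist_S_iff:
  assumes "s \<in> S" "c \<in> C" "d \<in> C" shows "\<delta> c d = s \<longleftrightarrow> c \<noteq> d \<and> (c, d) \<in> E s"
proof -
  have "\<delta> c d = s \<longleftrightarrow> gal [s] c d" using dist_gal[of "[s]" c d] assms by simp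
  also have "\<dots> \<longleftrightarrow> c \<noteq> d \<and> (c, d) \<in> E s" using assms by (auto simp: gal_Cons gal_Nil)
  finally show ?thesis .
qed

lemma gal_rev: "ws \<in> lists S \<Longrightarrow> gal ws c d \<Longrightarrow> gal (rev ws) d c"
proof (induction ws arbitrary: c)
  case Nil
  then show ?case by (auto simp: gal_Nil)
next
  case (Cons s ws)
  then have s: "s \<in> S" "ws \<in> lists S" by auto
  then obtain e where e: "c \<noteq> e" "(c, e) \<in> E s" "gal ws e d" using Cons.prems(2) gal_Cons by blast
  have "gal (rev ws) d e" using Cons.IH s e by blast
  moreover have "gal [s] e c" using e s E_sym E_closed by (auto simp: gal_Cons gal_Nil)
  ultimately show ?case using gal_append[of "rev ws" "[s]"] s by auto
qed

lemma dist_inv: assumes "c \<in> C" "d \<in> C" shows "\<delta> d c = iv (\<delta> c d)"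
proof -
  obtain ws where ws: "ws \<in> lists S" "wp ws = \<delta> c d" "length ws = len (\<delta> c d)" "gal ws c d"
    using dist_galE[OF assms] by blast
  have "\<delta> d c = wp (rev ws)"
    using dist_gal[of "rev ws" d c] gal_rev ws assms dist_closed[OF assms] by (simp add: word_prod_rev)
  then show ?thesis using ws by (simp add: word_prod_rev)
qed

text \<open>If \<open>\<delta> c d \<cdot> s\<close> is longer, galleries concatenate. Otherwise a
  reduced gallery to \<open>d\<close> enters the \<open>s\<close>-panel at a chamber
  \<open>f\<close>, and \<open>e\<close> is either \<open>f\<close> itself or again at distance
  \<open>s\<close> from \<open>f\<close>.\<close>

lemma dist_step:
  assumes "c \<in> C" "s \<in> S" "(d, e) \<in> E s"
  shows "\<delta> c e = \<delta> c d \<or> \<delta> c e = \<delta> c d \<cdot> s"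
proof (cases "d = e")
  case False
  have d: "d \<in> C" "e \<in> C" using E_closed assms by auto
  have de: "\<delta> d e = s" using dist_S_iff False assms d by blast
  let ?w = "\<delta> c d"
  have wG: "?w \<in> G" using dist_closed assms d by blast
  show ?thesis
  proof (cases "s \<in> NN (iv ?w)")
    case False
    then have "len (?w \<cdot> s) = len ?w + len s" using len_mult_S(1)[OF assms(2) wG] assms by simp
    then show ?thesis using dist_mult[of c d e] de assms d by simp
  next
    case True
    then have l: "len ?w = len (?w \<cdot> s) + len s" using len_mult_S[OF assms(2) wG] assms by simp
    have ws: "?w = (?w \<cdot> s) \<cdot> s" using wG assms by (simp add: m_assoc)
    obtain f where f: "f \<in> C" "\<delta> c f = ?w \<cdot> s" "\<delta> f d = s"
      by (rule dist_split[of c d "?w \<cdot> s" s]) (use l ws assms d wG in auto)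
    have "(f, e) \<in> E s" using f dist_S_iff[of s f d] E_trans assms d by blast
    then consider "f = e" | "\<delta> f e = s" using dist_S_iff[of s f e] assms d f by blast
    then show ?thesis
    proof cases
      case 1
      then show ?thesis using f by simp
    next
      case 2
      then have "\<delta> c e = (?w \<cdot> s) \<cdot> s" using dist_mult[of c f e] f l ws assms d by simp
      then show ?thesis using ws by simp
    qed
  qed
qed simp

text \<open>The retraction from \<open>c\<close> takes a gallery to one that may stutter, so letters
  of its type are dropped and none are added.\<close>

lemma dist_fold:
  assumes "c \<in> C" "ws \<in> lists S" "gal ws d e"
  shows "\<exists>vs. set vs \<subseteq> set ws \<and> length vs \<le> length ws \<and> \<delta> c e = \<delta> c d \<cdot> wp vs"
  using assms(2,3)
proof (induction ws arbitrary: d rule: list.induct)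
  case Nil
  then show ?case using assms(1) dist_closed by (intro exI[of _ "[]"]) (auto simp: gal_Nil)
next
  case (Cons s ws)
  then have s: "s \<in> S" "ws \<in> lists S" by auto
  then obtain f where f: "(d, f) \<in> E s" "gal ws f e" using Cons.prems(2) gal_Cons by blast
  then obtain vs where vs: "set vs \<subseteq> set ws" "length vs \<le> length ws" "\<delta> c e = \<delta> c f \<cdot> wp vs"
    using Cons.IH s by blast
  have d: "d \<in> C" using E_closed s f by blast
  have dG: "\<delta> c d \<in> G" using dist_closed assms d by blast
  have vG: "wp vs \<in> G" using vs s by auto
  from dist_step[OF assms(1) s(1) f(1)] show ?case
  proof
    assume "\<delta> c f = \<delta> c d"
    then show ?thesis using vs by (intro exI[of _ vs]) auto
  next
    assume "\<delta> c f = \<delta> c d \<cdot> s"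
    then have "\<delta> c e = \<delta> c d \<cdot> wp (s # vs)" using vs dG vG s by (simp add: m_assoc)
    then show ?thesis using vs by (intro exI[of _ "s # vs"]) auto
  qed
qed

lemma dist_retract:
  assumes "c \<in> C" "d \<in> C" "e \<in> C"
  shows "len (iv (\<delta> c d) \<cdot> \<delta> c e) \<le> len (\<delta> d e)"
    and "J \<subseteq> S \<Longrightarrow> \<delta> d e \<in> par J \<Longrightarrow> iv (\<delta> c d) \<cdot> \<delta> c e \<in> par J"
proof -
  have dG: "\<delta> c d \<in> G" using dist_closed assms by blast
  have fold: "iv (\<delta> c d) \<cdot> \<delta> c e = wp vs" if "set vs \<subseteq> set ws" "ws \<in> lists S" "\<delta> c e = \<delta> c d \<cdot> wp vs" for vs ws
    using that dG by (auto simp: subset_iff)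
  obtain ws where ws: "ws \<in> lists S" "wp ws = \<delta> d e" "length ws = len (\<delta> d e)" "gal ws d e"
    using dist_galE assms by blast
  obtain vs where vs: "set vs \<subseteq> set ws" "length vs \<le> length ws" "\<delta> c e = \<delta> c d \<cdot> wp vs"
    using dist_fold[OF assms(1) ws(1,4)] by blast
  have "vs \<in> lists S" using vs ws by auto
  then show "len (iv (\<delta> c d) \<cdot> \<delta> c e) \<le> len (\<delta> d e)"
    using fold[OF vs(1) ws(1) vs(3)] len_le[of vs] vs(2) ws(3) by simp
  show "iv (\<delta> c d) \<cdot> \<delta> c e \<in> par J" if J: "J \<subseteq> S" "\<delta> d e \<in> par J"
  proof -
    obtain ws where ws: "ws \<in> lists J" "wp ws = \<delta> d e" "length ws = len (\<delta> d e)"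
      using par_reduced_word[OF J] by blast
    have wsS: "ws \<in> lists S" using ws J by auto
    then have "gal ws d e" using dist_gal[of ws d e] ws assms by simp
    then obtain vs where vs: "set vs \<subseteq> set ws" "\<delta> c e = \<delta> c d \<cdot> wp vs"
      using dist_fold[OF assms(1) wsS] by blast
    then have "vs \<in> lists J" using ws by auto
    then show ?thesis using fold[OF vs(1) wsS vs(2)] unfolding par_def by simp
  qed
qed

lemma dist_triangle:
  assumes "c \<in> C" "d \<in> C" "e \<in> C" shows "len (\<delta> c e) \<le> len (\<delta> c d) + len (\<delta> d e)"
proof -
  have G: "\<delta> c d \<in> G" "\<delta> c e \<in> G" using dist_closed assms by auto
  have "len (\<delta> c e) \<le> len (\<delta> c d) + len (iv (\<delta> c d) \<cdot> \<delta> c e)"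
    using len_mult_le[of "\<delta> c d" "iv (\<delta> c d) \<cdot> \<delta> c e"] G by simp
  then show ?thesis using dist_retract(1)[OF assms] by simp
qed

lemma len_dist_sym: "c \<in> C \<Longrightarrow> d \<in> C \<Longrightarrow> len (\<delta> d c) = len (\<delta> c d)"
  using dist_inv[of c d] dist_closed[of c d] by simp

text \<open>The last letter \<open>s\<close> of \<open>u\<close> is peeled off. Two different
  penultimate chambers would be \<open>s\<close>-adjacent, and one of them would then be at the
  longer distance \<open>v \<cdot> u1 \<cdot> s\<close> from \<open>c\<close>.\<close>

lemma dist_split_unique:
  assumes "c \<in> C" "d \<in> C" "d' \<in> C" "e \<in> C" "\<delta> c d = v" "\<delta> c d' = v" "\<delta> d e = u" "\<delta> d' e = u"
    "len (v \<cdot> u) = len v + len u"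
  shows "d = d'"
  using assms
proof (induction "len u" arbitrary: u e)
  case 0
  have "u \<in> G" using dist_closed 0 by blast
  then have "u = \<epsilon>" using 0 by simp
  then show ?case using dist_one_iff[of d e] dist_one_iff[of d' e] 0 by simp
next
  case (Suc n)
  have vG: "v \<in> G" and uG: "u \<in> G" using dist_closed Suc.prems by blast+
  obtain us where us: "us \<in> lists S" "wp us = u" "length us = len u" using len_word_ex[OF uG] by blast
  then have "us \<noteq> []" using Suc.hyps(2) by auto
  then obtain us' s where us': "us = us' @ [s]" by (metis append_butlast_last_id)
  define u1 where "u1 = wp us'"
  have s: "s \<in> S" and u1G: "u1 \<in> G" using us us' u1_def by auto
  have u: "u = u1 \<cdot> s" using us us' u1_def by auto
  have l1: "len u1 = length us'" "len (u1 \<cdot> s) = len u1 + len s"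
    using len_split[of us' "[s]"] us us' s unfolding u1_def by auto
  have ln: "n = len u1" using l1 us us' Suc.hyps(2) by simp
  obtain f where f: "f \<in> C" "\<delta> d f = u1" "\<delta> f e = s"
    by (rule dist_split[of d e u1 s]) (use Suc.prems u u1G s l1 in auto)
  obtain f' where f': "f' \<in> C" "\<delta> d' f' = u1" "\<delta> f' e = s"
    by (rule dist_split[of d' e u1 s]) (use Suc.prems u u1G s l1 in auto)
  have vus: "v \<cdot> u = (v \<cdot> u1) \<cdot> s" using u vG u1G s by (simp add: m_assoc)
  have l2: "len ((v \<cdot> u1) \<cdot> s) = len v + len u1 + 1" using vus Suc.prems(9) u l1 s by simp
  then have l3: "len (v \<cdot> u1) = len v + len u1" "len ((v \<cdot> u1) \<cdot> s) = len (v \<cdot> u1) + len s"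
    using len_mult_le[of v u1] len_mult_le[of "v \<cdot> u1" s] vG u1G s by auto
  have cf: "\<delta> c f = v \<cdot> u1" "\<delta> c f' = v \<cdot> u1"
    using dist_mult[of c d f] dist_mult[of c d' f'] f f' Suc.prems l3 by auto
  have "f = f'"
  proof (rule ccontr)
    assume ne: "f \<noteq> f'"
    have "(f, e) \<in> E s" "(f', e) \<in> E s"
      using f f' dist_S_iff[OF s _ \<open>e \<in> C\<close>] by blast+
    then have "(f, f') \<in> E s" using E_trans[OF s] E_sym[OF s] by blast
    then have "\<delta> f f' = s" using dist_S_iff[OF s] f f' ne by blast
    then have "\<delta> c f' = (v \<cdot> u1) \<cdot> s" using dist_mult[of c f f'] cf f f' l3 Suc.prems by simp
    then show False using cf l3 s by simp
  qed
  then show ?case using Suc.hyps(1)[OF ln, of f] f f' Suc.prems l3 by simp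
qed

section \<open>Existence of apartments\<close>

text \<open>A partial isometry is extended across one \<open>s\<close>-panel. If a chamber already
  reached lies beyond the panel, it dictates \<open>d\<close>, the second chamber on a reduced
  gallery from \<open>a\<close> towards it. Otherwise any second chamber of the panel will
  do.\<close>

lemma partial_apartment_step:
  assumes R: "\<And>x c. (x, c) \<in> R \<Longrightarrow> x \<in> G \<and> c \<in> C"
    "\<And>x c y d. (x, c) \<in> R \<Longrightarrow> (y, d) \<in> R \<Longrightarrow> \<delta> c d = iv x \<cdot> y"
    and xa: "(x, a) \<in> R" and s: "s \<in> S"
  obtains d where "d \<in> C" "\<And>y b. (y, b) \<in> R \<Longrightarrow> \<delta> d b = iv (x \<cdot> s) \<cdot> y"
proof -
  have x: "x \<in> G" "a \<in> C" using R(1) xa by auto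
  have up: "\<delta> d b = iv (x \<cdot> s) \<cdot> y"
    if "(y, b) \<in> R" "s \<notin> NN (iv x \<cdot> y)" "d \<in> C" "\<delta> a d = s" for y b d
  proof -
    have y: "y \<in> G" "b \<in> C" using R(1) that by auto
    have da: "\<delta> d a = s" using dist_inv[of a d] that x s by simp
    have ab: "\<delta> a b = iv x \<cdot> y" using R(2) xa that by blast
    have "len (s \<cdot> (iv x \<cdot> y)) = len s + len (iv x \<cdot> y)"
      using len_S_mult(1)[OF s, of "iv x \<cdot> y"] that x y s by simp
    then have "\<delta> d b = s \<cdot> (iv x \<cdot> y)" using dist_mult[of d a b] da ab that x y by simp
    then show ?thesis using x y s by (simp add: grp)
  qed
  show ?thesis
  proof (cases "\<exists>y b. (y, b) \<in> R \<and> s \<in> NN (iv x \<cdot> y)")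
    case False
    have "E s `` {a} \<in> C // E s" using x(2) by (rule quotientI)
    then obtain c c' where cc: "c \<in> E s `` {a}" "c' \<in> E s `` {a}" "c \<noteq> c'" using panels[OF s] by blast
    then obtain d where "(a, d) \<in> E s" "d \<noteq> a" by blast
    then have d: "d \<in> C" "\<delta> a d = s" using E_closed[OF s] dist_S_iff[OF s x(2)] by auto
    show ?thesis by (rule that[OF d(1)]) (use up False d in blast)
  next
    case True
    then obtain x1 b1 where b1: "(x1, b1) \<in> R" "s \<in> NN (iv x \<cdot> x1)" by blast
    define u1 where "u1 = iv x \<cdot> x1"
    have x1: "x1 \<in> G" "b1 \<in> C" using R(1) b1 by auto
    have u1: "u1 \<in> G" "\<delta> a b1 = u1" "s \<in> NN u1" using x x1 R(2)[OF xa b1(1)] b1 u1_def by auto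
    have "len u1 = len s + len (s \<cdot> u1)" using len_S_mult[OF s u1(1)] u1 s by simp
    then obtain d where d: "d \<in> C" "\<delta> a d = s" "\<delta> d b1 = s \<cdot> u1"
      using dist_split[of a b1 s "s \<cdot> u1"] x x1 u1 s by auto
    show ?thesis
    proof (rule that[OF d(1)])
      fix y b assume yb: "(y, b) \<in> R"
      have y: "y \<in> G" "b \<in> C" using R(1) yb by auto
      define u where "u = iv x \<cdot> y"
      have u: "u \<in> G" "\<delta> a b = u" using x y R(2)[OF xa yb] u_def by auto
      show "\<delta> d b = iv (x \<cdot> s) \<cdot> y"
      proof (cases "s \<in> NN u")
        case False
        then show ?thesis using up[OF yb _ d(1,2)] u_def by blast
      next
        case True
        have "(a, d) \<in> E s" using d dist_S_iff[OF s x(2) d(1)] by blast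
        from dist_step[OF y(2) s this] have "\<delta> b d = iv u \<or> \<delta> b d = iv u \<cdot> s"
          using dist_inv[of a b] x y u by simp
        then have "\<delta> d b = u \<or> \<delta> d b = s \<cdot> u"
          using dist_inv[of b d] y d u s by (auto simp: grp)
        moreover have "\<delta> d b \<noteq> u"
        proof
          \<comment> \<open>Seen from \<open>a\<close>, the chambers \<open>b1\<close> and
            \<open>b\<close> are on the same side of the wall of \<open>s\<close>; seen from
            \<open>d\<close> they would be on different sides, and the retraction from
            \<open>d\<close> would increase their distance.\<close>
          assume db: "\<delta> d b = u"
          let ?t = "iv u1 \<cdot> u"
          have "\<delta> b1 b = iv x1 \<cdot> y" using R(2) b1 yb by blast
          then have bb: "\<delta> b1 b = ?t" unfolding u1_def u_def using x x1 y by (simp add: grp)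
          have "len (iv (s \<cdot> u1) \<cdot> u) \<le> len ?t"
            using dist_retract(1)[OF d(1) x1(2) y(2)] d(3) db bb by simp
          moreover have "iv (s \<cdot> u1) \<cdot> u = (iv u1 \<cdot> s \<cdot> u1) \<cdot> ?t" using u1 u s by (simp add: grp)
          moreover have "iv u1 \<cdot> s \<cdot> u1 \<notin> NN ?t"
            using NN_mult[of u1 ?t s] u1 u s True by simp
          moreover have "iv u1 \<cdot> s \<cdot> u1 \<in> refls" using refls_conj'[OF S_refls[OF s] u1(1)] .
          ultimately show False using not_NN_less[of "iv u1 \<cdot> s \<cdot> u1" ?t] u1 u by simp
        qed
        ultimately show ?thesis using u_def x y s by (simp add: grp)
      qed
    qed
  qed
qed

text \<open>Partial isometries are handled as relations, so that the union of a chain is immediately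
  one of them. A maximal one is closed under right multiplication by generators, hence defined
  everywhere.\<close>

theorem apartment_exists:
  obtains f where "f \<in> G \<rightarrow> C" "\<And>v w. v \<in> G \<Longrightarrow> w \<in> G \<Longrightarrow> \<delta> (f v) (f w) = cox_dist W v w"
proof -
  obtain c0 where c0: "c0 \<in> C" using nonempty by blast
  define isom where "isom = (\<lambda>R. R \<subseteq> G \<times> C \<and> (\<forall>x c y d. (x, c) \<in> R \<longrightarrow> (y, d) \<in> R \<longrightarrow> \<delta> c d = iv x \<cdot> y))"
  define P where "P = {R. isom R \<and> (\<epsilon>, c0) \<in> R}"
  have "{(\<epsilon>, c0)} \<in> P" unfolding P_def isom_def using c0 by simp
  then have "P \<noteq> {}" by blast
  moreover have "\<Union>\<C> \<in> P" if "\<C> \<noteq> {}" "subset.chain P \<C>" for \<C>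
  proof -
    have sub: "\<C> \<subseteq> P" and tot: "\<And>A B. A \<in> \<C> \<Longrightarrow> B \<in> \<C> \<Longrightarrow> A \<subseteq> B \<or> B \<subseteq> A"
      using that(2) unfolding subset.chain_def by blast+
    have "\<delta> c d = iv x \<cdot> y" if xy: "(x, c) \<in> \<Union>\<C>" "(y, d) \<in> \<Union>\<C>" for x c y d
    proof -
      obtain A B where AB: "A \<in> \<C>" "(x, c) \<in> A" "B \<in> \<C>" "(y, d) \<in> B" using xy by blast
      then obtain K where K: "K \<in> \<C>" "(x, c) \<in> K" "(y, d) \<in> K" using tot[of A B] by blast
      then have "isom K" using sub unfolding P_def by blast
      then show ?thesis using K unfolding isom_def by blast
    qed
    moreover have "\<Union>\<C> \<subseteq> G \<times> C" using sub unfolding P_def isom_def by blast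
    moreover have "(\<epsilon>, c0) \<in> \<Union>\<C>" using that(1) sub unfolding P_def by blast
    ultimately show ?thesis unfolding P_def isom_def by blast
  qed
  ultimately have "\<exists>M\<in>P. \<forall>X\<in>P. M \<subseteq> X \<longrightarrow> X = M" by (rule subset_Zorn_nonempty)
  then obtain M where M: "M \<in> P" "\<And>X. X \<in> P \<Longrightarrow> M \<subseteq> X \<Longrightarrow> X = M" by blast
  have M1: "\<And>x c. (x, c) \<in> M \<Longrightarrow> x \<in> G \<and> c \<in> C"
    and M2: "\<And>x c y d. (x, c) \<in> M \<Longrightarrow> (y, d) \<in> M \<Longrightarrow> \<delta> c d = iv x \<cdot> y"
    using M(1) unfolding P_def isom_def by blast+
  have step: "\<exists>d. (x \<cdot> s, d) \<in> M" if xa: "(x, a) \<in> M" "s \<in> S" for x a s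
  proof -
    have xG: "x \<in> G" using M1 xa by blast
    obtain d where d: "d \<in> C" "\<And>y b. (y, b) \<in> M \<Longrightarrow> \<delta> d b = iv (x \<cdot> s) \<cdot> y"
      using partial_apartment_step[OF M1 M2 xa] by metis
    have d': "\<delta> b d = iv y \<cdot> (x \<cdot> s)" if yb: "(y, b) \<in> M" for y b
    proof -
      have "y \<in> G" "b \<in> C" using M1 yb by auto
      then show ?thesis using dist_inv[of d b] d(1) d(2)[OF yb] xG xa(2) by (simp add: inv_mult_group)
    qed
    have "isom (insert (x \<cdot> s, d) M)"
      unfolding isom_def
    proof (intro conjI allI impI)
      show "insert (x \<cdot> s, d) M \<subseteq> G \<times> C" using M1 d(1) xG xa(2) by auto
      fix y b z c assume "(y, b) \<in> insert (x \<cdot> s, d) M" "(z, c) \<in> insert (x \<cdot> s, d) M"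
      then show "\<delta> b c = iv y \<cdot> z" using M2[of y b z c] d(2)[of z c] d'[of y b] d(1) xG xa(2) by auto
    qed
    then have "insert (x \<cdot> s, d) M \<in> P" using M(1) unfolding P_def by blast
    then have "insert (x \<cdot> s, d) M = M" using M(2) by blast
    then show ?thesis by blast
  qed
  have all: "\<exists>a. (wp ws, a) \<in> M" if "ws \<in> lists S" for ws
    using that
  proof (induction ws rule: rev_induct)
    case Nil
    then show ?case using M(1) unfolding P_def by auto
  next
    case (snoc s ws)
    then have "ws \<in> lists S" "s \<in> S" by auto
    then show ?case using snoc.IH step by (auto simp: r_one)
  qed
  have "\<forall>w\<in>G. \<exists>a. (w, a) \<in> M" using all word_ex by blast
  from bchoice[OF this] obtain f where f: "\<forall>w\<in>G. (w, f w) \<in> M" by blast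
  show ?thesis
  proof (rule that)
    show "f \<in> G \<rightarrow> C" using f M1 by auto
    show "\<delta> (f v) (f w) = cox_dist W v w" if "v \<in> G" "w \<in> G" for v w
      unfolding cox_dist_def using f M2 that by blast
  qed
qed

lemma apartment_isometric:
  assumes "apartment W C \<delta> A"
  shows "isometric A (gallery_dist W S \<delta>) G (gallery_dist W S (cox_dist W))"
proof -
  obtain f where f: "f \<in> G \<rightarrow> C" "\<forall>v\<in>G. \<forall>w\<in>G. \<delta> (f v) (f w) = cox_dist W v w" "A = f ` G"
    using assms unfolding apartment_def by blast
  have inj: "inj_on f G"
  proof (rule inj_onI)
    fix x y assume xy: "x \<in> G" "y \<in> G" "f x = f y"
    have "f y \<in> C" using f(1) xy by auto
    moreover have "\<delta> (f x) (f y) = iv x \<cdot> y" using f(2) xy unfolding cox_dist_def by blast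
    ultimately have "iv x \<cdot> y = \<epsilon>" using xy by simp
    then have "x \<cdot> (iv x \<cdot> y) = x" using xy by simp
    then show "x = y" using xy by simp
  qed
  define g where "g = inv_into G f"
  have g: "bij_betw g A G" unfolding g_def f(3) by (rule bij_betw_inv_into) (simp add: inj bij_betw_def)
  show ?thesis unfolding isometric_def
  proof (intro exI conjI ballI)
    show "bij_betw g A G" by (rule g)
    fix x y assume xy: "x \<in> A" "y \<in> A"
    then have "g x \<in> G" "g y \<in> G" "f (g x) = x" "f (g y) = y"
      unfolding g_def f(3) by (auto intro: inv_into_into f_inv_into_f)
    then show "gallery_dist W S (cox_dist W) (g x) (g y) = gallery_dist W S \<delta> x y"
      using f(2) unfolding gallery_dist_def by metis
  qed
qed

end

section \<open>Asymptotic dimension of buildings\<close>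

context coxeter_system begin

text \<open>The ball of radius \<open>R\<close> around \<open>w\<close> consists of elements that
  have \<open>v\<close> as an initial part of a reduced expression; \<open>R'\<close> bounds the
  distance from the centre to the apex.\<close>

definition cone_apex :: "nat \<Rightarrow> nat \<Rightarrow> 'w \<Rightarrow> 'w \<Rightarrow> bool" where
  "cone_apex R R' w v \<longleftrightarrow> w \<in> G \<and> v \<in> G \<and> len (iv v \<cdot> w) \<le> R' \<and>
     (\<forall>x\<in>G. len (iv w \<cdot> x) \<le> R \<longrightarrow> len x = len v + len (iv v \<cdot> x))"

lemma cone_apexD:
  assumes "cone_apex R R' w v"
  shows "w \<in> G" "v \<in> G" "len (iv v \<cdot> w) \<le> R'"
    "x \<in> G \<Longrightarrow> len (iv w \<cdot> x) \<le> R \<Longrightarrow> len x = len v + len (iv v \<cdot> x)"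
  using assms unfolding cone_apex_def by blast+

lemma cone_apex_exists:
  assumes "finite S" obtains R' where "\<And>w. w \<in> G \<Longrightarrow> \<exists>v. cone_apex R R' w v"
proof -
  obtain R' where R': "\<And>w. w \<in> G \<Longrightarrow> \<exists>b\<in>G. len b \<le> R' \<and>
    (\<forall>y\<in>G. len y \<le> R \<longrightarrow> len (w \<cdot> y) = len (w \<cdot> b) + len (iv b \<cdot> y))"
    using ball_in_cone[OF assms, of R] by metis
  have "\<exists>v. cone_apex R R' w v" if w: "w \<in> G" for w
  proof -
    obtain b where b: "b \<in> G" "len b \<le> R'"
      "\<forall>y\<in>G. len y \<le> R \<longrightarrow> len (w \<cdot> y) = len (w \<cdot> b) + len (iv b \<cdot> y)" using R'[OF w] by blast
    have "len x = len (w \<cdot> b) + len (iv (w \<cdot> b) \<cdot> x)" if "x \<in> G" "len (iv w \<cdot> x) \<le> R" for x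
    proof -
      have "len (w \<cdot> (iv w \<cdot> x)) = len (w \<cdot> b) + len (iv b \<cdot> (iv w \<cdot> x))"
        using b(3)[rule_format, of "iv w \<cdot> x"] that w by simp
      then show ?thesis using w b(1) that by (simp add: grp)
    qed
    moreover have "len (iv (w \<cdot> b) \<cdot> w) \<le> R'" using w b(1,2) by (simp add: grp)
    moreover have "w \<cdot> b \<in> G" using w b(1) by simp
    ultimately have "cone_apex R R' w (w \<cdot> b)" unfolding cone_apex_def using w by blast
    then show ?thesis by blast
  qed
  then show ?thesis by (rule that)
qed

end

context building begin

text \<open>When lengths add, this says that some minimal gallery from \<open>c0\<close> to
  \<open>c\<close> runs through \<open>q\<close>, over the element \<open>v\<close>.\<close>

definition passes :: "'c \<Rightarrow> 'w \<Rightarrow> 'c \<Rightarrow> 'c \<Rightarrow> bool" where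
  "passes c0 v q c \<longleftrightarrow> q \<in> C \<and> c \<in> C \<and> \<delta> c0 q = v \<and> \<delta> q c = iv v \<cdot> \<delta> c0 c"

text \<open>The step is viewed from \<open>q\<close>, which leaves two candidates for
  \<open>\<delta> q f\<close>. For either of them the cone condition makes lengths add, so the
  distance from \<open>c0\<close> still factors through \<open>q\<close>.\<close>

lemma passes_step:
  assumes "c0 \<in> C" "v \<in> G" "s \<in> S" "(c, f) \<in> E s" "passes c0 v q c"
    and cone: "\<And>x. x = \<delta> c0 c \<or> x = \<delta> c0 c \<cdot> s \<Longrightarrow> len x = len v + len (iv v \<cdot> x)"
  shows "passes c0 v q f"
proof -
  have cf: "c \<in> C" "f \<in> C" using E_closed assms by auto
  have q: "q \<in> C" "\<delta> c0 q = v" "\<delta> q c = iv v \<cdot> \<delta> c0 c" using assms(5) unfolding passes_def by auto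
  have cG: "\<delta> c0 c \<in> G" using dist_closed assms cf by blast
  define z where "z = \<delta> q f"
  have zG: "z \<in> G" unfolding z_def using dist_closed q cf by blast
  have "z = iv v \<cdot> \<delta> c0 c \<or> z = iv v \<cdot> \<delta> c0 c \<cdot> s"
    unfolding z_def using dist_step[OF q(1) assms(3,4)] q(3) by simp
  then have "v \<cdot> z = \<delta> c0 c \<or> v \<cdot> z = \<delta> c0 c \<cdot> s"
    using assms cG by (auto simp: m_assoc)
  from cone[OF this] have "len (v \<cdot> z) = len v + len z" using assms(2) zG by simp
  then have "\<delta> c0 f = v \<cdot> z" using dist_mult[of c0 q f] assms(1) q cf z_def by simp
  then show ?thesis unfolding passes_def using q cf z_def zG assms(2) by simp
qed

text \<open>This replaces a projection: all chambers of a gallery that stays over the cone are reached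
  from \<open>c0\<close> through the same chamber \<open>q\<close> over the apex \<open>v\<close>.\<close>

lemma passes_gallery:
  assumes "c0 \<in> C" "cone_apex R R' w v" "ws \<in> lists S" "gal ws c e" "passes c0 v q c"
    "len (iv w \<cdot> \<delta> c0 c) + length ws \<le> R"
  shows "passes c0 v q e"
  using assms(3-)
proof (induction ws arbitrary: c rule: list.induct)
  case Nil
  then show ?case by (simp add: gal_Nil)
next
  case (Cons s ws)
  have s: "s \<in> S" "ws \<in> lists S" using Cons.prems by auto
  have wv: "w \<in> G" "v \<in> G" using cone_apexD(1,2)[OF assms(2)] by auto
  obtain f where f: "(c, f) \<in> E s" "gal ws f e" using Cons.prems(2) gal_Cons[OF s(1)] by blast
  have cf: "c \<in> C" "f \<in> C" using E_closed[OF s(1) f(1)] by auto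
  have cG: "\<delta> c0 c \<in> G" using dist_closed assms(1) cf by blast
  have "len (iv w \<cdot> \<delta> c0 c \<cdot> s) \<le> len (iv w \<cdot> \<delta> c0 c) + 1"
    using len_mult_le[of "iv w \<cdot> \<delta> c0 c" s] wv cG s(1) by simp
  then have "len (iv w \<cdot> (\<delta> c0 c \<cdot> s)) \<le> len (iv w \<cdot> \<delta> c0 c) + 1"
    using m_assoc[of "iv w" "\<delta> c0 c" s] wv cG s(1) by simp
  note right = this
  have near: "len (iv w \<cdot> x) \<le> len (iv w \<cdot> \<delta> c0 c) + 1" "x \<in> G"
    if "x = \<delta> c0 c \<or> x = \<delta> c0 c \<cdot> s" for x
  proof -
    show "len (iv w \<cdot> x) \<le> len (iv w \<cdot> \<delta> c0 c) + 1"
      using that right le_add1[of "len (iv w \<cdot> \<delta> c0 c)" 1] by blast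
    show "x \<in> G" using that cG m_closed[OF cG S_closed[OF s(1)]] by blast
  qed
  have "passes c0 v q f"
  proof (rule passes_step[OF assms(1) wv(2) s(1) f(1) Cons.prems(3)])
    fix x assume x: "x = \<delta> c0 c \<or> x = \<delta> c0 c \<cdot> s"
    have "len (iv w \<cdot> x) \<le> R" using near(1)[OF x] Cons.prems(4) by simp
    then show "len x = len v + len (iv v \<cdot> x)" by (rule cone_apexD(4)[OF assms(2) near(2)[OF x]])
  qed
  moreover have "len (iv w \<cdot> \<delta> c0 f) + length ws \<le> R"
    using near(1)[OF dist_step[OF assms(1) s(1) f(1)]] Cons.prems(4) by simp
  ultimately show ?case by (rule Cons.IH[OF s(2) f(2)])
qed

lemma passes_exists:
  assumes "c0 \<in> C" "c \<in> C" "v \<in> G" "len (\<delta> c0 c) = len v + len (iv v \<cdot> \<delta> c0 c)"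
  obtains q where "passes c0 v q c"
proof -
  have cG: "\<delta> c0 c \<in> G" using dist_closed assms by blast
  obtain q where "q \<in> C" "\<delta> c0 q = v" "\<delta> q c = iv v \<cdot> \<delta> c0 c"
    by (rule dist_split[of c0 c v "iv v \<cdot> \<delta> c0 c"]) (use assms cG in auto)
  then show ?thesis using that assms unfolding passes_def by blast
qed

lemma passes_unique:
  assumes "c0 \<in> C" "v \<in> G" "len (\<delta> c0 c) = len v + len (iv v \<cdot> \<delta> c0 c)"
    "passes c0 v q c" "passes c0 v q' c"
  shows "q = q'"
proof -
  have c: "q \<in> C" "q' \<in> C" "c \<in> C" "\<delta> c0 q = v" "\<delta> c0 q' = v"
    "\<delta> q c = iv v \<cdot> \<delta> c0 c" "\<delta> q' c = iv v \<cdot> \<delta> c0 c"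
    using assms(4,5) unfolding passes_def by auto
  have "\<delta> c0 c \<in> G" using dist_closed assms c by blast
  then have "len (v \<cdot> (iv v \<cdot> \<delta> c0 c)) = len v + len (iv v \<cdot> \<delta> c0 c)" using assms by simp
  from dist_split_unique[OF assms(1) c(1,2,3,4,5,6,7) this] show ?thesis .
qed

lemma asdim_le_building:
  assumes S: "finite S" and W: "asdim_le G (gallery_dist W S (cox_dist W)) n"
  shows "asdim_le C (gallery_dist W S \<delta>) n"
  unfolding asdim_le_iff_coloured_cover
proof (intro allI impI)
  fix r :: real assume "r > 0"
  let ?d = "gallery_dist W S (cox_dist W)"
  obtain \<U> D where U: "coloured_cover {..n} G ?d r \<U> D"
    using W \<open>r > 0\<close> unfolding asdim_le_iff_coloured_cover by blast
  have len_U: "real (len (iv x \<cdot> y)) \<le> D" if "i \<in> {..n}" "B \<in> \<U> i" "x \<in> B" "y \<in> B" for i B x y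
    using coloured_coverD(3)[OF U that] unfolding gallery_dist_def cox_dist_def .
  \<comment> \<open>A ball of this radius around a point of a piece contains the piece, of diameter
    at most \<open>D\<close>, and what lies under a gallery of length below \<open>r\<close> that
    starts over it.\<close>
  define R where "R = nat \<lceil>D\<rceil> + nat \<lceil>r\<rceil>"
  obtain R' where R': "\<And>w. w \<in> G \<Longrightarrow> \<exists>v. cone_apex R R' w v"
    using cone_apex_exists[OF S, of R] by metis
  have "\<exists>wv. B \<noteq> {} \<longrightarrow> fst wv \<in> B \<and> cone_apex R R' (fst wv) (snd wv)" if BG: "B \<subseteq> G" for B
  proof (cases "B = {}")
    case False
    then obtain w where w: "w \<in> B" by blast
    have "w \<in> G" using w BG by blast
    then obtain v where "cone_apex R R' w v" using R' by blast
    then show ?thesis using w by (intro exI[of _ "(w, v)"]) simp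
  qed simp
  then have "\<forall>B\<in>Pow G. \<exists>wv. B \<noteq> {} \<longrightarrow> fst wv \<in> B \<and> cone_apex R R' (fst wv) (snd wv)" by simp
  from bchoice[OF this] obtain wv where
    wv: "\<forall>B\<in>Pow G. B \<noteq> {} \<longrightarrow> fst (wv B) \<in> B \<and> cone_apex R R' (fst (wv B)) (snd (wv B))" ..
  define w where "w = (\<lambda>B. fst (wv B))"
  define v where "v = (\<lambda>B. snd (wv B))"
  have apex: "w B \<in> B" "cone_apex R R' (w B) (v B)" if "i \<in> {..n}" "B \<in> \<U> i" "x \<in> B" for i B x
  proof -
    have "B \<subseteq> G" "B \<noteq> {}" using coloured_coverD(2)[OF U that(1,2)] that(3) by auto
    then show "w B \<in> B" "cone_apex R R' (w B) (v B)" using wv unfolding w_def v_def by auto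
  qed
  obtain c0 where c0: "c0 \<in> C" using nonempty by auto
  have cG: "\<delta> c0 c \<in> G" if "c \<in> C" for c using dist_closed[OF c0 that] .
  have near: "len (iv (w B) \<cdot> \<delta> c0 c) \<le> nat \<lceil>D\<rceil>" if "i \<in> {..n}" "B \<in> \<U> i" "\<delta> c0 c \<in> B" for i B c
    using len_U[OF that(1,2) apex(1)[OF that] that(3)] by linarith
  have cone: "len (\<delta> c0 c) = len (v B) + len (iv (v B) \<cdot> \<delta> c0 c)"
    if "i \<in> {..n}" "B \<in> \<U> i" "\<delta> c0 c \<in> B" "c \<in> C" for i B c
    using cone_apexD(4)[OF apex(2)[OF that(1-3)] cG[OF that(4)]] near[OF that(1-3)] R_def by simp
  \<comment> \<open>The preimage of \<open>B\<close> is split according to the chamber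
    \<open>q\<close> over the apex; all these parts go into the family of \<open>B\<close>, so the
    number of families does not grow.\<close>
  define V where "V = (\<lambda>B q. {c \<in> C. \<delta> c0 c \<in> B \<and> passes c0 (v B) q c})"
  define \<V> where "\<V> = (\<lambda>i. (\<lambda>(B, q). V B q) ` (\<U> i \<times> C))"
  have \<V>: "\<exists>B q. B \<in> \<U> i \<and> A = V B q" if "A \<in> \<V> i" for A i using that unfolding \<V>_def by auto
  have "coloured_cover {..n} C (gallery_dist W S \<delta>) r \<V> (2 * (real R' + real (nat \<lceil>D\<rceil>)))"
  proof (rule coloured_coverI)
    fix c assume c: "c \<in> C"
    obtain i B where i: "i \<in> {..n}" "B \<in> \<U> i" "\<delta> c0 c \<in> B"
      using coloured_coverD(1)[OF U cG[OF c]] by auto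
    obtain q where q: "passes c0 (v B) q c"
      by (rule passes_exists[OF c0 c cone_apexD(2)[OF apex(2)[OF i]] cone[OF i c]])
    then have "c \<in> V B q" "q \<in> C" using c i unfolding V_def passes_def by auto
    moreover from this have "V B q \<in> \<V> i" unfolding \<V>_def using i(2) by force
    ultimately show "\<exists>p\<in>{..n}. \<exists>A\<in>\<V> p. c \<in> A" using i(1) by metis
  next
    fix i A assume "A \<in> \<V> i"
    then show "A \<subseteq> C" using \<V> unfolding V_def by fastforce
  next
    fix i A c e assume i: "i \<in> {..n}" and A: "A \<in> \<V> i" "c \<in> A" "e \<in> A"
    obtain B q where B: "B \<in> \<U> i" "A = V B q" using \<V>[OF A(1)] by metis
    have bound: "len (\<delta> q x) \<le> R' + nat \<lceil>D\<rceil>" "q \<in> C" "x \<in> C" if "x \<in> A" for x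
    proof -
      have x: "x \<in> C" "\<delta> c0 x \<in> B" "passes c0 (v B) q x" using that unfolding B V_def by auto
      note ap = cone_apexD[OF apex(2)[OF i B(1) x(2)]]
      have eq: "\<delta> q x = iv (v B) \<cdot> \<delta> c0 x" and q: "q \<in> C" using x(3) unfolding passes_def by auto
      have "iv (v B) \<cdot> \<delta> c0 x = (iv (v B) \<cdot> w B) \<cdot> (iv (w B) \<cdot> \<delta> c0 x)"
        using ap(1,2) cG[OF x(1)] by (simp add: m_assoc)
      then have "len (\<delta> q x) \<le> len (iv (v B) \<cdot> w B) + len (iv (w B) \<cdot> \<delta> c0 x)"
        unfolding eq using len_mult_le[of "iv (v B) \<cdot> w B" "iv (w B) \<cdot> \<delta> c0 x"] ap(1,2) cG[OF x(1)] by simp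
      then show "len (\<delta> q x) \<le> R' + nat \<lceil>D\<rceil>" using ap(3) near[OF i B(1) x(2)] by linarith
      show "q \<in> C" "x \<in> C" by (fact q, fact x(1))
    qed
    note bc = bound[OF A(2)] and be = bound[OF A(3)]
    have "len (\<delta> c e) \<le> len (\<delta> q c) + len (\<delta> q e)"
      using dist_triangle[OF bc(3,2) be(3)] len_dist_sym[OF bc(2,3)] by simp
    also have "\<dots> \<le> (R' + nat \<lceil>D\<rceil>) + (R' + nat \<lceil>D\<rceil>)" by (rule add_mono[OF bc(1) be(1)])
    finally have "len (\<delta> c e) \<le> 2 * (R' + nat \<lceil>D\<rceil>)" by (simp only: mult_2)
    then have "real (len (\<delta> c e)) \<le> real (2 * (R' + nat \<lceil>D\<rceil>))" by (simp only: of_nat_le_iff)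
    then show "gallery_dist W S \<delta> c e \<le> 2 * (real R' + real (nat \<lceil>D\<rceil>))"
      unfolding gallery_dist_def by simp
  next
    fix i A A' c e assume i: "i \<in> {..n}" and A: "A \<in> \<V> i" "A' \<in> \<V> i" "A \<noteq> A'" "c \<in> A" "e \<in> A'"
    obtain B q where B: "B \<in> \<U> i" "A = V B q" using \<V>[OF A(1)] by metis
    obtain B' q' where B': "B' \<in> \<U> i" "A' = V B' q'" using \<V>[OF A(2)] by metis
    have c: "c \<in> C" "\<delta> c0 c \<in> B" "passes c0 (v B) q c" using A(4) unfolding B V_def by auto
    have e: "e \<in> C" "\<delta> c0 e \<in> B'" "passes c0 (v B') q' e" using A(5) unfolding B' V_def by auto
    show "r \<le> gallery_dist W S \<delta> c e"
    proof (rule ccontr)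
      assume "\<not> r \<le> gallery_dist W S \<delta> c e"
      then have lt: "real (len (\<delta> c e)) < r" unfolding gallery_dist_def by simp
      have "len (iv (\<delta> c0 c) \<cdot> \<delta> c0 e) \<le> len (\<delta> c e)" by (rule dist_retract(1)[OF c0 c(1) e(1)])
      then have "\<not> r \<le> ?d (\<delta> c0 c) (\<delta> c0 e)" using lt unfolding gallery_dist_def cox_dist_def by linarith
      then have BB: "B = B'" using coloured_coverD(4)[OF U i B(1) B'(1) _ c(2) e(2)] by metis
      have ap: "cone_apex R R' (w B) (v B)" by (rule apex(2)[OF i B(1) c(2)])
      obtain ws where ws: "ws \<in> lists S" "length ws = len (\<delta> c e)" "gal ws c e"
        using dist_galE[OF c(1) e(1)] by metis
      have "len (iv (w B) \<cdot> \<delta> c0 c) + length ws \<le> R"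
        using near[OF i B(1) c(2)] ws(2) lt unfolding R_def by linarith
      then have Qe: "passes c0 (v B) q e" by (rule passes_gallery[OF c0 ap ws(1,3) c(3)])
      have eB: "\<delta> c0 e \<in> B" using e(2) BB by simp
      have "q = q'"
        by (rule passes_unique[OF c0 cone_apexD(2)[OF ap] cone[OF i B(1) eB e(1)] Qe])
          (use e(3) BB in simp)
      then show False using A(3) B(2) B'(2) BB by simp
    qed
  qed
  then show "\<exists>\<U> D. coloured_cover {..n} C (gallery_dist W S \<delta>) r \<U> D" by blast
qed

lemma asdim_le_building_iff:
  assumes "finite S"
  shows "asdim_le C (gallery_dist W S \<delta>) n \<longleftrightarrow> asdim_le G (gallery_dist W S (cox_dist W)) n"
proof
  assume C: "asdim_le C (gallery_dist W S \<delta>) n"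
  obtain f where f: "f \<in> G \<rightarrow> C" "\<And>v w. v \<in> G \<Longrightarrow> w \<in> G \<Longrightarrow> \<delta> (f v) (f w) = cox_dist W v w"
    using apartment_exists by metis
  show "asdim_le G (gallery_dist W S (cox_dist W)) n"
  proof (rule asdim_le_isometric_embedding[OF C])
    show "f v \<in> C" if "v \<in> G" for v using f(1) that by auto
    show "gallery_dist W S \<delta> (f v) (f w) = gallery_dist W S (cox_dist W) v w" if "v \<in> G" "w \<in> G" for v w
      unfolding gallery_dist_def f(2)[OF that] ..
  qed
qed (rule asdim_le_building[OF assms])

end

section \<open>The piecewise Euclidean metric\<close>

context coxeter_system begin

section \<open>Positive definiteness of the canonical form for finite parabolic subgroups\<close>

lemma cox_form_sym: assumes "T \<subseteq> S" shows "cox_form W T u v = cox_form W T v u"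
proof -
  have "cox_form W T u v = (\<Sum>s\<in>T. \<Sum>t\<in>T. BB s t * u s * v t)" unfolding cox_form_def BB_def ..
  also have "\<dots> = (\<Sum>t\<in>T. \<Sum>s\<in>T. BB s t * u s * v t)" by (rule sum.swap)
  also have "\<dots> = (\<Sum>t\<in>T. \<Sum>s\<in>T. BB t s * v t * u s)"
    using assms by (intro sum.cong HOL.refl) (auto simp: BB_sym subset_iff)
  finally show ?thesis unfolding cox_form_def BB_def .
qed

lemma cox_form_lincomb:
  "cox_form W T u (\<lambda>r. a * v r + b * w r) = a * cox_form W T u v + b * cox_form W T u w"
  unfolding cox_form_bil bil_lincomb by (simp add: sum.distrib sum_distrib_left algebra_simps)

context
  fixes T assumes S: "finite S" and T: "T \<subseteq> S" "finite (par T)"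
begin

text \<open>Averaging the standard inner product over the finite group \<open>par T\<close> makes it
  invariant; the canonical form is then compared with it.\<close>

definition avg_ip :: "('w \<Rightarrow> real) \<Rightarrow> ('w \<Rightarrow> real) \<Rightarrow> real" where
  "avg_ip u v = (\<Sum>g\<in>par T. \<Sum>t\<in>S. ract g u t * ract g v t)"

lemma par_G: "g \<in> par T \<Longrightarrow> g \<in> G"
  using par_closed[OF T(1)] .

lemma avg_ip_sym: "avg_ip u v = avg_ip v u"
  unfolding avg_ip_def by (simp add: mult.commute)

lemma avg_ip_lincomb: "avg_ip u (\<lambda>r. \<Sum>y\<in>Y. c y * f y r) = (\<Sum>y\<in>Y. c y * avg_ip u (f y))"
proof -
  have "avg_ip u (\<lambda>r. \<Sum>y\<in>Y. c y * f y r) =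
    (\<Sum>g\<in>par T. \<Sum>t\<in>S. \<Sum>y\<in>Y. c y * (ract g u t * ract g (f y) t))"
    unfolding avg_ip_def
    by (intro sum.cong HOL.refl) (simp add: ract_lincomb[OF S par_G] sum_distrib_left algebra_simps)
  also have "\<dots> = (\<Sum>g\<in>par T. \<Sum>y\<in>Y. \<Sum>t\<in>S. c y * (ract g u t * ract g (f y) t))"
    by (intro sum.cong HOL.refl sum.swap)
  also have "\<dots> = (\<Sum>y\<in>Y. \<Sum>g\<in>par T. \<Sum>t\<in>S. c y * (ract g u t * ract g (f y) t))"
    by (rule sum.swap)
  finally show ?thesis unfolding avg_ip_def by (simp add: sum_distrib_left)
qed

lemma avg_ip_invariant:
  assumes "h \<in> par T" shows "avg_ip (ract h u) (ract h v) = avg_ip u v"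
proof -
  have hG: "h \<in> G" using assms par_G by blast
  have "avg_ip (ract h u) (ract h v) = (\<Sum>g\<in>par T. \<Sum>t\<in>S. ract (g \<cdot> h) u t * ract (g \<cdot> h) v t)"
    unfolding avg_ip_def by (intro sum.cong HOL.refl) (simp add: ract_mult[OF S par_G hG])
  also have "\<dots> = avg_ip u v"
    unfolding avg_ip_def
  proof (rule sum.reindex_bij_witness[where i = "\<lambda>g. g \<cdot> iv h" and j = "\<lambda>g. g \<cdot> h"])
    fix g assume g: "g \<in> par T"
    then have gG: "g \<in> G" using par_G by blast
    show "(g \<cdot> h) \<cdot> iv h = g" "(g \<cdot> iv h) \<cdot> h = g" using gG hG by (simp_all add: m_assoc)
    show "g \<cdot> h \<in> par T" "g \<cdot> iv h \<in> par T"
      using par_mult[OF T(1)] par_inv[OF T(1)] assms g by simp_all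
  qed simp
  finally show ?thesis .
qed

lemma ract_S: "s \<in> S \<Longrightarrow> ract s v = (\<lambda>t. v t - 2 * bil S s v * root_vec s t)"
  using ract_word[OF S, of "[s]" v] cox_refl_bil[OF S] by simp

lemma avg_ip_diff: "avg_ip u (\<lambda>t. x t - c * y t) = avg_ip u x - c * avg_ip u y"
proof -
  have 1: "(\<lambda>t. x t - c * y t) = (\<lambda>r. \<Sum>b\<in>{0, 1::nat}. (if b = 0 then 1 else - c) * (if b = 0 then x else y) r)"
    by (simp add: fun_eq_iff)
  have 2: "(\<Sum>b\<in>{0, 1::nat}. (if b = 0 then 1 else - c) * avg_ip u (if b = 0 then x else y)) =
      avg_ip u x - c * avg_ip u y" by simp
  show ?thesis unfolding 1 avg_ip_lincomb 2 ..
qed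

lemma avg_ip_zero: "avg_ip u (\<lambda>_. 0) = 0"
  using avg_ip_lincomb[of u _ _ "{}"] by simp

text \<open>Since \<open>s\<close> negates its root, invariance gives
  \<open>avg_ip e v = - avg_ip e (ract s v)\<close> for the root \<open>e\<close>; expanding the
  reflection brings in the canonical form.\<close>

lemma avg_ip_root:
  assumes s: "s \<in> T"
  shows "avg_ip (root_vec s) v = avg_ip (root_vec s) (root_vec s) * bil S s v"
proof -
  let ?e = "root_vec s"
  have sS: "s \<in> S" using s T by auto
  have "ract s ?e = (\<lambda>t. 0 - 1 * ?e t)"
    using bil_root[OF S sS, of s] sS by (simp add: ract_S fun_eq_iff)
  then have 1: "avg_ip u (ract s ?e) = - avg_ip u ?e" for u
    using avg_ip_diff[of u "\<lambda>_. 0" 1 ?e] avg_ip_zero by simp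
  have "avg_ip ?e v = avg_ip (ract s ?e) (ract s v)"
    using avg_ip_invariant[OF par_generator[OF T(1) s]] by simp
  also have "\<dots> = avg_ip (ract s v) (ract s ?e)" by (rule avg_ip_sym)
  also have "\<dots> = - avg_ip ?e (ract s v)" unfolding 1 by (simp only: avg_ip_sym[of _ ?e])
  also have "\<dots> = - avg_ip ?e v + 2 * bil S s v * avg_ip ?e ?e"
    unfolding ract_S[OF sS, of v] avg_ip_diff by simp
  finally show ?thesis by simp
qed

lemma avg_ip_pos: "0 \<le> avg_ip u u" "avg_ip u u = 0 \<Longrightarrow> t \<in> S \<Longrightarrow> u t = 0"
proof -
  show "0 \<le> avg_ip u u" unfolding avg_ip_def by (intro sum_nonneg) simp
  assume z: "avg_ip u u = 0" and t: "t \<in> S"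
  have "(\<Sum>t\<in>S. ract g u t * ract g u t) = 0" if "g \<in> par T" for g
    using z that T(2) unfolding avg_ip_def
    by (subst (asm) sum_nonneg_eq_0_iff) (auto intro: sum_nonneg)
  from this[OF par_one] have "(\<Sum>t\<in>S. u t * u t) = 0" using ract_one[OF S] by simp
  then show "u t = 0" using t S by (simp add: sum_nonneg_eq_0_iff)
qed

lemma avg_ip_self_pos: assumes "s \<in> T" shows "0 < avg_ip (root_vec s) (root_vec s)"
proof -
  have "s \<in> S" using assms T by auto
  then have "avg_ip (root_vec s) (root_vec s) \<noteq> 0"
    using avg_ip_pos(2)[of "root_vec s" s] by (auto simp: root_vec_def)
  then show ?thesis using avg_ip_pos(1)[of "root_vec s"] by simp
qed

text \<open>The averaged inner products of the roots are \<open>\<langle>e\<^sub>s, e\<^sub>t\<rangle> = \<kappa>\<^sub>s B(e\<^sub>s, e\<^sub>t)\<close> with \<open>\<kappa>\<^sub>s > 0\<close>. By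
  symmetry \<open>\<kappa>\<^sub>s = \<kappa>\<^sub>t\<close> unless \<open>B(e\<^sub>s, e\<^sub>t) = 0\<close>, so \<open>B\<close> is the Gram matrix of the vectors
  \<open>e\<^sub>s / sqrt \<kappa>\<^sub>s\<close>.\<close>

lemma cox_form_avg_ip:
  "cox_form W T v v = avg_ip (\<lambda>r. \<Sum>s\<in>T. (v s / sqrt (avg_ip (root_vec s) (root_vec s))) * root_vec s r)
     (\<lambda>r. \<Sum>s\<in>T. (v s / sqrt (avg_ip (root_vec s) (root_vec s))) * root_vec s r)"
proof -
  define k where "k = (\<lambda>s. avg_ip (root_vec s) (root_vec s))"
  let ?u = "\<lambda>r. \<Sum>s\<in>T. (v s / sqrt (k s)) * root_vec s r"
  have kpos: "k s > 0" if "s \<in> T" for s unfolding k_def using avg_ip_self_pos that by blast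
  have ip: "avg_ip (root_vec s) (root_vec t) = k s * BB s t" if "s \<in> T" "t \<in> T" for s t
  proof -
    have "t \<in> S" using that T by auto
    then show ?thesis using avg_ip_root[OF that(1), of "root_vec t"] bil_root[OF S, of t s] k_def by simp
  qed
  have entry: "v s / sqrt (k s) * (v t / sqrt (k t) * avg_ip (root_vec s) (root_vec t)) = BB s t * v s * v t"
    if st: "s \<in> T" "t \<in> T" for s t
  proof (cases "BB s t = 0")
    case True
    then show ?thesis using ip[OF st] by simp
  next
    case False
    have "s \<in> S" "t \<in> S" using st T by auto
    then have "k s * BB s t = k t * BB s t" using ip[OF st] ip[OF st(2,1)] avg_ip_sym BB_sym by metis
    then have kk: "k s = k t" using False by simp
    have "sqrt (k t) * sqrt (k t) = k t" using kpos[OF st(2)] by simp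
    then show ?thesis using ip[OF st] kk kpos[OF st(2)] by (simp add: field_simps)
  qed
  have lin_l: "avg_ip ?u (root_vec t) = (\<Sum>s\<in>T. v s / sqrt (k s) * avg_ip (root_vec t) (root_vec s))" for t
    unfolding avg_ip_sym[of ?u "root_vec t"] by (rule avg_ip_lincomb)
  have "avg_ip ?u ?u = (\<Sum>t\<in>T. v t / sqrt (k t) * avg_ip ?u (root_vec t))"
    by (rule avg_ip_lincomb)
  also have "\<dots> = (\<Sum>t\<in>T. v t / sqrt (k t) * (\<Sum>s\<in>T. v s / sqrt (k s) * avg_ip (root_vec t) (root_vec s)))"
    unfolding lin_l ..
  also have "\<dots> = (\<Sum>t\<in>T. \<Sum>s\<in>T. BB t s * v t * v s)"
    unfolding sum_distrib_left by (intro sum.cong HOL.refl entry)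
  also have "\<dots> = cox_form W T v v" unfolding cox_form_def BB_def ..
  finally show ?thesis unfolding k_def by simp
qed

lemma cox_form_nonneg: "0 \<le> cox_form W T v v"
  unfolding cox_form_avg_ip by (rule avg_ip_pos)

lemma cox_form_definite: assumes "cox_form W T v v = 0" "t \<in> T" shows "v t = 0"
proof -
  define k where "k = (\<lambda>s. avg_ip (root_vec s) (root_vec s))"
  have "(\<Sum>s\<in>T. (v s / sqrt (k s)) * root_vec s t) = 0"
    using avg_ip_pos(2) assms T(1) unfolding cox_form_avg_ip k_def by blast
  moreover have "(\<Sum>s\<in>T. (v s / sqrt (k s)) * root_vec s t) = (\<Sum>s\<in>T. if s = t then v s / sqrt (k s) else 0)"
    by (rule sum.cong) (auto simp: root_vec_def)
  moreover have "finite T" using T(1) S finite_subset by blast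
  ultimately have "v t / sqrt (k t) = 0" using assms(2) by simp
  then show ?thesis using avg_ip_self_pos[OF assms(2)] k_def by simp
qed

end

section \<open>Base points and face centres\<close>

text \<open>A solution for \<open>T'\<close> is corrected along the vector \<open>n\<close>, which
  has coordinate 1 at \<open>t\<close> and is orthogonal to the roots in \<open>T'\<close>. Its
  product with the root of \<open>t\<close> equals its own squared length, which is nonzero by
  definiteness.\<close>

lemma linear_system_solvable:
  assumes "finite S" "T \<subseteq> S" "finite (par T)"
  shows "\<exists>v. (\<forall>t. t \<notin> T \<longrightarrow> v t = 0) \<and> (\<forall>s\<in>T. bil T s v = b s)"
proof -
  have fT: "finite T" using assms finite_subset by blast
  have "T' \<subseteq> T \<Longrightarrow> \<exists>v. (\<forall>t. t \<notin> T' \<longrightarrow> v t = 0) \<and> (\<forall>s\<in>T'. bil T' s v = b s)" if "finite T'" for T' b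
    using that
  proof (induction T' arbitrary: b rule: finite_induct)
    case empty
    then show ?case by (intro exI[of _ "\<lambda>_. 0"]) simp
  next
    case (insert t T')
    let ?I = "insert t T'"
    have I: "?I \<subseteq> S" using insert assms by auto
    have fp: "finite (par ?I)" using par_mono[OF insert.prems] assms(3) finite_subset by blast
    obtain v0 where v0: "\<forall>r. r \<notin> T' \<longrightarrow> v0 r = 0" "\<forall>s\<in>T'. bil T' s v0 = b s"
      using insert.IH[of b] insert.prems by blast
    obtain w0 where w0: "\<forall>r. r \<notin> T' \<longrightarrow> w0 r = 0" "\<forall>s\<in>T'. bil T' s w0 = - BB s t"
      using insert.IH[of "\<lambda>s. - BB s t"] insert.prems by blast
    have bilI: "bil ?I s u = BB s t * u t + bil T' s u" for s u
      unfolding bil_def using insert.hyps by simp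
    define n where "n = (\<lambda>r. 1 * root_vec t r + 1 * w0 r)"
    have tS: "t \<in> S" using I by simp
    have n: "n t = 1" "bil ?I s n = 0" if "s \<in> T'" for s
    proof -
      show "n t = 1" using w0 insert.hyps unfolding n_def root_vec_def by simp
      have "bil ?I s n = bil ?I s (root_vec t) + bil ?I s w0" unfolding n_def bil_lincomb by simp
      also have "\<dots> = BB s t + (BB s t * w0 t + bil T' s w0)"
        using insert.hyps by (simp add: bil_root bilI[of s w0])
      finally show "bil ?I s n = 0" using w0 that insert.hyps by simp
    qed
    have nt: "n t = 1" using w0 insert.hyps unfolding n_def root_vec_def by simp
    have "cox_form W ?I n n = bil ?I t n"
      unfolding cox_form_bil using insert.hyps n nt by simp
    moreover have "cox_form W ?I n n \<noteq> 0" using cox_form_definite[OF assms(1) I fp, of n t] nt by auto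
    ultimately have d: "bil ?I t n \<noteq> 0" by simp
    define l where "l = (b t - bil ?I t v0) / bil ?I t n"
    define v where "v = (\<lambda>r. 1 * v0 r + l * n r)"
    have "v r = 0" if "r \<notin> ?I" for r
      using that v0 w0 unfolding v_def n_def root_vec_def by auto
    moreover have "bil ?I s v = b s" if "s \<in> ?I" for s
    proof (cases "s = t")
      case True
      then show ?thesis using d unfolding v_def bil_lincomb l_def by simp
    next
      case False
      then have "s \<in> T'" using that by simp
      then show ?thesis using v0 n insert.hyps unfolding v_def bil_lincomb bilI[of s v0] by simp
    qed
    ultimately show ?case by blast
  qed
  from this[OF fT] show ?thesis by blast
qed

lemma linear_system_unique:
  assumes "finite S" "T \<subseteq> S" "finite (par T)"
    "\<And>t. t \<notin> T \<Longrightarrow> u t = v t" "\<And>s. s \<in> T \<Longrightarrow> bil T s u = bil T s v"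
  shows "u = v"
proof
  fix t
  define d where "d = (\<lambda>t. u t - v t)"
  have "cox_form W T d d = 0" unfolding cox_form_bil d_def bil_sub using assms(5) by simp
  then show "u t = v t" using cox_form_definite[OF assms(1-3), of d t] assms(4)[of t] unfolding d_def by auto
qed

lemma base_point:
  assumes "finite S" "T \<subseteq> S" "finite (par T)"
  shows "t \<notin> T \<Longrightarrow> base_point W T t = 0" "s \<in> T \<Longrightarrow> bil T s (base_point W T) = 1"
proof -
  have fT: "finite T" using assms finite_subset by blast
  let ?P = "\<lambda>v. (\<forall>s. s \<notin> T \<longrightarrow> v s = 0) \<and> (\<forall>s\<in>T. cox_form W T (root_vec s) v = 1)"
  obtain v where v: "\<forall>t. t \<notin> T \<longrightarrow> v t = 0" "\<forall>s\<in>T. bil T s v = 1"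
    using linear_system_solvable[OF assms, of "\<lambda>_. 1"] by blast
  have "?P (base_point W T)"
    unfolding base_point_def
  proof (rule theI[of ?P v])
    show "?P v" using v cox_form_root[OF fT] by simp
    fix u assume "?P u"
    then show "u = v" using v cox_form_root[OF fT]
      by (intro linear_system_unique[OF assms]) auto
  qed
  then show "t \<notin> T \<Longrightarrow> base_point W T t = 0" "s \<in> T \<Longrightarrow> bil T s (base_point W T) = 1"
    using cox_form_root[OF fT] by auto
qed

lemma base_point_unique:
  assumes "finite S" "T \<subseteq> S" "finite (par T)" "\<And>t. t \<notin> T \<Longrightarrow> v t = 0" "\<And>s. s \<in> T \<Longrightarrow> bil T s v = 1"
  shows "v = base_point W T"
  using assms base_point[OF assms(1-3)] by (intro linear_system_unique[OF assms(1-3)]) auto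

text \<open>Let \<open>m\<close> and \<open>p\<close> be the negative and positive parts. The form
  of \<open>m\<close> with the base point is the sum of the coordinates of \<open>m\<close>, hence
  nonnegative; that of \<open>m\<close> with \<open>p\<close> is nonpositive, since off-diagonal
  entries are. So the form of \<open>m\<close> with itself is at most 0 and \<open>m\<close>
  vanishes.\<close>

lemma base_point_nonneg:
  assumes "finite S" "T \<subseteq> S" "finite (par T)" shows "0 \<le> base_point W T t"
proof (cases "t \<in> T")
  case True
  define v where "v = base_point W T"
  define m where "m = (\<lambda>t. max 0 (- v t))"
  define p where "p = (\<lambda>t. max 0 (v t))"
  have v: "v = (\<lambda>r. 1 * p r + (- 1) * m r)" unfolding p_def m_def by (auto simp: fun_eq_iff max_def)
  have "cox_form W T m v = (\<Sum>s\<in>T. m s)"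
    unfolding cox_form_bil v_def using base_point[OF assms] by simp
  then have 1: "0 \<le> cox_form W T m v" unfolding m_def by (simp add: sum_nonneg)
  have 2: "cox_form W T m v = cox_form W T m p - cox_form W T m m"
    unfolding arg_cong[OF v, of "cox_form W T m"] cox_form_lincomb by simp
  have "cox_form W T m p \<le> 0"
    unfolding cox_form_def BB_def[symmetric]
  proof (intro sum_nonpos)
    fix s t assume st: "s \<in> T" "t \<in> T"
    show "BB s t * m s * p t \<le> 0"
    proof (cases "s = t")
      case True
      then show ?thesis unfolding m_def p_def by (auto simp: max_def)
    next
      case False
      have "0 \<le> m s * p t" unfolding m_def p_def by simp
      moreover have "BB s t \<le> 0" using BB_nonpos[of s t] st assms False by auto
      ultimately show ?thesis using mult_nonpos_nonneg[of "BB s t" "m s * p t"] by (simp add: mult.assoc)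
    qed
  qed
  then have "cox_form W T m m \<le> 0" using 1 2 by simp
  then have "cox_form W T m m = 0" using cox_form_nonneg[OF assms, of m] by simp
  then have "m t = 0" using cox_form_definite[OF assms _ True] by blast
  then show ?thesis unfolding m_def v_def by (simp add: max_def split: if_splits)
qed (simp add: base_point[OF assms])

lemma act_outside:
  assumes "finite T" "U \<subseteq> T" "ws \<in> lists U" "r \<notin> U" shows "act T ws v r = v r"
  using assms(3)
proof (induction ws)
  case (Cons s ws)
  then have "s \<in> U" "s \<in> T" using assms by auto
  then show ?case using Cons.IH assms(4) by (auto simp: cox_refl_bil[OF assms(1)] root_vec_def)
qed simp

text \<open>The reflections in \<open>U\<close> permute the orbit, so its average is orthogonal to
  the roots in \<open>U\<close>. It agrees with the base point of \<open>T\<close> outside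
  \<open>U\<close>. The difference of the two therefore solves the equations that determine the base
  point of \<open>U\<close>.\<close>

lemma face_centre:
  assumes S: "finite S" and T: "T \<subseteq> S" "finite (par T)" and U: "U \<subseteq> T"
  shows "face_centre W T U = (\<lambda>t. base_point W T t - base_point W U t)"
proof -
  let ?x = "base_point W T"
  have fT: "finite T" and US: "U \<subseteq> S" and fU: "finite (par U)"
    using T S U finite_subset par_mono[OF U] by blast+
  define Ob where "Ob = face_orbit W T U"
  have Ob_act: "Ob = (\<lambda>ws. act T ws ?x) ` lists U" unfolding Ob_def face_orbit_def act_def ..
  have actS: "act T ws ?x = ract (wp ws) ?x" if "ws \<in> lists U" for ws
  proof -
    have "ws \<in> lists T" "ws \<in> lists S" using that U T by auto
    then show ?thesis using act_subset[OF S T(1), of ws ?x] base_point(1)[OF S T] ract_word[OF S] by simp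
  qed
  have "Ob = (\<lambda>g. ract g ?x) ` par U"
    unfolding Ob_act par_def image_image using actS by (intro image_cong HOL.refl)
  then have fin: "finite Ob" using fU by simp
  have "?x \<in> Ob" unfolding Ob_act by (rule image_eqI[of _ _ "[]"]) auto
  then have card: "real (card Ob) \<noteq> 0" using fin by auto
  define c where "c = face_centre W T U"
  have c: "c t = (\<Sum>v\<in>Ob. v t) / real (card Ob)" for t unfolding c_def face_centre_def Ob_def ..
  have c': "c = (\<lambda>r. \<Sum>v\<in>Ob. (1 / real (card Ob)) * v r)"
    unfolding fun_eq_iff c by (simp add: sum_divide_distrib)
  have out: "c r = ?x r" if "r \<notin> U" for r
  proof -
    have "v r = ?x r" if "v \<in> Ob" for v using that act_outside[OF fT U _ \<open>r \<notin> U\<close>] unfolding Ob_act by auto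
    then have "(\<Sum>v\<in>Ob. v r) = (\<Sum>v\<in>Ob. ?x r)" by (rule sum.cong[OF HOL.refl])
    then have "(\<Sum>v\<in>Ob. v r) = real (card Ob) * ?x r" by simp
    then show ?thesis unfolding c using card by simp
  qed
  have centre: "bil T s c = 0" if s: "s \<in> U" for s
  proof -
    have sT: "s \<in> T" "s \<in> S" using s U T by auto
    have closed: "cox_refl W T s v \<in> Ob" if v: "v \<in> Ob" for v
    proof -
      obtain ws where "ws \<in> lists U" "v = act T ws ?x" using v unfolding Ob_act by blast
      then show ?thesis unfolding Ob_act using s by (intro image_eqI[of _ _ "s # ws"]) auto
    qed
    have "(\<Sum>v\<in>Ob. bil T s v) = (\<Sum>v\<in>Ob. bil T s (cox_refl W T s v))"
      by (rule sum.reindex_bij_witness[where i = "cox_refl W T s" and j = "cox_refl W T s"])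
        (simp_all only: refl_refl[OF fT T(1) sT(1)] closed)
    also have "\<dots> = (\<Sum>v\<in>Ob. - bil T s v)"
    proof (rule sum.cong)
      fix v
      have "bil T s (\<lambda>t. 1 * v t + (- 2 * bil T s v) * root_vec s t) = - bil T s v"
        unfolding bil_lincomb using fT sT by (simp add: bil_root)
      then show "bil T s (cox_refl W T s v) = - bil T s v" unfolding cox_refl_bil[OF fT sT(1)] by simp
    qed simp
    finally have "(\<Sum>v\<in>Ob. bil T s v) = 0" by (simp add: sum_negf)
    moreover have "bil T s c = (\<Sum>v\<in>Ob. 1 / real (card Ob) * bil T s v)" unfolding c' by (rule bil_sum)
    ultimately show ?thesis by (simp only: sum_distrib_left[symmetric])
  qed
  define d where "d = (\<lambda>t. ?x t - c t)"
  have "d = base_point W U"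
  proof (rule base_point_unique[OF S US fU])
    show d0: "d t = 0" if "t \<notin> U" for t using out that unfolding d_def by simp
    fix s assume s: "s \<in> U"
    have "bil U s d = bil T s d" using bil_superset[OF fT U, of d s] d0 by simp
    also have "\<dots> = 1" unfolding d_def bil_sub using centre[OF s] base_point(2)[OF S T, of s] s U by auto
    finally show "bil U s d = 1" .
  qed
  then have "base_point W U t = ?x t - c t" for t unfolding d_def by (rule fun_cong[OF HOL.sym])
  then show ?thesis unfolding c_def[symmetric] by (simp add: fun_eq_iff)
qed

text \<open>\<open>wall_height s U\<close> is the distance from the wall of \<open>s\<close> of the vertex \<open>U\<close> of \<open>K\<close>, in any block
  containing both.\<close>

definition wall_height :: "'w \<Rightarrow> 'w set \<Rightarrow> real" where
  "wall_height s U = 1 - bil U s (base_point W U)"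

lemma wall_height_mem: "finite S \<Longrightarrow> U \<subseteq> S \<Longrightarrow> finite (par U) \<Longrightarrow> s \<in> U \<Longrightarrow> wall_height s U = 0"
  unfolding wall_height_def using base_point(2) by simp

text \<open>Off-diagonal entries of the form are nonpositive and base points have nonnegative
  coordinates, so moving from the base point to the centre of the face of \<open>U\<close> does not
  approach the wall of \<open>s\<close>.\<close>

lemma wall_height_ge1:
  assumes "finite S" "U \<subseteq> S" "finite (par U)" "s \<in> S" "s \<notin> U" shows "1 \<le> wall_height s U"
proof -
  have "bil U s (base_point W U) \<le> 0"
    unfolding bil_def
  proof (rule sum_nonpos)
    fix t assume t: "t \<in> U"
    then have "BB s t \<le> 0" using BB_nonpos[of s t] assms by auto
    then show "BB s t * base_point W U t \<le> 0"
      using base_point_nonneg[OF assms(1-3)] by (rule mult_nonpos_nonneg)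
  qed
  then show ?thesis unfolding wall_height_def by simp
qed

text \<open>The base point of \<open>T\<close> contributes 1 and that of \<open>U\<close> is
  supported on \<open>U\<close>, so the value is the same for all \<open>T\<close>.\<close>

lemma bil_face_centre:
  assumes "finite S" "T \<subseteq> S" "finite (par T)" "U \<subseteq> T" "s \<in> T"
  shows "bil T s (face_centre W T U) = wall_height s U"
proof -
  have fT: "finite T" and US: "U \<subseteq> S" and fU: "finite (par U)"
    using assms finite_subset par_mono[OF assms(4)] by blast+
  show ?thesis
    unfolding face_centre[OF assms(1-4)] bil_sub wall_height_def
    using base_point(2)[OF assms(1-3,5)] bil_superset[OF fT assms(4), of "base_point W U" s]
      base_point(1)[OF assms(1) US fU] by simp
qed

lemma bil_block_embed:
  assumes "finite S" "T \<subseteq> S" "finite (par T)" "s \<in> T"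
  shows "bil T s (block_embed W T x) = (\<Sum>U\<in>Pow T. x U * wall_height s U)"
  unfolding block_embed_def bil_sum using bil_face_centre[OF assms(1-3) _ assms(4)]
  by (intro sum.cong HOL.refl) simp

lemma bil_Cauchy_Schwarz:
  assumes "finite S" "T \<subseteq> S" "finite (par T)" "s \<in> T"
  shows "\<bar>bil T s v\<bar> \<le> sqrt (cox_form W T v v)"
proof -
  have fT: "finite T" and sS: "s \<in> S" using assms finite_subset by auto
  define b where "b = bil T s v"
  let ?w = "\<lambda>r. 1 * v r + (- b) * root_vec s r"
  have 1: "cox_form W T v (root_vec s) = b"
    using cox_form_root[OF fT assms(4)] cox_form_sym[OF assms(2)] b_def by simp
  have "cox_form W T ?w v = cox_form W T v v - b * b"
    unfolding cox_form_sym[OF assms(2), of ?w v] cox_form_lincomb 1 by simp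
  moreover have "cox_form W T ?w (root_vec s) = b - b * 1"
    unfolding cox_form_sym[OF assms(2), of ?w "root_vec s"] cox_form_lincomb
    using cox_form_root[OF fT assms(4)] bil_root[OF fT assms(4), of s] sS b_def by simp
  ultimately have "cox_form W T ?w ?w = cox_form W T v v - b * b"
    unfolding cox_form_lincomb by simp
  then have "b\<^sup>2 \<le> cox_form W T v v" using cox_form_nonneg[OF assms(1-3), of ?w] by (simp add: power2_eq_square)
  then have "sqrt (b\<^sup>2) \<le> sqrt (cox_form W T v v)" by (rule real_sqrt_le_mono)
  then show ?thesis unfolding b_def by simp
qed

lemma spherical_iff: "T \<in> spherical W S \<longleftrightarrow> T \<subseteq> S \<and> finite (par T)"
  unfolding spherical_def using par_generate by auto

lemma finite_spherical: "finite S \<Longrightarrow> finite (spherical W S)"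
  by (rule finite_subset[of _ "Pow S"]) (auto simp: spherical_def)

lemma spherical_subset: assumes "T \<in> spherical W S" "U \<subseteq> T" shows "U \<in> spherical W S"
proof -
  have "finite (par T)" "T \<subseteq> S" using assms spherical_iff by auto
  then show ?thesis unfolding spherical_iff using assms(2) finite_subset[OF par_mono[OF assms(2)]] by auto
qed

lemma davis_K_D:
  assumes "x \<in> davis_K W S"
  shows "supp x \<subseteq> spherical W S" "U \<in> supp x \<Longrightarrow> V \<in> supp x \<Longrightarrow> U \<subseteq> V \<or> V \<subseteq> U" "0 \<le> x U"
    "sum x (supp x) = 1" "U \<notin> spherical W S \<Longrightarrow> x U = 0"
proof -
  have "subset.chain (spherical W S) (supp x)" "\<forall>T. 0 \<le> x T" and 1: "sum x (supp x) = 1"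
    using assms unfolding davis_K_def by auto
  then show "supp x \<subseteq> spherical W S" "U \<in> supp x \<Longrightarrow> V \<in> supp x \<Longrightarrow> U \<subseteq> V \<or> V \<subseteq> U" "0 \<le> x U"
    by (auto simp: subset_chain_def)
  then show "U \<notin> spherical W S \<Longrightarrow> x U = 0" unfolding supp_def by auto
  show "sum x (supp x) = 1" by (rule 1)
qed

lemma davis_K_sum: assumes "finite S" "x \<in> davis_K W S" shows "sum x (spherical W S) = 1"
proof -
  have "sum x (spherical W S) = sum x (supp x)"
    using davis_K_D(1)[OF assms(2)] finite_spherical[OF assms(1)]
    by (intro sum.mono_neutral_right) (auto simp: supp_def)
  then show ?thesis using davis_K_D(4)[OF assms(2)] by simp
qed

lemma davis_K_le1: assumes "finite S" "x \<in> davis_K W S" shows "x U \<le> 1"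
proof (cases "U \<in> spherical W S")
  case True
  then have "x U \<le> sum x (spherical W S)"
    using davis_K_D(3)[OF assms(2)] finite_spherical[OF assms(1)] by (intro member_le_sum) auto
  then show ?thesis using davis_K_sum[OF assms] by simp
next
  case False
  then show ?thesis using davis_K_D(5)[OF assms(2)] by simp
qed

lemma davis_K_block:
  assumes "finite S" "x \<in> davis_K W S" obtains T where "T \<in> spherical W S" "x \<in> davis_block W S T"
proof -
  have fin: "finite (supp x)"
    using davis_K_D(1)[OF assms(2)] finite_spherical[OF assms(1)] finite_subset by blast
  moreover have "supp x \<noteq> {}" using davis_K_D(4)[OF assms(2)] by auto
  ultimately obtain T where T: "T \<in> supp x" "\<And>U. U \<in> supp x \<Longrightarrow> \<not> T \<subset> U"
    using finite_has_maximal[of "supp x"] by (metis psubset_eq)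
  have "supp x \<subseteq> Pow T" using T davis_K_D(2)[OF assms(2)] by blast
  then show ?thesis using that T(1) davis_K_D(1)[OF assms(2)] assms(2) unfolding davis_block_def by blast
qed

lemma davis_type_eq: "x \<in> davis_K W S \<Longrightarrow> davis_type W S x = {s\<in>S. \<forall>T\<in>supp x. s \<in> T}"
  unfolding davis_type_def davis_mirror_def by auto

lemma davis_type_subset: "davis_type W S x \<subseteq> S"
  unfolding davis_type_def by auto

lemma davis_type_spherical: assumes "finite S" "x \<in> davis_K W S" shows "davis_type W S x \<in> spherical W S"
proof -
  have "supp x \<noteq> {}" using davis_K_D(4)[OF assms(2)] by auto
  then obtain U where U: "U \<in> supp x" by blast
  then have "davis_type W S x \<subseteq> U" using davis_type_eq[OF assms(2)] by auto
  then show ?thesis using spherical_subset U davis_K_D(1)[OF assms(2)] by blast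
qed

definition vtx :: "'w set \<Rightarrow> 'w set \<Rightarrow> real" where
  "vtx U = (\<lambda>T. if T = U then 1 else 0)"

lemma supp_vtx [simp]: "supp (vtx U) = {U}"
  unfolding supp_def vtx_def by auto

lemma vtx_K: "U \<in> spherical W S \<Longrightarrow> vtx U \<in> davis_K W S"
  unfolding davis_K_def using supp_vtx[of U] by (simp add: subset_chain_def) (simp add: vtx_def)

lemma vtx_block: "U \<in> spherical W S \<Longrightarrow> U \<subseteq> T \<Longrightarrow> vtx U \<in> davis_block W S T"
  unfolding davis_block_def using vtx_K by auto

lemma davis_type_vtx: "U \<in> spherical W S \<Longrightarrow> davis_type W S (vtx U) = U"
  using davis_type_eq[OF vtx_K] spherical_iff by auto

lemma par_singleton: assumes "s \<in> S" shows "par {s} \<subseteq> {\<epsilon>, s}"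
proof
  fix a assume "a \<in> par {s}"
  then obtain ws where "ws \<in> lists {s}" "a = wp ws" unfolding par_def by blast
  then show "a \<in> {\<epsilon>, s}" using assms by (induction ws arbitrary: a) auto
qed

lemma singleton_spherical: "s \<in> S \<Longrightarrow> {s} \<in> spherical W S"
  unfolding spherical_iff using finite_subset[OF par_singleton] by simp

lemma empty_spherical: "{} \<in> spherical W S"
  unfolding spherical_iff par_def by simp

section \<open>Distances from the walls of a chamber\<close>

definition height :: "'w \<Rightarrow> ('w set \<Rightarrow> real) \<Rightarrow> real" where
  "height s x = (\<Sum>U\<in>spherical W S. x U * wall_height s U)"

text \<open>\<open>height s\<close> is a linear function only on blocks of sets containing
  \<open>s\<close>. On the other blocks it is at least 1, so truncating at 1 makes it constant
  there.\<close>

definition cut_height :: "'w \<Rightarrow> ('w set \<Rightarrow> real) \<Rightarrow> real" where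
  "cut_height s x = min 1 (height s x)"

context
  assumes S: "finite S"
begin

lemma wall_height_nonneg:
  assumes "s \<in> S" "U \<in> spherical W S" shows "0 \<le> wall_height s U" "s \<notin> U \<Longrightarrow> 1 \<le> wall_height s U"
proof -
  have U: "U \<subseteq> S" "finite (par U)" using assms(2) spherical_iff by auto
  show 1: "s \<notin> U \<Longrightarrow> 1 \<le> wall_height s U" by (rule wall_height_ge1[OF S U assms(1)])
  show "0 \<le> wall_height s U"
    using 1 wall_height_mem[OF S U, of s] by (cases "s \<in> U") auto
qed

lemma height_ge:
  assumes "x \<in> davis_K W S" "s \<in> S"
  shows "(\<Sum>U\<in>{U\<in>spherical W S. s \<notin> U}. x U) \<le> height s x"
proof -
  have "(\<Sum>U\<in>{U\<in>spherical W S. s \<notin> U}. x U) \<le> (\<Sum>U\<in>{U\<in>spherical W S. s \<notin> U}. x U * wall_height s U)"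
  proof (rule sum_mono)
    fix U assume "U \<in> {U\<in>spherical W S. s \<notin> U}"
    then have "1 \<le> wall_height s U" using wall_height_nonneg(2)[OF assms(2)] by auto
    then show "x U \<le> x U * wall_height s U"
      using mult_left_mono[of 1 "wall_height s U" "x U"] davis_K_D(3)[OF assms(1)] by simp
  qed
  also have "\<dots> \<le> height s x"
    unfolding height_def using davis_K_D(3)[OF assms(1)] wall_height_nonneg(1)[OF assms(2)] finite_spherical[OF S]
    by (intro sum_mono2) auto
  finally show ?thesis .
qed

lemma height_type: assumes "x \<in> davis_K W S" "s \<in> davis_type W S x" shows "cut_height s x = 0"
proof -
  have s: "s \<in> S" "\<forall>T\<in>supp x. s \<in> T" using assms davis_type_eq by auto
  have "x U * wall_height s U = 0" if "U \<in> spherical W S" for U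
  proof (cases "U \<in> supp x")
    case True
    then have "s \<in> U" using s by blast
    moreover have "U \<subseteq> S" "finite (par U)" using that spherical_iff by auto
    ultimately show ?thesis using wall_height_mem[OF S] by simp
  qed (simp add: supp_def)
  then have "height s x = 0" unfolding height_def by (intro sum.neutral) blast
  then show ?thesis unfolding cut_height_def by simp
qed

lemma block_K: "x \<in> davis_block W S T \<Longrightarrow> x \<in> davis_K W S"
  unfolding davis_block_def by simp

lemma height_block:
  assumes "T \<in> spherical W S" "x \<in> davis_block W S T"
  shows "height s x = (\<Sum>U\<in>Pow T. x U * wall_height s U)"
proof -
  have "Pow T \<subseteq> spherical W S" using spherical_subset[OF assms(1)] by blast
  moreover have "x U = 0" if "U \<notin> Pow T" for U
    using assms(2) that unfolding davis_block_def supp_def by auto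
  ultimately show ?thesis
    unfolding height_def using finite_spherical[OF S] by (intro sum.mono_neutral_right) auto
qed

text \<open>If \<open>s \<in> T\<close>, the height is the product with a unit vector, and
  Cauchy-Schwarz applies. Otherwise the barycentric coordinates at vertices omitting
  \<open>s\<close> sum to 1, and the truncated height is constantly 1.\<close>

lemma cut_height_Lipschitz:
  assumes T: "T \<in> spherical W S" and x: "x \<in> davis_block W S T" and y: "y \<in> davis_block W S T" and s: "s \<in> S"
  shows "\<bar>cut_height s x - cut_height s y\<bar> \<le> block_dist W T x y"
proof -
  have T': "T \<subseteq> S" "finite (par T)" using T spherical_iff by auto
  define v where "v = (\<lambda>t. block_embed W T x t - block_embed W T y t)"
  have bd: "block_dist W T x y = sqrt (cox_form W T v v)" unfolding block_dist_def v_def Let_def ..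
  have nonneg: "0 \<le> block_dist W T x y" unfolding bd using cox_form_nonneg[OF S T'] by simp
  show ?thesis
  proof (cases "s \<in> T")
    case True
    have "bil T s v = height s x - height s y"
      unfolding v_def bil_sub bil_block_embed[OF S T' True] height_block[OF T x] height_block[OF T y] ..
    then have "\<bar>height s x - height s y\<bar> \<le> block_dist W T x y"
      using bil_Cauchy_Schwarz[OF S T' True, of v] bd by simp
    then show ?thesis unfolding cut_height_def by (auto simp: min_def abs_if split: if_splits)
  next
    case False
    have "cut_height s z = 1" if z: "z \<in> davis_block W S T" for z
    proof -
      have "(\<Sum>U\<in>{U\<in>spherical W S. s \<notin> U}. z U) = sum z (spherical W S)"
      proof (rule sum.mono_neutral_left)
        show "\<forall>U\<in>spherical W S - {U \<in> spherical W S. s \<notin> U}. z U = 0"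
          using z False unfolding davis_block_def supp_def by auto
      qed (use finite_spherical[OF S] in auto)
      then have "1 \<le> height s z" using height_ge[OF block_K[OF z] s] davis_K_sum[OF S block_K[OF z]] by simp
      then show ?thesis unfolding cut_height_def by simp
    qed
    then show ?thesis using x y nonneg by simp
  qed
qed

lemma block_dist_nonneg: "T \<in> spherical W S \<Longrightarrow> 0 \<le> block_dist W T x y"
  unfolding block_dist_def Let_def using cox_form_nonneg[OF S] spherical_iff by simp

text \<open>Chosen so that \<open>card S\<close> times this number is less than 1.\<close>

definition star_radius :: real where
  "star_radius = 1 / (1 + real (card S))"

lemma star_radius: "0 < star_radius" "star_radius \<le> 1"
  unfolding star_radius_def by auto

text \<open>Otherwise every vertex of the simplex containing \<open>x\<close> would be off one of the walls close to \<open>x\<close>,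
  and the barycentric coordinates of \<open>x\<close> would sum to less than 1.\<close>

lemma near_walls_spherical:
  assumes x: "x \<in> davis_K W S"
  shows "{s\<in>S. cut_height s x < star_radius} \<in> spherical W S"
proof -
  define Z where "Z = {s\<in>S. cut_height s x < star_radius}"
  have fZ: "finite Z" unfolding Z_def using S by simp
  have "\<exists>U\<in>supp x. Z \<subseteq> U"
  proof (rule ccontr)
    assume no: "\<not> (\<exists>U\<in>supp x. Z \<subseteq> U)"
    have "x U \<le> (\<Sum>s\<in>Z. if s \<notin> U then x U else 0)" if "U \<in> spherical W S" for U
    proof (cases "U \<in> supp x")
      case True
      then obtain s where s: "s \<in> Z" "s \<notin> U" using no by blast
      have "(if s \<notin> U then x U else 0) \<le> (\<Sum>s\<in>Z. if s \<notin> U then x U else 0)"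
        using s fZ davis_K_D(3)[OF x] by (intro member_le_sum) auto
      then show ?thesis using s by simp
    next
      case False
      then have "x U = 0" unfolding supp_def by simp
      then show ?thesis using sum_nonneg[of Z "\<lambda>s. if s \<notin> U then x U else 0"] by simp
    qed
    then have "sum x (spherical W S) \<le> (\<Sum>U\<in>spherical W S. \<Sum>s\<in>Z. if s \<notin> U then x U else 0)"
      by (rule sum_mono)
    also have "\<dots> = (\<Sum>s\<in>Z. \<Sum>U\<in>spherical W S. if s \<notin> U then x U else 0)" by (rule sum.swap)
    also have "\<dots> = (\<Sum>s\<in>Z. \<Sum>U\<in>{U\<in>spherical W S. s \<notin> U}. x U)"
      using finite_spherical[OF S] by (intro sum.cong HOL.refl sum.inter_filter[symmetric])
    also have "\<dots> \<le> (\<Sum>s\<in>Z. star_radius)"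
    proof (rule sum_mono)
      fix s assume "s \<in> Z"
      then have "s \<in> S" "cut_height s x < star_radius" unfolding Z_def by auto
      then show "(\<Sum>U\<in>{U\<in>spherical W S. s \<notin> U}. x U) \<le> star_radius"
        using height_ge[OF x, of s] star_radius(2) unfolding cut_height_def by (auto simp: min_def split: if_splits)
    qed
    also have "\<dots> = real (card Z) * star_radius" by simp
    also have "\<dots> \<le> real (card S) * star_radius"
    proof -
      have "card Z \<le> card S" unfolding Z_def using S by (intro card_mono) auto
      then show ?thesis using star_radius(1) by (intro mult_right_mono) auto
    qed
    also have "\<dots> < 1" unfolding star_radius_def by simp
    finally show False using davis_K_sum[OF S x] by simp
  qed
  then show ?thesis unfolding Z_def[symmetric] using spherical_subset davis_K_D(1)[OF x] by blast
qed

lemma spherical_len_bound: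
  obtains M where "\<And>T a. T \<in> spherical W S \<Longrightarrow> a \<in> par T \<Longrightarrow> len a \<le> M"
proof -
  have "finite (len ` (\<Union>T\<in>spherical W S. par T))"
    using finite_spherical[OF S] spherical_iff by blast
  then obtain M where "\<forall>k\<in>len ` (\<Union>T\<in>spherical W S. par T). k \<le> M"
    unfolding finite_nat_set_iff_bounded_le by blast
  then show ?thesis using that by blast
qed

lemma block_dist_bound:
  obtains D where "\<And>T x y. T \<in> spherical W S \<Longrightarrow> x \<in> davis_block W S T \<Longrightarrow> y \<in> davis_block W S T \<Longrightarrow>
    block_dist W T x y \<le> D"
proof -
  define c where "c = (\<lambda>T t. 2 * (\<Sum>U\<in>Pow T. \<bar>face_centre W T U t\<bar>))"
  define B where "B = (\<lambda>T. sqrt (\<Sum>s\<in>T. \<Sum>t\<in>T. \<bar>BB s t\<bar> * c T s * c T t))"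
  have "block_dist W T x y \<le> (\<Sum>T\<in>spherical W S. B T)"
    if T: "T \<in> spherical W S" and x: "x \<in> davis_block W S T" and y: "y \<in> davis_block W S T" for T x y
  proof -
    define v where "v = (\<lambda>t. block_embed W T x t - block_embed W T y t)"
    have emb: "\<bar>block_embed W T z t\<bar> \<le> (\<Sum>U\<in>Pow T. \<bar>face_centre W T U t\<bar>)"
      if z: "z \<in> davis_K W S" for z t
    proof -
      have "\<bar>block_embed W T z t\<bar> \<le> (\<Sum>U\<in>Pow T. \<bar>z U * face_centre W T U t\<bar>)"
        unfolding block_embed_def by (rule sum_abs)
      also have "\<dots> \<le> (\<Sum>U\<in>Pow T. \<bar>face_centre W T U t\<bar>)"
      proof (rule sum_mono)
        fix U
        have "\<bar>z U\<bar> \<le> 1" using davis_K_D(3)[OF z] davis_K_le1[OF S z] by simp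
        then show "\<bar>z U * face_centre W T U t\<bar> \<le> \<bar>face_centre W T U t\<bar>"
          using mult_right_mono[of "\<bar>z U\<bar>" 1 "\<bar>face_centre W T U t\<bar>"] by (simp add: abs_mult)
      qed
      finally show ?thesis .
    qed
    have v: "\<bar>v t\<bar> \<le> c T t" for t
      using emb[OF block_K[OF x], of t] emb[OF block_K[OF y], of t] unfolding v_def c_def by linarith
    have c0: "0 \<le> c T t" for t using order_trans[OF abs_ge_zero v] .
    have "cox_form W T v v \<le> (\<Sum>s\<in>T. \<Sum>t\<in>T. \<bar>BB s t\<bar> * c T s * c T t)"
      unfolding cox_form_def BB_def[symmetric]
    proof (intro sum_mono)
      fix s t
      have "BB s t * v s * v t \<le> \<bar>BB s t * v s * v t\<bar>" by (rule abs_ge_self)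
      also have "\<dots> = \<bar>BB s t\<bar> * \<bar>v s\<bar> * \<bar>v t\<bar>" by (simp add: abs_mult)
      also have "\<dots> \<le> \<bar>BB s t\<bar> * c T s * c T t"
        using v c0 by (intro mult_mono) auto
      finally show "BB s t * v s * v t \<le> \<bar>BB s t\<bar> * c T s * c T t" .
    qed
    then have "block_dist W T x y \<le> B T"
      unfolding block_dist_def Let_def v_def[symmetric] B_def by (rule real_sqrt_le_mono)
    also have "B T \<le> (\<Sum>T\<in>spherical W S. B T)"
    proof (rule member_le_sum[OF T])
      fix T' assume "T' \<in> spherical W S - {T}"
      show "0 \<le> B T'" unfolding B_def c_def by (auto intro!: sum_nonneg mult_nonneg_nonneg)
    qed (rule finite_spherical[OF S])
    finally show ?thesis .
  qed
  then show ?thesis using that by blast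
qed

end

section \<open>The Davis realization\<close>

lemma mult_S_neq: assumes "v \<in> G" "s \<in> S" shows "v \<noteq> v \<cdot> s"
proof
  assume "v = v \<cdot> s"
  then have "iv v \<cdot> v = iv v \<cdot> (v \<cdot> s)" by (rule arg_cong)
  then show False using S_neq1[OF assms(2)] assms by simp
qed

text \<open>Through this structure every result on the realization of a building specializes to the
  Davis complex of \<open>W\<close>.\<close>

lemma coxeter_building:
  "building W S G (\<lambda>s. {(v, w). v \<in> G \<and> w \<in> G \<and> (w = v \<or> w = v \<cdot> s)}) (cox_dist W)"
    (is "building W S G ?E _")
proof unfold_locales
  show "G \<noteq> {}" by blast
  show "equiv G (?E s)" if s: "s \<in> S" for s
  proof (rule equivI)
    show "trans (?E s)" by (rule transI) (use s in \<open>auto simp: m_assoc\<close>)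
    show "sym (?E s)" by (rule symI) (use s in \<open>auto simp: m_assoc\<close>)
  qed (auto simp: refl_on_def)
  show "\<exists>c\<in>P. \<exists>c'\<in>P. c \<noteq> c'" if s: "s \<in> S" and P: "P \<in> G // ?E s" for s P
  proof -
    obtain v where v: "v \<in> G" "P = ?E s `` {v}" using P by (rule quotientE)
    have "v \<noteq> v \<cdot> s" by (rule mult_S_neq[OF v(1) s])
    moreover have "v \<in> P" "v \<cdot> s \<in> P" using v s by auto
    ultimately show ?thesis by blast
  qed
  show "cox_dist W c c' \<in> G" if "c \<in> G" "c' \<in> G" for c c'
    using that unfolding cox_dist_def by simp
  show "cox_dist W c c' = wp ws \<longleftrightarrow> (\<exists>cs. gallery G ?E ws cs \<and> hd cs = c \<and> last cs = c')"
    if ws: "reduced_word W S ws" and c: "c \<in> G" and c': "c' \<in> G" for ws c c'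
  proof
    have wsS: "ws \<in> lists S" using ws unfolding reduced_word_def by blast
    have takeS: "take i ws \<in> lists S" for i using wsS by (auto dest: in_set_takeD)
    have step: "wp (take (Suc i) ws) = wp (take i ws) \<cdot> ws ! i" if "i < length ws" for i
      using that wsS takeS[of i] by (simp add: take_Suc_conv_app_nth)
    assume "cox_dist W c c' = wp ws"
    then have c'_eq: "c' = c \<cdot> wp ws" unfolding cox_dist_def using c c' wsS
      using cancel_inv_r[OF c c'] by simp
    define cs where "cs = map (\<lambda>i. c \<cdot> wp (take i ws)) [0..<Suc (length ws)]"
    have nth: "cs ! i = c \<cdot> wp (take i ws)" if "i \<le> length ws" for i
      using that unfolding cs_def by (simp del: upt_Suc)
    have "gallery G ?E ws cs"
      unfolding gallery_def
    proof (intro conjI allI impI)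
      show "set cs \<subseteq> G" unfolding cs_def using c word_prod_closed[OF takeS] by (auto simp del: upt_Suc)
      show "length cs = Suc (length ws)" unfolding cs_def by simp
      fix i assume i: "i < length ws"
      have wsi: "ws ! i \<in> S" using wsS i by simp
      have G: "cs ! i \<in> G" using nth[of i] i c takeS by simp
      have e: "cs ! Suc i = cs ! i \<cdot> ws ! i"
        using nth[of i] nth[of "Suc i"] step[OF i] i c takeS[of i] wsi by (simp add: m_assoc)
      then show "cs ! i \<noteq> cs ! Suc i" using mult_S_neq[OF G wsi] by simp
      show "(cs ! i, cs ! Suc i) \<in> ?E (ws ! i)" using e G wsi by auto
    qed
    moreover have "cs \<noteq> []" unfolding cs_def by simp
    moreover from this have "hd cs = c" "last cs = c'"
      using nth[of 0] nth[of "length ws"] c c'_eq by (simp_all add: hd_conv_nth last_conv_nth cs_def del: upt_Suc)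
    ultimately show "\<exists>cs. gallery G ?E ws cs \<and> hd cs = c \<and> last cs = c'" by blast
  next
    have wsS: "ws \<in> lists S" using ws unfolding reduced_word_def by blast
    have takeS: "take i ws \<in> lists S" for i using wsS by (auto dest: in_set_takeD)
    assume "\<exists>cs. gallery G ?E ws cs \<and> hd cs = c \<and> last cs = c'"
    then obtain cs where cs: "gallery G ?E ws cs" "hd cs = c" "last cs = c'" by blast
    then have ne: "cs \<noteq> []" and l: "length cs = Suc (length ws)" unfolding gallery_def by auto
    have "cs ! i = c \<cdot> wp (take i ws)" if "i \<le> length ws" for i
      using that
    proof (induction i)
      case 0
      then show ?case using cs(2) ne c by (simp add: hd_conv_nth)
    next
      case (Suc i)
      then have i: "i < length ws" by simp
      have "cs ! i \<noteq> cs ! Suc i" "(cs ! i, cs ! Suc i) \<in> ?E (ws ! i)" using cs(1) i unfolding gallery_def by auto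
      then have "cs ! Suc i = cs ! i \<cdot> ws ! i" by auto
      then show ?case using Suc i wsS takeS[of i] c by (simp add: take_Suc_conv_app_nth m_assoc)
    qed
    from this[of "length ws"] have "c' = c \<cdot> wp ws" using cs(3) ne l by (simp add: last_conv_nth)
    then show "cox_dist W c c' = wp ws" unfolding cox_dist_def using c wsS by simp
  qed
qed

end

context building begin

abbreviation KK where "KK \<equiv> davis_K W S"
abbreviation pt where "pt c x \<equiv> davis_pt W S C \<delta> c x"

lemma par_dist_inv: "J \<subseteq> S \<Longrightarrow> c \<in> C \<Longrightarrow> d \<in> C \<Longrightarrow> \<delta> c d \<in> par J \<Longrightarrow> \<delta> d c \<in> par J"
  using dist_inv[of c d] par_inv[of J "\<delta> c d"] by simp

lemma par_dist_trans:
  assumes "J \<subseteq> S" "c \<in> C" "d \<in> C" "e \<in> C" "\<delta> c d \<in> par J" "\<delta> d e \<in> par J"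
  shows "\<delta> c e \<in> par J"
proof -
  have "iv (\<delta> c d) \<cdot> \<delta> c e \<in> par J" by (rule dist_retract(2)[OF assms(2-4,1,6)])
  from par_mult[OF assms(1,5) this] show ?thesis using dist_closed assms by simp
qed

lemma davis_rel_iff:
  "((c, x), (d, y)) \<in> davis_rel W S C \<delta> \<longleftrightarrow>
     c \<in> C \<and> d \<in> C \<and> x \<in> KK \<and> x = y \<and> \<delta> c d \<in> par (davis_type W S x)"
  unfolding davis_rel_def using par_generate[OF davis_type_subset] by auto

lemma davis_rel_equiv: "equiv (C \<times> KK) (davis_rel W S C \<delta>)"
proof (rule equivI)
  show "davis_rel W S C \<delta> \<subseteq> (C \<times> KK) \<times> (C \<times> KK)" unfolding davis_rel_def by auto
  show "refl_on (C \<times> KK) (davis_rel W S C \<delta>)" unfolding refl_on_def by (auto simp: davis_rel_iff)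
  show "sym (davis_rel W S C \<delta>)"
  proof (rule symI)
    fix p q assume "(p, q) \<in> davis_rel W S C \<delta>"
    then show "(q, p) \<in> davis_rel W S C \<delta>"
      by (cases p; cases q) (auto simp: davis_rel_iff intro: par_dist_inv[OF davis_type_subset])
  qed
  show "trans (davis_rel W S C \<delta>)"
  proof (rule transI)
    fix p q r assume "(p, q) \<in> davis_rel W S C \<delta>" "(q, r) \<in> davis_rel W S C \<delta>"
    then show "(p, r) \<in> davis_rel W S C \<delta>"
      by (cases p; cases q; cases r) (auto simp: davis_rel_iff intro: par_dist_trans[OF davis_type_subset])
  qed
qed

lemma pt_eq_iff:
  assumes "c \<in> C" "x \<in> KK" "d \<in> C" "y \<in> KK"
  shows "pt c x = pt d y \<longleftrightarrow> x = y \<and> \<delta> c d \<in> par (davis_type W S x)"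
  unfolding davis_pt_def
  using eq_equiv_class_iff[OF davis_rel_equiv, of "(c, x)" "(d, y)"] assms by (auto simp: davis_rel_iff)

lemma davis_iff: "p \<in> davis W S C \<delta> \<longleftrightarrow> (\<exists>c\<in>C. \<exists>x\<in>KK. p = pt c x)"
  unfolding davis_def quotient_def davis_pt_def by auto

lemma davis_pt_closed: "c \<in> C \<Longrightarrow> x \<in> KK \<Longrightarrow> pt c x \<in> davis W S C \<delta>"
  using davis_iff by blast

lemma mem_davis_pt: "z \<in> pt c x \<Longrightarrow> fst z \<in> C \<and> snd z \<in> KK \<and> pt (fst z) (snd z) = pt c x"
proof -
  assume "z \<in> pt c x"
  then have r: "((c, x), z) \<in> davis_rel W S C \<delta>" unfolding davis_pt_def by simp
  then have "fst z \<in> C \<and> snd z \<in> KK" by (cases z) (auto simp: davis_rel_iff)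
  moreover have "pt c x = pt (fst z) (snd z)"
    unfolding davis_pt_def using equiv_class_eq[OF davis_rel_equiv r] by simp
  ultimately show ?thesis by simp
qed

lemma davis_pt_self: "c \<in> C \<Longrightarrow> x \<in> KK \<Longrightarrow> (c, x) \<in> pt c x"
  unfolding davis_pt_def by (simp add: davis_rel_iff)

section \<open>Strings and the quasi-isometry with the set of chambers\<close>

abbreviation string where "string \<equiv> davis_string W S C \<delta>"

context
  assumes S: "finite S"
begin

lemma string_ends: "string p q l \<Longrightarrow> p \<in> davis W S C \<delta> \<and> q \<in> davis W S C \<delta> \<and> 0 \<le> l"
proof (induction rule: davis_string.induct)
  case (step p c x l T y)
  then show ?case using davis_pt_closed block_K[OF S] block_dist_nonneg[OF S] by auto
qed auto

text \<open>A string is cut greedily into pieces of length at least \<open>star_radius\<close>: so far there are \<open>k\<close> of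
  them, the last one ends at the point \<open>pt a y\<close>, and the string has run a length \<open>l2\<close> since.\<close>

lemma string_anchor:
  assumes M: "\<forall>T\<in>spherical W S. \<forall>a\<in>par T. len a \<le> M"
    and "string p q l" "c0 \<in> C" "x0 \<in> KK" "p = pt c0 x0"
  shows "\<exists>a y k l2 c z. a \<in> C \<and> y \<in> KK \<and> c \<in> C \<and> z \<in> KK \<and> q = pt c z \<and>
    len (\<delta> c0 a) \<le> k * M \<and> real k * star_radius + l2 \<le> l \<and> 0 \<le> l2 \<and> l2 < star_radius \<and>
    \<delta> a c \<in> par {s\<in>S. cut_height s y < star_radius} \<and> (\<forall>s\<in>S. \<bar>cut_height s z - cut_height s y\<bar> \<le> l2)"
  using assms(2-)
proof (induction rule: davis_string.induct)
  case (base p)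
  show ?case
    by (rule exI[of _ c0], rule exI[of _ x0], rule exI[of _ 0], rule exI[of _ 0], rule exI[of _ c0], rule exI[of _ x0])
      (use base star_radius(1)[OF S] in auto)
next
  case (step p c' x l T y')
  obtain a y k l2 c z where IH: "a \<in> C" "y \<in> KK" "c \<in> C" "z \<in> KK" "pt c' x = pt c z"
    "len (\<delta> c0 a) \<le> k * M" "real k * star_radius + l2 \<le> l" "0 \<le> l2" "l2 < star_radius"
    "\<delta> a c \<in> par {s\<in>S. cut_height s y < star_radius}" "\<forall>s\<in>S. \<bar>cut_height s z - cut_height s y\<bar> \<le> l2"
    using step.IH[OF step.prems] by (elim exE conjE)
  define Z where "Z = {s\<in>S. cut_height s y < star_radius}"
  have Z: "Z \<subseteq> S" "Z \<in> spherical W S" using near_walls_spherical[OF S IH(2)] unfolding Z_def by auto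
  define b where "b = block_dist W T x y'"
  have xK: "x \<in> KK" "y' \<in> KK" using step block_K[OF S] by auto
  have b0: "0 \<le> b" unfolding b_def by (rule block_dist_nonneg[OF S \<open>T \<in> spherical W S\<close>])
  have zx: "z = x" "\<delta> c c' \<in> par (davis_type W S z)"
    using pt_eq_iff[of c z c' x] IH(3-5) xK \<open>c' \<in> C\<close> by auto
  \<comment> \<open>The string may change from \<open>c\<close> to \<open>c'\<close> at the point
    without running any length. The walls through the point have height 0 there, hence height below
    \<open>star_radius\<close> at the anchor, so the change stays in the residue of
    \<open>Z\<close>.\<close>
  have "davis_type W S z \<subseteq> Z"
  proof
    fix s assume s: "s \<in> davis_type W S z"
    have sS: "s \<in> S" using s davis_type_subset by blast
    have "cut_height s z = 0" by (rule height_type[OF S IH(4) s])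
    then have "cut_height s y < star_radius" using IH(9,11) sS by force
    then show "s \<in> Z" unfolding Z_def using sS by simp
  qed
  then have "\<delta> c c' \<in> par Z" using zx(2) par_mono by blast
  then have acZ: "\<delta> a c' \<in> par Z"
    using par_dist_trans[OF Z(1) IH(1,3) \<open>c' \<in> C\<close>] IH(10) unfolding Z_def[symmetric] by simp
  show ?case
  proof (cases "l2 + b < star_radius")
    case True
    have "\<bar>cut_height s y' - cut_height s y\<bar> \<le> l2 + b" if "s \<in> S" for s
    proof -
      have "\<bar>cut_height s x - cut_height s y'\<bar> \<le> b"
        unfolding b_def by (rule cut_height_Lipschitz[OF S]) (use step that in auto)
      moreover have "\<bar>cut_height s x - cut_height s y\<bar> \<le> l2" using IH(11) that zx(1) by simp
      ultimately show ?thesis by linarith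
    qed
    moreover have "real k * star_radius + (l2 + b) \<le> l + b" using IH(7) by simp
    ultimately show ?thesis using IH(1,2,6,8) xK(2) \<open>c' \<in> C\<close> True acZ b0
      unfolding Z_def b_def[symmetric]
      by (intro exI[of _ a] exI[of _ y] exI[of _ k] exI[of _ "l2 + b"] exI[of _ c'] exI[of _ y']) simp
  next
    case False
    \<comment> \<open>The piece has reached the length \<open>star_radius\<close>. It is closed, and
      the anchor moves to the current point at the price of one residue, at most
      \<open>M\<close>.\<close>
    have "len (\<delta> c0 c') \<le> len (\<delta> c0 a) + len (\<delta> a c')"
      by (rule dist_triangle[OF \<open>c0 \<in> C\<close> IH(1) \<open>c' \<in> C\<close>])
    also have "\<dots> \<le> k * M + M" by (rule add_mono[OF IH(6) M[rule_format, OF Z(2) acZ]])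
    finally have "len (\<delta> c0 c') \<le> Suc k * M" by simp
    moreover have "real (Suc k) * star_radius + 0 \<le> l + b"
      using IH(7) False by (simp add: algebra_simps)
    ultimately show ?thesis using xK(2) \<open>c' \<in> C\<close> star_radius(1)[OF S]
      unfolding b_def[symmetric]
      by (intro exI[of _ c'] exI[of _ y'] exI[of _ "Suc k"] exI[of _ 0] exI[of _ c'] exI[of _ y']) simp
  qed
qed

lemma string_lower_bound:
  obtains M where "0 < M" "\<And>c x d y l. c \<in> C \<Longrightarrow> x \<in> KK \<Longrightarrow> d \<in> C \<Longrightarrow> y \<in> KK \<Longrightarrow>
    string (pt c x) (pt d y) l \<Longrightarrow> real (len (\<delta> c d)) \<le> (l + 2) * M"
proof -
  obtain M where M: "\<And>T a. T \<in> spherical W S \<Longrightarrow> a \<in> par T \<Longrightarrow> len a \<le> M"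
    by (rule spherical_len_bound[OF S]) blast
  then have M': "\<forall>T\<in>spherical W S. \<forall>a\<in>par T. len a \<le> M" by blast
  \<comment> \<open>There are at most \<open>l / star_radius\<close> closed pieces. The 2 in
    \<open>l + 2\<close> pays for the unfinished piece and for the change of chamber at the end
    point; the 1 added to \<open>M\<close> keeps the constant positive.\<close>
  define M' where "M' = (real M + 1) / star_radius"
  have sr: "0 < star_radius" "star_radius \<le> 1" using star_radius[OF S] by auto
  have "real (len (\<delta> c d)) \<le> (l + 2) * M'"
    if cd: "c \<in> C" "x \<in> KK" "d \<in> C" "y \<in> KK" and st: "string (pt c x) (pt d y) l" for c x d y l
  proof -
    obtain a y0 k l2 e z where *: "a \<in> C" "y0 \<in> KK" "e \<in> C" "z \<in> KK" "pt d y = pt e z"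
    "len (\<delta> c a) \<le> k * M" "real k * star_radius + l2 \<le> l" "0 \<le> l2"
    "\<delta> a e \<in> par {s\<in>S. cut_height s y0 < star_radius}"
      using string_anchor[OF M' st cd(1,2) HOL.refl] by (elim exE conjE)
    have "\<delta> e d \<in> par (davis_type W S z)" using pt_eq_iff[of e z d y] * cd by auto
    then have "len (\<delta> e d) \<le> M" by (rule M[OF davis_type_spherical[OF S *(4)]])
    moreover have "len (\<delta> a e) \<le> M" by (rule M[OF near_walls_spherical[OF S *(2)] *(9)])
    moreover have "len (\<delta> c d) \<le> len (\<delta> c a) + len (\<delta> a d)" "len (\<delta> a d) \<le> len (\<delta> a e) + len (\<delta> e d)"
      by (rule dist_triangle; fact)+
    ultimately have "len (\<delta> c d) \<le> k * M + (M + M)" using *(6) by linarith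
    then have "real (len (\<delta> c d)) \<le> real (k * M + (M + M))" by (simp only: of_nat_le_iff)
    then have 1: "real (len (\<delta> c d)) \<le> (real k + 2) * real M" by (simp add: algebra_simps)
    have "real k * star_radius \<le> l" using *(7,8) by simp
    then have "real k \<le> l / star_radius" using sr by (simp add: field_simps)
    moreover have "2 \<le> 2 / star_radius" using sr by (simp add: field_simps)
    ultimately have 2: "real k + 2 \<le> (l + 2) / star_radius" by (simp add: add_divide_distrib)
    have "(real k + 2) * real M \<le> (l + 2) / star_radius * (real M + 1)"
      using 2 by (intro mult_mono) auto
    then show ?thesis using 1 unfolding M'_def by simp
  qed
  moreover have "0 < M'" unfolding M'_def using sr by simp
  ultimately show ?thesis using that by blast
qed

text \<open>The vertex \<open>vtx {}\<close> lies in every block of a chamber, so any two points of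
  the chamber are joined through it in two steps.\<close>

lemma string_within_chamber:
  assumes D: "\<And>T x y. T \<in> spherical W S \<Longrightarrow> x \<in> davis_block W S T \<Longrightarrow> y \<in> davis_block W S T \<Longrightarrow>
    block_dist W T x y \<le> D"
    and st: "string p (pt c x) l" and c: "c \<in> C" "x \<in> KK" "y \<in> KK"
  shows "\<exists>l'. l' \<le> l + 2 * D \<and> string p (pt c y) l'"
proof -
  let ?o = "vtx {}"
  obtain T where T: "T \<in> spherical W S" "x \<in> davis_block W S T" by (rule davis_K_block[OF S c(2)])
  obtain T' where T': "T' \<in> spherical W S" "y \<in> davis_block W S T'" by (rule davis_K_block[OF S c(3)])
  have o: "?o \<in> davis_block W S T" "?o \<in> davis_block W S T'" using vtx_block[OF empty_spherical] by auto
  have "string p (pt c y) (l + block_dist W T x ?o + block_dist W T' ?o y)"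
    by (rule davis_string.step[OF davis_string.step[OF st c(1) T o(1)] c(1) T'(1) o(2) T'(2)])
  moreover have "block_dist W T x ?o \<le> D" "block_dist W T' ?o y \<le> D"
    by (rule D[OF T o(1)], rule D[OF T'(1) o(2) T'(2)])
  ultimately show ?thesis by (intro exI[of _ "l + block_dist W T x ?o + block_dist W T' ?o y"]) simp
qed

text \<open>Along a gallery, adjacent chambers of type \<open>s\<close> share the vertex
  \<open>vtx {s}\<close>; each letter costs one passage through a chamber, and one more leads to the
  end point.\<close>

lemma string_upper_bound:
  obtains D where "0 \<le> D" "\<And>c x d y. c \<in> C \<Longrightarrow> x \<in> KK \<Longrightarrow> d \<in> C \<Longrightarrow> y \<in> KK \<Longrightarrow>
    \<exists>l. l \<le> (real (len (\<delta> c d)) + 1) * D \<and> string (pt c x) (pt d y) l"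
proof -
  obtain D0 where D0: "\<And>T x y. T \<in> spherical W S \<Longrightarrow> x \<in> davis_block W S T \<Longrightarrow> y \<in> davis_block W S T \<Longrightarrow>
    block_dist W T x y \<le> D0"
    by (rule block_dist_bound[OF S]) blast
  define D where "D = max 0 D0"
  have D: "block_dist W T x y \<le> D" if "T \<in> spherical W S" "x \<in> davis_block W S T" "y \<in> davis_block W S T" for T x y
    using D0[OF that] unfolding D_def by simp
  have Dn: "0 \<le> D" unfolding D_def by simp
  have walk: "\<exists>l'. l' \<le> l + real (length ws) * (2 * D) \<and> (\<exists>y\<in>KK. string p (pt d y) l')"
    if "ws \<in> lists S" "gal ws c d" "x \<in> KK" "string p (pt c x) l" for ws c d p x l
    using that
  proof (induction ws arbitrary: c x l rule: list.induct)
    case Nil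
    then show ?case by (intro exI[of _ l]) (auto simp: gal_Nil)
  next
    case (Cons s ws)
    then have s: "s \<in> S" "ws \<in> lists S" by auto
    obtain e where e: "c \<noteq> e" "(c, e) \<in> E s" "gal ws e d" using Cons.prems(2) gal_Cons[OF s(1)] by blast
    have ce: "c \<in> C" "e \<in> C" using E_closed[OF s(1) e(2)] by auto
    have v: "vtx {s} \<in> KK" by (rule vtx_K[OF singleton_spherical[OF s(1)]])
    have "\<delta> c e = s" using dist_S_iff[OF s(1) ce] e by blast
    then have "\<delta> c e \<in> par (davis_type W S (vtx {s}))"
      using davis_type_vtx[OF singleton_spherical[OF s(1)]] par_generator[of "{s}" s] s(1) by simp
    then have eq: "pt c (vtx {s}) = pt e (vtx {s})" using pt_eq_iff[OF ce(1) v ce(2) v] by simp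
    obtain l1 where l1: "l1 \<le> l + 2 * D" "string p (pt e (vtx {s})) l1"
      using string_within_chamber[OF D Cons.prems(4) ce(1) Cons.prems(3) v] unfolding eq by blast
    obtain l' where l': "l' \<le> l1 + real (length ws) * (2 * D)" "\<exists>y\<in>KK. string p (pt d y) l'"
      using Cons.IH[OF s(2) e(3) v l1(2)] by blast
    have "l' \<le> l + real (length (s # ws)) * (2 * D)" using l'(1) l1(1) by (simp add: algebra_simps)
    then show ?case using l'(2) by blast
  qed
  have "\<exists>l. l \<le> (real (len (\<delta> c d)) + 1) * (2 * D) \<and> string (pt c x) (pt d y) l"
    if cd: "c \<in> C" "x \<in> KK" "d \<in> C" "y \<in> KK" for c x d y
  proof -
    obtain ws where ws: "ws \<in> lists S" "length ws = len (\<delta> c d)" "gal ws c d"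
      using dist_galE[OF cd(1,3)] by metis
    have "string (pt c x) (pt c x) 0" by (rule davis_string.base[OF davis_pt_closed[OF cd(1,2)]])
    from walk[OF ws(1,3) cd(2) this] obtain l' z where
      l': "l' \<le> real (len (\<delta> c d)) * (2 * D)" "z \<in> KK" "string (pt c x) (pt d z) l'"
      unfolding ws(2) by auto
    obtain l where "l \<le> l' + 2 * D" "string (pt c x) (pt d y) l"
      using string_within_chamber[OF D l'(3) cd(3) l'(2) cd(4)] by blast
    then show ?thesis using l'(1) by (intro exI[of _ l]) (simp add: algebra_simps)
  qed
  then show ?thesis using that[of "2 * D"] Dn by simp
qed

text \<open>An infimum of real numbers has its meaning for nonempty sets bounded below: connecting
  strings exist, and their lengths are nonnegative.\<close>

lemma davis_dist_Inf:
  assumes "p \<in> davis W S C \<delta>" "q \<in> davis W S C \<delta>"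
  shows "{l. string p q l} \<noteq> {}" "bdd_below {l. string p q l}"
proof -
  obtain c x d y where "c \<in> C" "x \<in> KK" "p = pt c x" "d \<in> C" "y \<in> KK" "q = pt d y"
    using assms davis_iff[of p] davis_iff[of q] by blast
  moreover obtain D where "\<And>c x d y. c \<in> C \<Longrightarrow> x \<in> KK \<Longrightarrow> d \<in> C \<Longrightarrow> y \<in> KK \<Longrightarrow>
    \<exists>l. l \<le> (real (len (\<delta> c d)) + 1) * D \<and> string (pt c x) (pt d y) l"
    by (rule string_upper_bound) blast
  ultimately show "{l. string p q l} \<noteq> {}" by blast
  show "bdd_below {l. string p q l}" by (rule bdd_belowI[of _ 0]) (use string_ends in auto)
qed

lemma davis_quasi_isometry:
  obtains M D where "0 < M" "\<And>c x d y. c \<in> C \<Longrightarrow> x \<in> KK \<Longrightarrow> d \<in> C \<Longrightarrow> y \<in> KK \<Longrightarrow>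
      real (len (\<delta> c d)) \<le> (davis_dist W S C \<delta> (pt c x) (pt d y) + 2) * M \<and>
      davis_dist W S C \<delta> (pt c x) (pt d y) \<le> (real (len (\<delta> c d)) + 1) * D" "0 \<le> D"
proof -
  obtain M where M: "0 < M" "\<And>c x d y l. c \<in> C \<Longrightarrow> x \<in> KK \<Longrightarrow> d \<in> C \<Longrightarrow> y \<in> KK \<Longrightarrow>
    string (pt c x) (pt d y) l \<Longrightarrow> real (len (\<delta> c d)) \<le> (l + 2) * M"
    by (rule string_lower_bound) blast
  obtain D where D: "0 \<le> D" "\<And>c x d y. c \<in> C \<Longrightarrow> x \<in> KK \<Longrightarrow> d \<in> C \<Longrightarrow> y \<in> KK \<Longrightarrow>
    \<exists>l. l \<le> (real (len (\<delta> c d)) + 1) * D \<and> string (pt c x) (pt d y) l"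
    by (rule string_upper_bound) blast
  have "real (len (\<delta> c d)) \<le> (davis_dist W S C \<delta> (pt c x) (pt d y) + 2) * M \<and>
      davis_dist W S C \<delta> (pt c x) (pt d y) \<le> (real (len (\<delta> c d)) + 1) * D"
    if cd: "c \<in> C" "x \<in> KK" "d \<in> C" "y \<in> KK" for c x d y
  proof
    note ne = davis_dist_Inf[OF davis_pt_closed[OF cd(1,2)] davis_pt_closed[OF cd(3,4)]]
    have "real (len (\<delta> c d)) / M - 2 \<le> davis_dist W S C \<delta> (pt c x) (pt d y)"
      unfolding davis_dist_def
    proof (rule cInf_greatest[OF ne(1)])
      fix l assume "l \<in> {l. string (pt c x) (pt d y) l}"
      then have "real (len (\<delta> c d)) \<le> (l + 2) * M" using M(2)[OF cd] by simp
      then show "real (len (\<delta> c d)) / M - 2 \<le> l" using M(1) by (simp add: field_simps)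
    qed
    then show "real (len (\<delta> c d)) \<le> (davis_dist W S C \<delta> (pt c x) (pt d y) + 2) * M"
      using M(1) by (simp add: field_simps)
    obtain l where "l \<le> (real (len (\<delta> c d)) + 1) * D" "string (pt c x) (pt d y) l" using D(2)[OF cd] by blast
    then show "davis_dist W S C \<delta> (pt c x) (pt d y) \<le> (real (len (\<delta> c d)) + 1) * D"
      unfolding davis_dist_def using cInf_lower[OF _ ne(2), of l] by simp
  qed
  then show ?thesis using that M(1) D(1) by blast
qed

text \<open>One coarse map sends \<open>c\<close> to \<open>pt c (vtx {})\<close>; the other picks a
  chamber for each point of the realization.\<close>

lemma asdim_le_davis_iff:
  "asdim_le (davis W S C \<delta>) (davis_dist W S C \<delta>) n \<longleftrightarrow> asdim_le C (gallery_dist W S \<delta>) n"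
proof -
  obtain M D where M: "0 < M" and D: "0 \<le> D" and QI: "\<And>c x d y. c \<in> C \<Longrightarrow> x \<in> KK \<Longrightarrow> d \<in> C \<Longrightarrow> y \<in> KK \<Longrightarrow>
      real (len (\<delta> c d)) \<le> (davis_dist W S C \<delta> (pt c x) (pt d y) + 2) * M \<and>
      davis_dist W S C \<delta> (pt c x) (pt d y) \<le> (real (len (\<delta> c d)) + 1) * D"
    by (rule davis_quasi_isometry) blast
  let ?d = "davis_dist W S C \<delta>"
  let ?o = "vtx {}"
  have o: "?o \<in> KK" by (rule vtx_K[OF empty_spherical])
  have lower: "real (len (\<delta> c d)) \<le> (B + 2) * M"
    if "c \<in> C" "x \<in> KK" "d \<in> C" "y \<in> KK" "?d (pt c x) (pt d y) \<le> B" for c x d y B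
  proof -
    have "(?d (pt c x) (pt d y) + 2) * M \<le> (B + 2) * M" using that M by (intro mult_right_mono) auto
    then show ?thesis using QI[OF that(1-4)] by linarith
  qed
  have upper: "?d (pt c x) (pt d y) \<le> (B + 1) * D"
    if "c \<in> C" "x \<in> KK" "d \<in> C" "y \<in> KK" "real (len (\<delta> c d)) \<le> B" for c x d y B
  proof -
    have "(real (len (\<delta> c d)) + 1) * D \<le> (B + 1) * D" using that D by (intro mult_right_mono) auto
    then show ?thesis using QI[OF that(1-4)] by linarith
  qed
  show ?thesis
  proof
    assume "asdim_le (davis W S C \<delta>) ?d n"
    then show "asdim_le C (gallery_dist W S \<delta>) n"
    proof (rule asdim_le_coarse_embedding)
      show "pt c ?o \<in> davis W S C \<delta>" if "c \<in> C" for c using davis_pt_closed that o by blast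
      show "\<exists>D'. \<forall>c\<in>C. \<forall>d\<in>C. ?d (pt c ?o) (pt d ?o) \<le> B \<longrightarrow> gallery_dist W S \<delta> c d \<le> D'" for B
        unfolding gallery_dist_def using lower[OF _ o _ o] by blast
      show "\<exists>r'. \<forall>c\<in>C. \<forall>d\<in>C. gallery_dist W S \<delta> c d < r \<longrightarrow> ?d (pt c ?o) (pt d ?o) < r'" for r
      proof (intro exI[of _ "(r + 1) * D + 1"] ballI impI)
        fix c d assume "c \<in> C" "d \<in> C" "gallery_dist W S \<delta> c d < r"
        then have "?d (pt c ?o) (pt d ?o) \<le> (r + 1) * D"
          unfolding gallery_dist_def by (intro upper o) auto
        then show "?d (pt c ?o) (pt d ?o) < (r + 1) * D + 1" by simp
      qed
    qed
  next
    assume C: "asdim_le C (gallery_dist W S \<delta>) n"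
    have "\<forall>p\<in>davis W S C \<delta>. \<exists>z. fst z \<in> C \<and> snd z \<in> KK \<and> p = pt (fst z) (snd z)"
    proof
      fix p assume "p \<in> davis W S C \<delta>"
      then obtain c x where "c \<in> C" "x \<in> KK" "p = pt c x" using davis_iff by blast
      then show "\<exists>z. fst z \<in> C \<and> snd z \<in> KK \<and> p = pt (fst z) (snd z)"
        by (intro exI[of _ "(c, x)"]) simp
    qed
    from bchoice[OF this] obtain z where
      z: "\<forall>p\<in>davis W S C \<delta>. fst (z p) \<in> C \<and> snd (z p) \<in> KK \<and> p = pt (fst (z p)) (snd (z p))" ..
    let ?g = "\<lambda>p. fst (z p)"
    show "asdim_le (davis W S C \<delta>) ?d n"
    proof (rule asdim_le_coarse_embedding[OF C])
      show "?g p \<in> C" if "p \<in> davis W S C \<delta>" for p using z that by blast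
      show "\<exists>D'. \<forall>p\<in>davis W S C \<delta>. \<forall>q\<in>davis W S C \<delta>. gallery_dist W S \<delta> (?g p) (?g q) \<le> B \<longrightarrow> ?d p q \<le> D'" for B
      proof (intro exI[of _ "(B + 1) * D"] ballI impI)
        fix p q assume p: "p \<in> davis W S C \<delta>" "q \<in> davis W S C \<delta>" "gallery_dist W S \<delta> (?g p) (?g q) \<le> B"
        have "?d (pt (?g p) (snd (z p))) (pt (?g q) (snd (z q))) \<le> (B + 1) * D"
          using p z unfolding gallery_dist_def by (intro upper) auto
        then show "?d p q \<le> (B + 1) * D" using z p by metis
      qed
      show "\<exists>r'. \<forall>p\<in>davis W S C \<delta>. \<forall>q\<in>davis W S C \<delta>. ?d p q < r \<longrightarrow> gallery_dist W S \<delta> (?g p) (?g q) < r'" for r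
      proof (intro exI[of _ "(r + 2) * M + 1"] ballI impI)
        fix p q assume p: "p \<in> davis W S C \<delta>" "q \<in> davis W S C \<delta>" "?d p q < r"
        have zp: "?g p \<in> C" "snd (z p) \<in> KK" "p = pt (?g p) (snd (z p))"
          and zq: "?g q \<in> C" "snd (z q) \<in> KK" "q = pt (?g q) (snd (z q))" using z p by blast+
        have "?d (pt (?g p) (snd (z p))) (pt (?g q) (snd (z q))) \<le> r" using p(3) zp(3) zq(3) by simp
        from lower[OF zp(1,2) zq(1,2) this]
        show "gallery_dist W S \<delta> (?g p) (?g q) < (r + 2) * M + 1" unfolding gallery_dist_def by simp
      qed
    qed
  qed
qed

end

end

section \<open>Maps of realizations induced by maps of chambers\<close>

definition davis_map ::
    "('w, 'm) monoid_scheme \<Rightarrow> 'w set \<Rightarrow> 'd set \<Rightarrow> ('d \<Rightarrow> 'd \<Rightarrow> 'w) \<Rightarrow> ('c \<Rightarrow> 'd) \<Rightarrow>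
     ('c \<times> ('w set \<Rightarrow> real)) set \<Rightarrow> ('d \<times> ('w set \<Rightarrow> real)) set" where
  "davis_map W S C' \<delta>' \<phi> p = (let z = (SOME z. z \<in> p) in davis_pt W S C' \<delta>' (\<phi> (fst z)) (snd z))"

text \<open>A map that respects residues respects the gluing, so the choice of representative does
  not matter, and it sends strings to strings with the same block lengths. Two buildings are
  involved because it serves both for the retraction to \<open>W\<close> and for the inclusion of an
  apartment.\<close>

lemma davis_map_properties:
  fixes W :: "('w, 'm) monoid_scheme"
  assumes S: "finite S" and b1: "building W S C E \<delta>" and b2: "building W S C' E' \<delta>'"
    and map: "\<forall>c\<in>C. \<phi> c \<in> C'"
    and resp: "\<forall>J c d. J \<subseteq> S \<longrightarrow> c \<in> C \<longrightarrow> d \<in> C \<longrightarrow> \<delta> c d \<in> generate W J \<longrightarrow>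
      \<delta>' (\<phi> c) (\<phi> d) \<in> generate W J"
  shows davis_map_pt: "c \<in> C \<Longrightarrow> x \<in> davis_K W S \<Longrightarrow>
      davis_map W S C' \<delta>' \<phi> (davis_pt W S C \<delta> c x) = davis_pt W S C' \<delta>' (\<phi> c) x"
    and davis_map_closed: "p \<in> davis W S C \<delta> \<Longrightarrow> davis_map W S C' \<delta>' \<phi> p \<in> davis W S C' \<delta>'"
    and davis_map_dist: "p \<in> davis W S C \<delta> \<Longrightarrow> q \<in> davis W S C \<delta> \<Longrightarrow>
      davis_dist W S C' \<delta>' (davis_map W S C' \<delta>' \<phi> p) (davis_map W S C' \<delta>' \<phi> q) \<le> davis_dist W S C \<delta> p q"
proof -
  interpret A: building W S C E \<delta> by (rule b1)
  interpret B: building W S C' E' \<delta>' by (rule b2)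
  let ?\<Phi> = "davis_map W S C' \<delta>' \<phi>"
  have \<phi>: "\<phi> c \<in> C'" if "c \<in> C" for c using map that by blast
  have pt: "?\<Phi> (A.pt c x) = B.pt (\<phi> c) x" if c: "c \<in> C" and x: "x \<in> davis_K W S" for c x
  proof -
    define z where "z = (SOME z. z \<in> A.pt c x)"
    have "z \<in> A.pt c x" unfolding z_def by (rule someI[of _ "(c, x)"]) (rule A.davis_pt_self[OF c x])
    from A.mem_davis_pt[OF this] have z: "fst z \<in> C" "snd z \<in> davis_K W S" "A.pt (fst z) (snd z) = A.pt c x" by auto
    then have *: "snd z = x" "\<delta> (fst z) c \<in> A.par (davis_type W S x)" using A.pt_eq_iff[of "fst z" "snd z" c x] c x by auto
    have "\<delta>' (\<phi> (fst z)) (\<phi> c) \<in> generate W (davis_type W S x)"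
      by (rule resp[rule_format, OF A.davis_type_subset z(1) c]) (use *(2) A.par_generate[OF A.davis_type_subset] in simp)
    then have "B.pt (\<phi> (fst z)) x = B.pt (\<phi> c) x"
      using B.pt_eq_iff[OF \<phi>[OF z(1)] x \<phi>[OF c] x] A.par_generate[OF A.davis_type_subset] by simp
    then show ?thesis unfolding davis_map_def z_def[symmetric] Let_def *(1) .
  qed
  then show "c \<in> C \<Longrightarrow> x \<in> davis_K W S \<Longrightarrow> ?\<Phi> (A.pt c x) = B.pt (\<phi> c) x" .
  have closed: "?\<Phi> p \<in> davis W S C' \<delta>'" if "p \<in> davis W S C \<delta>" for p
    using that pt \<phi> B.davis_pt_closed unfolding A.davis_iff by fastforce
  then show "p \<in> davis W S C \<delta> \<Longrightarrow> ?\<Phi> p \<in> davis W S C' \<delta>'" .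
  have string: "B.string (?\<Phi> p) (?\<Phi> q) l" if "A.string p q l" for p q l
    using that
  proof (induction rule: davis_string.induct)
    case (base p)
    then show ?case by (intro davis_string.base closed)
  next
    case (step p c x l T y)
    have K: "x \<in> davis_K W S" "y \<in> davis_K W S" using step A.block_K[OF S] by auto
    have "B.string (?\<Phi> p) (B.pt (\<phi> c) x) l" using step pt K by simp
    then have "B.string (?\<Phi> p) (B.pt (\<phi> c) y) (l + block_dist W T x y)"
      by (rule davis_string.step) (use step \<phi> in auto)
    then show ?case using step pt K by simp
  qed
  show "davis_dist W S C' \<delta>' (?\<Phi> p) (?\<Phi> q) \<le> davis_dist W S C \<delta> p q"
    if p: "p \<in> davis W S C \<delta>" and q: "q \<in> davis W S C \<delta>"
    unfolding davis_dist_def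
    by (rule cInf_superset_mono)
      (use A.davis_dist_Inf(1)[OF S p q] B.davis_dist_Inf(2)[OF S closed[OF p] closed[OF q]] string in auto)
qed

context building begin

lemma davis_apartment_isometric:
  assumes S: "finite S" and A: "apartment W C \<delta> A"
  shows "isometric (\<Union>c\<in>A. davis_chamber W S C \<delta> c) (davis_dist W S C \<delta>)
    (davis W S G (cox_dist W)) (davis_dist W S G (cox_dist W))"
proof -
  let ?dW = "davis_dist W S G (cox_dist W)"
  let ?U = "\<Union>c\<in>A. davis_chamber W S C \<delta> c"
  interpret V: building W S G "\<lambda>s. {(v, w). v \<in> G \<and> w \<in> G \<and> (w = v \<or> w = v \<cdot> s)}" "cox_dist W"
    by (rule coxeter_building)
  obtain f where f: "f \<in> G \<rightarrow> C" and fd: "\<forall>v\<in>G. \<forall>w\<in>G. \<delta> (f v) (f w) = cox_dist W v w" and Af: "A = f ` G"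
    using A unfolding apartment_def by blast
  have fC: "f v \<in> C" if "v \<in> G" for v using f that by auto
  \<comment> \<open>The retraction is centred at a chamber of the apartment itself, so that it
    inverts \<open>f\<close>.\<close>
  define \<rho> where "\<rho> = \<delta> (f \<epsilon>)"
  have \<rho>G: "\<rho> c \<in> G" if "c \<in> C" for c unfolding \<rho>_def using dist_closed fC that by simp
  have \<rho>f: "\<rho> (f w) = w" if "w \<in> G" for w unfolding \<rho>_def using fd that by (simp add: cox_dist_def)
  define F where "F = davis_map W S G (cox_dist W) \<rho>"
  define H where "H = davis_map W S C \<delta> f"
  have \<rho>resp: "\<forall>J c d. J \<subseteq> S \<longrightarrow> c \<in> C \<longrightarrow> d \<in> C \<longrightarrow> \<delta> c d \<in> generate W J \<longrightarrow>
    cox_dist W (\<rho> c) (\<rho> d) \<in> generate W J"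
  proof (intro allI impI)
    fix J c d assume J: "J \<subseteq> S" and c: "c \<in> C" and d: "d \<in> C" and cd: "\<delta> c d \<in> generate W J"
    show "cox_dist W (\<rho> c) (\<rho> d) \<in> generate W J"
      unfolding cox_dist_def \<rho>_def
      using dist_retract(2)[OF fC[OF one_closed] c d J] cd par_generate[OF J] by simp
  qed
  have fresp: "\<forall>J v w. J \<subseteq> S \<longrightarrow> v \<in> G \<longrightarrow> w \<in> G \<longrightarrow> cox_dist W v w \<in> generate W J \<longrightarrow>
    \<delta> (f v) (f w) \<in> generate W J"
    using fd by simp
  have maps: "\<forall>c\<in>C. \<rho> c \<in> G" "\<forall>w\<in>G. f w \<in> C" using \<rho>G fC by auto
  note F = davis_map_properties[OF S building_axioms V.building_axioms maps(1) \<rho>resp, folded F_def]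
  note H = davis_map_properties[OF S V.building_axioms building_axioms maps(2) fresp, folded H_def]
  have U: "p \<in> ?U \<longleftrightarrow> (\<exists>w\<in>G. \<exists>x\<in>KK. p = pt (f w) x)" for p
    unfolding Af davis_chamber_def by auto
  have FH: "F (H q) = q" "H q \<in> ?U" if q: "q \<in> davis W S G (cox_dist W)" for q
  proof -
    obtain w x where w: "w \<in> G" "x \<in> KK" "q = V.pt w x" using q V.davis_iff by blast
    have Hq: "H q = pt (f w) x" using H(1)[OF w(1,2)] w(3) by simp
    then show "H q \<in> ?U" using U w by blast
    show "F (H q) = q" using F(1)[OF fC[OF w(1)] w(2)] Hq \<rho>f[OF w(1)] w(3) by simp
  qed
  have HF: "H (F p) = p" "p \<in> davis W S C \<delta>" if p: "p \<in> ?U" for p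
  proof -
    obtain w x where w: "w \<in> G" "x \<in> KK" "p = pt (f w) x" using p U by blast
    show "p \<in> davis W S C \<delta>" using w davis_pt_closed fC by blast
    have "F p = V.pt w x" using F(1)[OF fC[OF w(1)] w(2)] \<rho>f[OF w(1)] w(3) by simp
    then show "H (F p) = p" using H(1)[OF w(1,2)] w(3) by simp
  qed
  show ?thesis
    unfolding isometric_def
  proof (intro exI conjI ballI)
    show "bij_betw F ?U (davis W S G (cox_dist W))"
    proof (rule bij_betw_byWitness[where f' = H])
      show "\<forall>p\<in>?U. H (F p) = p" using HF(1) by blast
      show "\<forall>q\<in>davis W S G (cox_dist W). F (H q) = q" using FH(1) by blast
      show "F ` ?U \<subseteq> davis W S G (cox_dist W)" using F(2) HF(2) by blast
      show "H ` davis W S G (cox_dist W) \<subseteq> ?U" using FH(2) by blast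
    qed
    fix p q assume p: "p \<in> ?U" and q: "q \<in> ?U"
    \<comment> \<open>Strings measuring the ambient distance may leave the apartment; since
      \<open>F\<close> is defined on the whole realization, they too are carried into
      \<open>W\<close>.\<close>
    have "?dW (F p) (F q) \<le> davis_dist W S C \<delta> p q" by (rule F(3)[OF HF(2)[OF p] HF(2)[OF q]])
    moreover have "davis_dist W S C \<delta> (H (F p)) (H (F q)) \<le> ?dW (F p) (F q)"
      by (rule H(3)[OF F(2)[OF HF(2)[OF p]] F(2)[OF HF(2)[OF q]]])
    ultimately show "?dW (F p) (F q) = davis_dist W S C \<delta> p q" using HF(1)[OF p] HF(1)[OF q] by simp
  qed
qed

end

theorem theorem1:
  fixes W :: "('w, 'm) monoid_scheme" and S :: "'w set"
    and C :: "'c set" and E :: "'w \<Rightarrow> ('c \<times> 'c) set" and \<delta> :: "'c \<Rightarrow> 'c \<Rightarrow> 'w"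
  assumes "finite S" and "building W S C E \<delta>"
  shows
    "(asdim C (gallery_dist W S \<delta>) \<noteq> \<infinity> \<and>
      asdim C (gallery_dist W S \<delta>) = asdim (carrier W) (gallery_dist W S (cox_dist W)) \<and>
      (\<forall>A. apartment W C \<delta> A \<longrightarrow>
         isometric A (gallery_dist W S \<delta>) (carrier W) (gallery_dist W S (cox_dist W)) \<and>
         asdim C (gallery_dist W S \<delta>) = asdim A (gallery_dist W S \<delta>)))
     \<and>
     (asdim (davis W S C \<delta>) (davis_dist W S C \<delta>) \<noteq> \<infinity> \<and>
      asdim (davis W S C \<delta>) (davis_dist W S C \<delta>) =
        asdim (davis W S (carrier W) (cox_dist W)) (davis_dist W S (carrier W) (cox_dist W)) \<and>
      (\<forall>A. apartment W C \<delta> A \<longrightarrow>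
         isometric (\<Union>c\<in>A. davis_chamber W S C \<delta> c) (davis_dist W S C \<delta>)
           (davis W S (carrier W) (cox_dist W)) (davis_dist W S (carrier W) (cox_dist W)) \<and>
         asdim (davis W S C \<delta>) (davis_dist W S C \<delta>) =
           asdim (\<Union>c\<in>A. davis_chamber W S C \<delta> c) (davis_dist W S C \<delta>)))"
proof -
  interpret building W S C E \<delta> by (rule assms(2))
  interpret V: building W S G "\<lambda>s. {(v, w). v \<in> G \<and> w \<in> G \<and> (w = v \<or> w = v \<cdot> s)}" "cox_dist W"
    by (rule coxeter_building)
  let ?gC = "gallery_dist W S \<delta>" and ?gW = "gallery_dist W S (cox_dist W)"
  let ?dC = "davis_dist W S C \<delta>" and ?dW = "davis_dist W S G (cox_dist W)"
  have CW: "asdim C ?gC = asdim G ?gW"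
    by (rule asdim_cong) (rule asdim_le_building_iff[OF assms(1)])
  have dC: "asdim (davis W S C \<delta>) ?dC = asdim C ?gC"
    by (rule asdim_cong) (rule asdim_le_davis_iff[OF assms(1)])
  have dW: "asdim (davis W S G (cox_dist W)) ?dW = asdim G ?gW"
    by (rule asdim_cong) (rule V.asdim_le_davis_iff[OF assms(1)])
  obtain n where "asdim_le G ?gW n" by (rule asdim_le_coxeter_group[OF assms(1)])
  then have fin: "asdim G ?gW \<noteq> \<infinity>" by (rule asdim_finite)
  have apt: "isometric A ?gC G ?gW" "asdim C ?gC = asdim A ?gC" if "apartment W C \<delta> A" for A
    using apartment_isometric[OF that] asdim_isometric[OF apartment_isometric[OF that]] CW by auto
  have dapt: "isometric (\<Union>c\<in>A. davis_chamber W S C \<delta> c) ?dC (davis W S G (cox_dist W)) ?dW"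
    "asdim (davis W S C \<delta>) ?dC = asdim (\<Union>c\<in>A. davis_chamber W S C \<delta> c) ?dC"
    if "apartment W C \<delta> A" for A
    using davis_apartment_isometric[OF assms(1) that]
      asdim_isometric[OF davis_apartment_isometric[OF assms(1) that]] CW dC dW by auto
  show ?thesis using CW dC dW fin apt dapt by simp
qed

end
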